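(* Let $k\ge1$, let the atomic step set $\mathcal A\subset\mathbb R^k$ be (up to rescaling) either $\{\pm e^{(1)},\dots,\pm e^{(k)}\}$ or $\{\sum_{j=1}^k\varepsilon_j e^{(j)}:\varepsilon_j\in\{-1,+1\}\}$, and let $\mathcal S$ be a finite composite step set over $\mathcal A$ with weight function $w:\mathcal S\to\mathbb R_+$ such that for every $(a_1,\dots,a_m)\in\mathcal S$, every $j\le m$ and every $\rho\in B_k$, $(\rho(a_1),\dots,\rho(a_j),a_{j+1},\dots,a_m)\in\mathcal S$ with the same weight. Let $S(z_1,\dots,z_k)$ be the composite step generating function and assume $S(1,\dots,1)>0$. Then for every $\vec u=(u_1,\dots,u_k)\in\mathcal W^0\cap\mathcal L$, \[ P_n^+(\vec u)=S(1,\dots,1)^n\left( \frac{2}{\pi} \right)^{k/2}\left( \frac{S(1,\dots,1)}{nS''(1,\dots,1)} \right)^{k^2/2}\left( \prod_{j=1}^k\frac{u_j(j-1)!}{(2j-1)!} \right)\left( \prod_{1\le j<m\le k}(u_m^2-u_j^2) \right)\left( 1+O\left( n^{-1} \right) \right) \] as $n\to\infty$, where $S''(1,\dots,1)$ is the second derivative of $S$ with respect to any one of the $z_j$, evaluated at $(1,\dots,1)$.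
   Context: $e^{(j)}$ are the standard basis vectors; $B_k$ is the group of signed permutations of coordinates (generated by reflections in $x_i=x_j$ and $x_1=0$). A composite step is a finite sequence of atomic steps moving the walker by their sum. $\mathcal L$ is the $\mathbb Z$-lattice spanned by $\mathcal A$, $\mathcal W^0=\{0<x_1<\dots<x_k\}$. $S(\vec z)=\sum_{(a_1,\dots,a_m)\in\mathcal S}w((a_1,\dots,a_m))\vec z^{\,a_1+\dots+a_m}$. $P_n^+(\vec u)$ is the total weight (product of the weights of the composite steps) of all $n$-step walks with steps from $\mathcal S$ starting at $\vec u$, with arbitrary end point, all of whose positions lie in $\mathcal W^0$. *)

theory Defs
  imports
    "HOL-Analysis.Analysis"
    "HOL-Combinatorics.Permutations"
    "HOL-Library.Landau_Symbols"
begin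

text \<open>
  A vector of \<open>\<real>\<^sup>k\<close> is a function with coordinates at \<open>1, \<dots>, k\<close> that vanishes at every other
  index, so \<open>k\<close> is an ordinary natural number and coordinates keep their one-based numbering.
\<close>

type_synonym rvec = "nat \<Rightarrow> real"

definition vec_space :: "nat \<Rightarrow> rvec set" where
  "vec_space k = {x. \<forall>i. i \<notin> {1..k} \<longrightarrow> x i = 0}"

definition std_basis :: "nat \<Rightarrow> rvec" where
  "std_basis j = (\<lambda>i. if i = j then 1 else 0)"

definition rescale :: "real \<Rightarrow> rvec \<Rightarrow> rvec" where
  "rescale c x = (\<lambda>i. c * x i)"

definition vsum :: "rvec list \<Rightarrow> rvec" where
  "vsum as = (\<lambda>i. \<Sum>a\<leftarrow>as. a i)"

definition axis_steps :: "nat \<Rightarrow> rvec set" where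
  "axis_steps k = {rescale s (std_basis j) | s j. s \<in> {-1, 1} \<and> j \<in> {1..k}}"

definition diagonal_steps :: "nat \<Rightarrow> rvec set" where
  "diagonal_steps k =
     {(\<lambda>i. \<Sum>j = 1..k. s j * std_basis j i) | s. \<forall>j\<in>{1..k}. s j \<in> {-1, 1}}"

definition signed_perms :: "nat \<Rightarrow> (rvec \<Rightarrow> rvec) set" where
  "signed_perms k =
     {(\<lambda>x i. if i \<in> {1..k} then s i * x (p i) else 0) | s p.
        (\<forall>i\<in>{1..k}. s i \<in> {-1, 1}) \<and> p permutes {1..k}}"

text \<open>The integer span of a finite set of vectors.\<close>

definition int_lattice :: "rvec set \<Rightarrow> rvec set" where
  "int_lattice A = {(\<lambda>i. \<Sum>a\<in>A. of_int (n a) * a i) | n :: rvec \<Rightarrow> int. True}"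

definition chamber :: "nat \<Rightarrow> rvec set" where
  "chamber k = {x \<in> vec_space k. 0 < x 1 \<and> (\<forall>j\<in>{1..<k}. x j < x (Suc j))}"

text \<open>A composite step is the list of its atomic steps; the empty list is the step that does not
  move the walker.\<close>

definition composite_step_set ::
    "rvec set \<Rightarrow> rvec list set \<Rightarrow> (rvec list \<Rightarrow> real) \<Rightarrow> bool" where
  "composite_step_set A S w \<longleftrightarrow> finite S \<and> S \<subseteq> lists A \<and> (\<forall>s\<in>S. 0 \<le> w s)"

definition prefix_invariant ::
    "nat \<Rightarrow> rvec list set \<Rightarrow> (rvec list \<Rightarrow> real) \<Rightarrow> bool" where
  "prefix_invariant k S w \<longleftrightarrow>
     (\<forall>s\<in>S. \<forall>j\<in>{1..length s}. \<forall>\<rho>\<in>signed_perms k.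
        map \<rho> (take j s) @ drop j s \<in> S \<and> w (map \<rho> (take j s) @ drop j s) = w s)"

text \<open>The step generating function at a point with positive coordinates. Real exponents are
  needed because the coordinates of rescaled atomic steps need not be integers.\<close>

definition step_gf ::
    "nat \<Rightarrow> rvec list set \<Rightarrow> (rvec list \<Rightarrow> real) \<Rightarrow> (nat \<Rightarrow> real) \<Rightarrow> real" where
  "step_gf k S w z = (\<Sum>s\<in>S. w s * (\<Prod>j = 1..k. z j powr vsum s j))"

definition step_gf_one :: "nat \<Rightarrow> rvec list set \<Rightarrow> (rvec list \<Rightarrow> real) \<Rightarrow> real" where
  "step_gf_one k S w = step_gf k S w (\<lambda>_. 1)"

text \<open>The second partial derivative with respect to the variable of index \<open>l\<close>, at
  \<open>(1, \<dots>, 1)\<close>.\<close>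

definition step_gf_snd_deriv_one ::
    "nat \<Rightarrow> rvec list set \<Rightarrow> (rvec list \<Rightarrow> real) \<Rightarrow> nat \<Rightarrow> real" where
  "step_gf_snd_deriv_one k S w l =
     (deriv ^^ 2) (\<lambda>t. step_gf k S w ((\<lambda>_. 1)(l := t))) 1"

text \<open>The positions of a walk include those reached after each atomic step inside a composite
  step, not only the end points of the composite steps.\<close>

definition stays_in_chamber :: "nat \<Rightarrow> rvec \<Rightarrow> rvec list list \<Rightarrow> bool" where
  "stays_in_chamber k u ss \<longleftrightarrow>
     (\<forall>i \<le> length (concat ss). (\<lambda>l. u l + vsum (take i (concat ss)) l) \<in> chamber k)"

definition walk_weight ::
    "nat \<Rightarrow> rvec list set \<Rightarrow> (rvec list \<Rightarrow> real) \<Rightarrow> nat \<Rightarrow> rvec \<Rightarrow> real" where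
  "walk_weight k S w n u =
     (\<Sum>ss \<in> {ss. ss \<in> lists S \<and> length ss = n \<and> stays_in_chamber k u ss}. prod_list (map w ss))"

end

theory Submission
  imports
    Defs
    "Jordan_Normal_Form.Determinant"
    "HOL-Probability.Probability"
    "HOL-Real_Asymp.Real_Asymp"
begin

text \<open>
  Prefix invariance under the transitive group \<open>B\<^sub>k\<close> forces \<open>\<S>\<close> to consist of all sequences of atomic
  steps of certain lengths, with weights depending on the length only. Hence \<open>S(z) = p(\<Sigma>(z))\<close> for a
  polynomial \<open>p\<close>, where \<open>\<Sigma>\<close> is the generating function of the atomic steps, and the weights of walks
  are obtained by substituting the numbers \<open>a\<^sub>m(u)\<close> of atomic \<open>m\<close>-step walks for the powers of \<open>x\<close> in
  \<open>p(x)\<^sup>n\<close>.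

  The alternant \<open>\<Sum>\<^sub>\<sigma> sgn \<sigma> \<Prod>\<^sub>j (z\<^sub>j\<^bsup>-u\<^sub>\<sigma>\<^sub>j\<^esup> - z\<^sub>j\<^bsup>u\<^sub>\<sigma>\<^sub>j\<^esup>)\<close> vanishes for \<open>u\<close> on the walls and is
  mapped by multiplication with \<open>\<Sigma>(z)\<close> to the sum of its neighbours in \<open>u\<close>. So \<open>a\<^sub>m(u)\<close> is the constant
  term of \<open>\<Sigma>(z)\<^sup>m\<close> times the alternant times any kernel that gives the value \<open>1\<close> for \<open>m = 0\<close>. By
  Schur's identity the Littlewood kernel \<open>\<Prod>\<^sub>j z\<^sub>j/(1-z\<^sub>j) \<Prod>\<^sub>j\<^sub><\<^sub>m (z\<^sub>m-z\<^sub>j)/(1-z\<^sub>jz\<^sub>m)\<close>, expanded for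
  \<open>|z\<^sub>j| < 1\<close>, is such a kernel. All its poles are cancelled by the alternant, so the radii can tend to
  \<open>1\<close>, and on the unit torus the product becomes \<open>\<Prod>\<^sub>j\<^sub><\<^sub>m |z\<^sub>m-z\<^sub>j|\<^sup>2\<close> times a smooth function. Thus
  Laplace's method leads to the Mehta integral with the square of the Vandermonde determinant, which
  Hermite polynomials evaluate. The other points of maximal modulus contribute a factor \<open>O(1/n)\<close>
  less, since the smooth function vanishes there to second order.
\<close>

section \<open>Determinants of polynomial values\<close>

text \<open>The poles of the kernel must be cancelled without limits at colliding variables. In the
  variables \<open>cosh_var z\<close> = e^z + e^(-z) - 2 the alternant is, up to elementary factors,
  a determinant of polynomial values. Newton interpolation splits off the Vandermonde product
  exactly; the cofactor, a determinant of divided differences, is a polynomial even where nodes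
  coincide. Its value at 0 produces the dependence on u, and its Lipschitz bound at 0 is part of the
  error estimate. Diagonal steps, in units of twice their coordinates, alternate between Z^k and (Z
  + 1/2)^k. Hence two parities occur: \<open>e\<close> at the start, which selects the polynomials,
  and \<open>e'\<close> after m steps, which enters as a phase only. As \<open>e'\<close> depends on
  m, p(x)^n cannot simply be evaluated at the symbol; its coefficients serve as nonnegative weights,
  and the kernel is estimated uniformly in m. Only real parts are integrated. The phase then
  deviates from 1 to second order; bounding a first order deviation in absolute value would give no
  better than O(n^(-1/2)).\<close>

fun newton_quot :: "'a::comm_ring_1 poly \<Rightarrow> (nat \<Rightarrow> 'a) \<Rightarrow> nat \<Rightarrow> 'a poly" where
  "newton_quot p t 0 = p"
| "newton_quot p t (Suc i) = synthetic_div (newton_quot p t i) (t i)"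

text \<open>The divided difference p[t_0, ..., t_i], obtained by synthetic division rather than by
  difference quotients: nothing is divided by t_i - t_j, so nodes may coincide and the value is a
  polynomial in the nodes.\<close>

definition divided_diff :: "'a::comm_ring_1 poly \<Rightarrow> (nat \<Rightarrow> 'a) \<Rightarrow> nat \<Rightarrow> 'a" where
  "divided_diff p t i = poly (newton_quot p t i) (t i)"

definition vandermonde :: "nat \<Rightarrow> (nat \<Rightarrow> 'a::comm_ring_1) \<Rightarrow> 'a" where
  "vandermonde k t = (\<Prod>m<k. \<Prod>j<m. t m - t j)"

lemma newton_interpolation:
  "poly p x = (\<Sum>i<N. divided_diff p t i * (\<Prod>l<i. x - t l))
     + poly (newton_quot p t N) x * (\<Prod>l<N. x - t l)"
proof (induction N)
  case (Suc N)
  have "poly (newton_quot p t N) x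
      = poly ([:- t N, 1:] * synthetic_div (newton_quot p t N) (t N)
          + [:poly (newton_quot p t N) (t N):]) x"
    by (simp only: synthetic_div_correct')
  then have "poly (newton_quot p t N) x
      = (x - t N) * poly (newton_quot p t (Suc N)) x + divided_diff p t N"
    by (simp add: divided_diff_def algebra_simps)
  then show ?case
    by (simp only: Suc.IH sum.lessThan_Suc prod.lessThan_Suc) (simp only: algebra_simps)
qed simp

text \<open>Newton's interpolation formula factors the matrix of values into the lower triangular
  matrix of the Newton basis, whose determinant is the Vandermonde product, and the matrix of
  divided differences.\<close>

lemma det_poly_eval:
  fixes q :: "nat \<Rightarrow> 'a::idom poly"
  shows "Determinant.det (Matrix.mat k k (\<lambda>(i, j). poly (q j) (t i)))
     = vandermonde k t * Determinant.det (Matrix.mat k k (\<lambda>(i, j). divided_diff (q j) t i))"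
proof -
  define L where "L = Matrix.mat k k (\<lambda>(i, j). \<Prod>l<j. t i - t l)"
  define D where "D = Matrix.mat k k (\<lambda>(i, j). divided_diff (q j) t i)"
  have L: "L \<in> carrier_mat k k" and D: "D \<in> carrier_mat k k"
    by (auto simp: L_def D_def)
  have zero: "(\<Prod>l<j. t i - t l) = 0" if "i < j" for i j
    using that by (intro prod_zero) auto
  have "Matrix.mat k k (\<lambda>(i, j). poly (q j) (t i)) = L * D"
  proof (rule eq_matI)
    fix i j assume "i < dim_row (L * D)" "j < dim_col (L * D)"
    then have ij: "i < k" "j < k" by (auto simp: L_def D_def)
    \<comment> \<open>At a node \<open>t i\<close> with i < k the remainder of order k vanishes, so
      the expansion is exact.\<close>
    have "poly (q j) (t i) = (\<Sum>r<k. divided_diff (q j) t r * (\<Prod>l<r. t i - t l))"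
      using newton_interpolation[of "q j" "t i" t k] zero[OF ij(1)] by simp
    then show "Matrix.mat k k (\<lambda>(i, j). poly (q j) (t i)) $$ (i, j) = (L * D) $$ (i, j)"
      using ij by (simp add: L_def D_def scalar_prod_def atLeast0LessThan mult.commute)
  qed (auto simp: L_def D_def)
  moreover have "Determinant.det L = vandermonde k t"
  proof -
    have "Determinant.det L = prod_list (diag_mat L)"
      by (rule det_lower_triangular[OF _ L]) (auto simp: L_def zero)
    also have "\<dots> = (\<Prod>i<k. \<Prod>l<i. t i - t l)"
      by (auto simp: diag_mat_def L_def prod.list_conv_set_nth atLeast0LessThan intro!: prod.cong)
    finally show ?thesis by (simp add: vandermonde_def)
  qed
  ultimately show ?thesis
    using det_mult[OF L D] by (simp add: D_def)
qed

lemma coeff_synthetic_div: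
  "coeff (synthetic_div p c) n = coeff p (Suc n) + c * coeff (synthetic_div p c) (Suc n)"
proof -
  have "coeff (p + Polynomial.smult c (synthetic_div p c)) (Suc n) = coeff (pCons (poly p c) (synthetic_div p c)) (Suc n)"
    by (simp only: synthetic_div_correct)
  then show ?thesis by simp
qed

lemma degree_newton_quot: "degree (newton_quot p t i) = degree p - i"
  by (induction i) (auto simp: degree_synthetic_div)

lemma newton_quot_eq_0: "degree p < i \<Longrightarrow> newton_quot p t i = 0"
proof (induction i)
  case (Suc i)
  have "degree (newton_quot p t i) = 0"
    using Suc.prems by (simp add: degree_newton_quot)
  then show ?case by (simp add: synthetic_div_eq_0_iff)
qed simp

lemma coeff_newton_quot_top:
  "degree p \<le> j \<Longrightarrow> i \<le> j \<Longrightarrow> coeff (newton_quot p t i) (j - i) = coeff p j"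
proof (induction i)
  case (Suc i)
  have "coeff (synthetic_div (newton_quot p t i) (t i)) (Suc (j - Suc i)) = 0"
    using Suc.prems by (intro coeff_eq_0) (simp add: degree_synthetic_div degree_newton_quot)
  then have "coeff (newton_quot p t (Suc i)) (j - Suc i) = coeff (newton_quot p t i) (Suc (j - Suc i))"
    by (simp add: coeff_synthetic_div[of _ _ "j - Suc i"])
  then show ?case using Suc by (simp add: Suc_diff_Suc)
qed simp

text \<open>A divided difference of order i kills polynomials of degree below i and returns the
  coefficient of index i in degree at most i, so the second factor in \<open>det_poly_eval\<close>
  is upper triangular.\<close>

lemma det_poly_eval_triangular:
  fixes q :: "nat \<Rightarrow> 'a::idom poly"
  assumes deg: "\<And>j. j < k \<Longrightarrow> degree (q j) \<le> j"
  shows "Determinant.det (Matrix.mat k k (\<lambda>(i, j). poly (q j) (t i))) = vandermonde k t * (\<Prod>j<k. coeff (q j) j)"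
proof -
  define D where "D = Matrix.mat k k (\<lambda>(i, j). divided_diff (q j) t i)"
  have diag: "divided_diff (q j) t j = coeff (q j) j" if "j < k" for j
  proof -
    have "degree (newton_quot (q j) t j) = 0"
      using deg[OF that] by (simp add: degree_newton_quot)
    then obtain c where "newton_quot (q j) t j = [:c:]"
      using degree_eq_zeroE by blast
    then show ?thesis
      using coeff_newton_quot_top[OF deg[OF that] order_refl, of t] by (simp add: divided_diff_def)
  qed
  have "Determinant.det D = prod_list (diag_mat D)"
  proof (rule det_upper_triangular)
    show "upper_triangular D"
      unfolding upper_triangular_def
    proof (intro allI impI)
      fix i j assume "i < dim_row D" "j < i"
      then have "degree (q j) < i" "i < k" "j < k" using deg[of j] by (auto simp: D_def)
      then show "D $$ (i, j) = 0" by (simp add: D_def divided_diff_def newton_quot_eq_0)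
    qed
  qed (auto simp: D_def)
  also have "\<dots> = (\<Prod>j<k. coeff (q j) j)"
    using diag by (auto simp: diag_mat_def D_def prod.list_conv_set_nth atLeast0LessThan intro!: prod.cong)
  finally show ?thesis by (simp add: det_poly_eval D_def)
qed

text \<open>Read off from a row permutation in the determinant of the monomials, whose value is the
  Vandermonde product.\<close>

lemma vandermonde_permute:
  fixes t :: "nat \<Rightarrow> 'a::idom"
  assumes p: "p permutes {..<k}"
  shows "vandermonde k (t \<circ> p) = of_int (sign p) * vandermonde k t"
proof -
  define A where "A = Matrix.mat k k (\<lambda>(i, j). poly (monom 1 j) (t i))"
  have A: "A \<in> carrier_mat k k" by (simp add: A_def)
  have p': "p permutes {0..<k}" using p by (simp add: atLeast0LessThan)
  have "Matrix.mat k k (\<lambda>(i, j). poly (monom 1 j) ((t \<circ> p) i)) = Matrix.mat k k (\<lambda>(i, j). A $$ (p i, j))"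
    using permutes_in_image[OF p] by (intro eq_matI) (auto simp: A_def)
  then have "Determinant.det (Matrix.mat k k (\<lambda>(i, j). poly (monom 1 j) ((t \<circ> p) i))) = of_int (sign p) * Determinant.det A"
    using Determinant.det_permute_rows[OF A p'] by simp
  then show ?thesis
    by (simp only: A_def det_poly_eval_triangular degree_monom_le) (simp add: comp_def)
qed

lemma newton_quot_0: "coeff (newton_quot p (\<lambda>_. 0) i) n = coeff p (n + i)"
proof (induction i arbitrary: n)
  case (Suc i)
  show ?case by (simp add: coeff_synthetic_div[of _ _ n] Suc)
qed simp

lemma divided_diff_0: "divided_diff p (\<lambda>_. 0) i = coeff p i"
  using newton_quot_0[of p i 0] by (simp add: divided_diff_def poly_0_coeff_0)

section \<open>Polynomial functions of k complex variables\<close>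

inductive mpoly_fun :: "nat \<Rightarrow> ((nat \<Rightarrow> complex) \<Rightarrow> complex) \<Rightarrow> bool" for k where
  const: "mpoly_fun k (\<lambda>s. c)"
| coord: "i < k \<Longrightarrow> mpoly_fun k (\<lambda>s. s i)"
| add: "mpoly_fun k f \<Longrightarrow> mpoly_fun k g \<Longrightarrow> mpoly_fun k (\<lambda>s. f s + g s)"
| mult: "mpoly_fun k f \<Longrightarrow> mpoly_fun k g \<Longrightarrow> mpoly_fun k (\<lambda>s. f s * g s)"

lemma mpoly_fun_sum: "(\<And>x. x \<in> X \<Longrightarrow> mpoly_fun k (f x)) \<Longrightarrow> mpoly_fun k (\<lambda>s. \<Sum>x\<in>X. f x s)"
  by (induction X rule: infinite_finite_induct) (auto intro: mpoly_fun.intros)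

lemma mpoly_fun_prod: "(\<And>x. x \<in> X \<Longrightarrow> mpoly_fun k (f x)) \<Longrightarrow> mpoly_fun k (\<lambda>s. \<Prod>x\<in>X. f x s)"
  by (induction X rule: infinite_finite_induct) (auto intro: mpoly_fun.intros)

text \<open>Synthetic division determines coefficients from the top: the n-th one is the (n+1)-st of
  the dividend plus \<open>s i\<close> times the (n+1)-st of the quotient. Hence a descending
  induction on n inside the induction on i, starting at the degree of \<open>p\<close>, from which
  on all coefficients of the quotient vanish.\<close>

lemma mpoly_fun_newton_quot:
  assumes "i \<le> k"
  shows "mpoly_fun k (\<lambda>s. coeff (newton_quot p s i) n)"
  using assms
proof (induction i arbitrary: n)
  case (Suc i)
  let ?N = "degree p"
  have top: "mpoly_fun k (\<lambda>s. coeff (newton_quot p s (Suc i)) n)" if "?N \<le> n" for n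
  proof -
    have "coeff (newton_quot p s (Suc i)) n = 0" for s
    proof (cases "?N < Suc i")
      case False
      then show ?thesis using that degree_newton_quot[of p s "Suc i"]
        by (intro coeff_eq_0) simp
    qed (metis newton_quot_eq_0 coeff_0)
    then show ?thesis by (simp add: mpoly_fun.const del: newton_quot.simps)
  qed
  show ?case
  proof (cases "n \<le> ?N")
    case True
    then show ?thesis
    proof (induction n rule: inc_induct)
      case (step n)
      have "mpoly_fun k (\<lambda>s. coeff (newton_quot p s i) (Suc n) + s i * coeff (newton_quot p s (Suc i)) (Suc n))"
        using Suc step by (intro mpoly_fun.intros) auto
      then show ?case by (simp add: coeff_synthetic_div[of _ _ n])
    qed (rule top, simp)
  qed (rule top, simp)
qed (simp add: mpoly_fun.const)

lemma mpoly_fun_power: "mpoly_fun k f \<Longrightarrow> mpoly_fun k (\<lambda>s. f s ^ n)"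
  by (induction n) (auto intro: mpoly_fun.intros)

lemma mpoly_fun_divided_diff:
  assumes "i < k"
  shows "mpoly_fun k (\<lambda>s. divided_diff p s i)"
proof -
  have eq: "divided_diff p s i = (\<Sum>n\<le>degree p. coeff (newton_quot p s i) n * s i ^ n)" for s
    unfolding divided_diff_def poly_altdef
    by (rule sum.mono_neutral_left) (auto simp: degree_newton_quot intro!: coeff_eq_0)
  show ?thesis unfolding eq
    using assms by (intro mpoly_fun_sum mpoly_fun.mult mpoly_fun_newton_quot mpoly_fun_power mpoly_fun.coord) auto
qed

lemma mpoly_fun_det:
  assumes "\<And>i j. i < k \<Longrightarrow> j < k \<Longrightarrow> mpoly_fun k (f i j)"
  shows "mpoly_fun k (\<lambda>s. Determinant.det (Matrix.mat k k (\<lambda>(i, j). f i j s)))"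
proof -
  have eq: "Determinant.det (Matrix.mat k k (\<lambda>(i, j). f i j s))
     = (\<Sum>p | p permutes {0..<k}. of_int (sign p) * (\<Prod>i = 0..<k. f i (p i) s))" for s
  proof -
    have "Determinant.det (Matrix.mat k k (\<lambda>(i, j). f i j s)) = (\<Sum>p | p permutes {0..<k}. of_int (sign p)
        * (\<Prod>i = 0..<k. Matrix.mat k k (\<lambda>(i, j). f i j s) $$ (i, p i)))"
      by (rule det_def') simp
    also have "\<dots> = (\<Sum>p | p permutes {0..<k}. of_int (sign p) * (\<Prod>i = 0..<k. f i (p i) s))"
      by (intro sum.cong refl arg_cong2[where f = "(*)"] prod.cong) (auto dest: permutes_in_image)
    finally show ?thesis .
  qed
  show ?thesis unfolding eq
    by (intro mpoly_fun_sum mpoly_fun.mult mpoly_fun.const mpoly_fun_prod assms)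
       (auto dest: permutes_in_image)
qed

lemma mpoly_fun_tendsto:
  assumes "mpoly_fun k f" "\<And>i. i < k \<Longrightarrow> ((\<lambda>n. g n i) \<longlongrightarrow> x i) F"
  shows "((\<lambda>n. f (g n)) \<longlongrightarrow> f x) F"
  using assms by induction (auto intro: tendsto_intros)

lemma mpoly_fun_measurable:
  assumes "mpoly_fun k f" "\<And>i. i < k \<Longrightarrow> (\<lambda>w. g w i) \<in> borel_measurable M"
  shows "(\<lambda>w. f (g w)) \<in> borel_measurable M"
  using assms by induction auto

lemma mpoly_fun_bounded:
  assumes "mpoly_fun k f" "R \<ge> 0"
  shows "\<exists>C\<ge>0. \<forall>s. (\<forall>i<k. norm (s i) \<le> R) \<longrightarrow> norm (f s) \<le> C"
  using assms(1)
proof induction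
  case (const c)
  show ?case by (intro exI[of _ "norm c"]) auto
next
  case (coord i)
  then show ?case using assms(2) by (intro exI[of _ R]) auto
next
  case (add f g)
  then obtain C D where C: "C \<ge> 0" "\<And>s. (\<forall>i<k. norm (s i) \<le> R) \<Longrightarrow> norm (f s) \<le> C"
    and D: "D \<ge> 0" "\<And>s. (\<forall>i<k. norm (s i) \<le> R) \<Longrightarrow> norm (g s) \<le> D" by metis
  have "norm (f s + g s) \<le> C + D" if "\<forall>i<k. norm (s i) \<le> R" for s
    using C(2)[OF that] D(2)[OF that] norm_triangle_ineq[of "f s" "g s"] by linarith
  then show ?case using C(1) D(1) by (intro exI[of _ "C + D"]) auto
next
  case (mult f g)
  then obtain C D where C: "C \<ge> 0" "\<And>s. (\<forall>i<k. norm (s i) \<le> R) \<Longrightarrow> norm (f s) \<le> C"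
    and D: "D \<ge> 0" "\<And>s. (\<forall>i<k. norm (s i) \<le> R) \<Longrightarrow> norm (g s) \<le> D" by metis
  have "norm (f s * g s) \<le> C * D" if "\<forall>i<k. norm (s i) \<le> R" for s
    unfolding norm_mult using C(1) C(2)[OF that] D(2)[OF that] by (intro mult_mono) auto
  then show ?case using C(1) D(1) by (intro exI[of _ "C * D"]) auto
qed

text \<open>Only increments from the origin are controlled; this suffices to compare the kernel with
  its value at the point of maximal modulus.\<close>

lemma mpoly_fun_lipschitz:
  assumes "mpoly_fun k f" "R \<ge> 0"
  shows "\<exists>C\<ge>0. \<forall>s. (\<forall>i<k. norm (s i) \<le> R) \<longrightarrow> norm (f s - f (\<lambda>_. 0)) \<le> C * (\<Sum>i<k. norm (s i))"
  using assms(1)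
proof induction
  case (const c)
  show ?case by (intro exI[of _ 0]) auto
next
  case (coord i)
  then have "norm (s i) \<le> 1 * (\<Sum>i<k. norm (s i))" for s :: "nat \<Rightarrow> complex"
    using member_le_sum[of i "{..<k}" "\<lambda>i. norm (s i)"] by auto
  then show ?case by (intro exI[of _ 1]) auto
next
  case (add f g)
  then obtain C D where C: "C \<ge> 0" "\<And>s. (\<forall>i<k. norm (s i) \<le> R) \<Longrightarrow> norm (f s - f (\<lambda>_. 0)) \<le> C * (\<Sum>i<k. norm (s i))"
    and D: "D \<ge> 0" "\<And>s. (\<forall>i<k. norm (s i) \<le> R) \<Longrightarrow> norm (g s - g (\<lambda>_. 0)) \<le> D * (\<Sum>i<k. norm (s i))" by metis
  have "norm (f s + g s - (f (\<lambda>_. 0) + g (\<lambda>_. 0))) \<le> (C + D) * (\<Sum>i<k. norm (s i))"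
    if "\<forall>i<k. norm (s i) \<le> R" for s
    using C(2)[OF that] D(2)[OF that] norm_triangle_ineq[of "f s - f (\<lambda>_. 0)" "g s - g (\<lambda>_. 0)"]
    by (simp add: algebra_simps)
  then show ?case using C(1) D(1) by (intro exI[of _ "C + D"]) auto
next
  case (mult f g)
  obtain B where B: "B \<ge> 0" "\<And>s. (\<forall>i<k. norm (s i) \<le> R) \<Longrightarrow> norm (f s) \<le> B"
    using mpoly_fun_bounded[OF mult.hyps(1) assms(2)] by metis
  obtain C D where C: "C \<ge> 0" "\<And>s. (\<forall>i<k. norm (s i) \<le> R) \<Longrightarrow> norm (f s - f (\<lambda>_. 0)) \<le> C * (\<Sum>i<k. norm (s i))"
    and D: "D \<ge> 0" "\<And>s. (\<forall>i<k. norm (s i) \<le> R) \<Longrightarrow> norm (g s - g (\<lambda>_. 0)) \<le> D * (\<Sum>i<k. norm (s i))"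
    using mult.IH by metis
  let ?G = "norm (g (\<lambda>_. 0))"
  have "norm (f s * g s - f (\<lambda>_. 0) * g (\<lambda>_. 0)) \<le> (B * D + C * ?G) * (\<Sum>i<k. norm (s i))"
    if s: "\<forall>i<k. norm (s i) \<le> R" for s
  proof -
    have "f s * g s - f (\<lambda>_. 0) * g (\<lambda>_. 0)
        = f s * (g s - g (\<lambda>_. 0)) + (f s - f (\<lambda>_. 0)) * g (\<lambda>_. 0)"
      by (simp add: algebra_simps)
    then have "norm (f s * g s - f (\<lambda>_. 0) * g (\<lambda>_. 0))
        \<le> norm (f s) * norm (g s - g (\<lambda>_. 0)) + norm (f s - f (\<lambda>_. 0)) * ?G"
      by (metis norm_mult norm_triangle_ineq)
    also have "\<dots> \<le> B * (D * (\<Sum>i<k. norm (s i))) + (C * (\<Sum>i<k. norm (s i))) * ?G"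
      using B C D s by (intro add_mono mult_mono mult_nonneg_nonneg sum_nonneg) auto
    finally show ?thesis by (simp add: algebra_simps)
  qed
  then show ?case using B(1) C(1) D(1) by (intro exI[of _ "B * D + C * ?G"]) auto
qed

section \<open>The Littlewood kernel\<close>

text \<open>The sum is the coefficient of index card Z - 1 of the Lagrange interpolation polynomial,
  which is p itself and has smaller degree.\<close>

lemma lagrange_top_coeff:
  fixes p :: "'a::field poly"
  assumes Z: "finite Z" and deg: "degree p + 1 < card Z"
  shows "(\<Sum>z\<in>Z. poly p z / (\<Prod>y\<in>Z - {z}. z - y)) = 0"
proof -
  define n where "n = card Z - 1"
  define L where "L z = (\<Prod>y\<in>Z - {z}. [:- y, 1:])" for z
  define a where "a z = poly p z / (\<Prod>y\<in>Z - {z}. z - y)" for z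
  define P where "P = (\<Sum>z\<in>Z. Polynomial.smult (a z) (L z))"
  have degL: "degree (L z) = n" if "z \<in> Z" for z
    using that Z by (simp add: L_def n_def degree_prod_eq_sum_degree)
  have lead: "coeff (L z) n = 1" if "z \<in> Z" for z
    using lead_coeff_prod[of "\<lambda>y. [:- y, 1:]" "Z - {z}"] degL[OF that] by (simp add: L_def)
  have "degree P \<le> n"
    unfolding P_def using degL by (intro degree_sum_le Z) (auto intro: order_trans[OF degree_smult_le])
  have "P = p"
  proof (rule poly_eqI_degree)
    fix x assume x: "x \<in> Z"
    have "poly (L z) x = 0" if "z \<in> Z - {x}" for z
      using that x Z by (auto simp: L_def poly_prod)
    then have "poly P x = a x * poly (L x) x"
      using x Z by (simp add: P_def poly_sum sum.remove)
    also have "poly (L x) x = (\<Prod>y\<in>Z - {x}. x - y)"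
      by (simp add: L_def poly_prod)
    also have "a x * \<dots> = poly p x"
      using Z by (simp add: a_def)
    finally show "poly P x = poly p x" .
  next
    show "card Z > degree P" "card Z > degree p"
      using \<open>degree P \<le> n\<close> deg by (auto simp: n_def)
  qed
  have "coeff P n = (\<Sum>z\<in>Z. a z)"
    by (simp add: P_def coeff_sum lead)
  moreover have "coeff P n = 0"
    using deg unfolding \<open>P = p\<close> by (intro coeff_eq_0) (simp add: n_def)
  ultimately show ?thesis by (simp add: a_def)
qed

text \<open>\<open>lagrange_top_coeff\<close> for the polynomial prod (1 - x_i X) at the nodes 0, -1
  and all x_i: the nodes x_i give the left side, 0 and -1 the two terms of the right side.\<close>

lemma partial_fraction_one_minus_prod:
  fixes x :: "'b \<Rightarrow> 'a::field"
  assumes I: "finite I" and inj: "inj_on x I" and nz: "\<And>i. i \<in> I \<Longrightarrow> x i \<noteq> 0 \<and> x i \<noteq> - 1"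
  shows "(\<Sum>i\<in>I. (1 - x i) / x i * (\<Prod>j\<in>I - {i}. (1 - x i * x j) / (x j - x i)))
     = (1 - (\<Prod>i\<in>I. x i)) / (\<Prod>i\<in>I. x i)"
proof -
  define p where "p = (\<Prod>j\<in>I. [:1, - x j:])"
  define Z where "Z = insert 0 (insert (-1) (x ` I))"
  have Z: "finite Z" using I by (simp add: Z_def)
  have notin: "0 \<notin> insert (-1) (x ` I)" "-1 \<notin> x ` I"
    using nz by (auto simp: image_iff) metis
  have card: "card Z = card I + 2"
    using notin I by (simp add: Z_def card_image[OF inj])
  \<comment> \<open>The two additional nodes raise their number to card I + 2, just enough for a
    polynomial of degree card I.\<close>
  have "degree p \<le> (\<Sum>j\<in>I. degree [:1, - x j:])"
    unfolding p_def using degree_prod_sum_le[OF I, of "\<lambda>j. [:1, - x j:]"] by (simp add: o_def)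
  also have "\<dots> \<le> (\<Sum>j\<in>I. 1)" by (intro sum_mono) auto
  finally have "degree p + 1 < card Z" by (simp add: card)
  then have "(\<Sum>z\<in>Z. poly p z / (\<Prod>y\<in>Z - {z}. z - y)) = 0"
    by (rule lagrange_top_coeff[OF Z])
  also have "(\<Sum>z\<in>Z. poly p z / (\<Prod>y\<in>Z - {z}. z - y))
      = poly p 0 / (\<Prod>y\<in>Z - {0}. 0 - y) + poly p (-1) / (\<Prod>y\<in>Z - {-1}. -1 - y)
        + (\<Sum>z\<in>x ` I. poly p z / (\<Prod>y\<in>Z - {z}. z - y))"
    using notin I unfolding Z_def by (subst sum.insert; simp)+
  also have "(\<Sum>z\<in>x ` I. poly p z / (\<Prod>y\<in>Z - {z}. z - y))
      = (\<Sum>i\<in>I. poly p (x i) / (\<Prod>y\<in>Z - {x i}. x i - y))"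
    by (simp add: sum.reindex[OF inj])
  also have "poly p 0 / (\<Prod>y\<in>Z - {0}. 0 - y) = 1 / (\<Prod>i\<in>I. - x i)"
  proof -
    have "Z - {0} = insert (-1) (x ` I)"
      unfolding Z_def using notin(1) by (rule Diff_insert_absorb)
    then show ?thesis using notin(2) I by (simp add: p_def poly_prod prod.reindex[OF inj])
  qed
  also have "poly p (-1) / (\<Prod>y\<in>Z - {-1}. -1 - y) = - ((\<Prod>i\<in>I. 1 + x i) / (\<Prod>i\<in>I. - (1 + x i)))"
  proof -
    have "0 \<notin> x ` I" using notin by auto
    moreover have "-1 \<notin> insert 0 (x ` I)" using notin(2) by simp
    then have "Z - {-1} = insert 0 (x ` I)"
      unfolding Z_def insert_commute[of 0] by (rule Diff_insert_absorb)
    moreover have "(\<Prod>i\<in>I. - 1 - x i) = (\<Prod>i\<in>I. - (1 + x i))" by (intro prod.cong) auto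
    ultimately show ?thesis using I by (simp add: p_def poly_prod prod.reindex[OF inj])
  qed
  also have "(\<Sum>i\<in>I. poly p (x i) / (\<Prod>y\<in>Z - {x i}. x i - y))
     = (\<Sum>i\<in>I. (-1) ^ (card I - 1) * ((1 - x i) / x i * (\<Prod>j\<in>I - {i}. (1 - x i * x j) / (x j - x i))))"
  proof (intro sum.cong refl)
    have cancel: "(1 - a) * (a + 1) * P / (a * ((a + 1) * (e * Q))) = e * ((1 - a) / a * (P / Q))"
      if "a + 1 \<noteq> 0" "a \<noteq> 0" "Q \<noteq> 0" "e * e = 1" for a e P Q :: 'a
    proof -
      have "e * Q \<noteq> 0" using that by auto
      moreover have "P = e * (P / Q) * (e * Q)"
      proof -
        have "e * (P / Q) * (e * Q) = (e * e) * (P / Q * Q)" by (simp only: mult_ac)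
        then show ?thesis using that by simp
      qed
      ultimately have "P / (e * Q) = e * (P / Q)"
        by (metis nonzero_divide_eq_eq)
      moreover have "(1 - a) * (a + 1) * P / (a * ((a + 1) * (e * Q))) = (1 - a) / a * (P / (e * Q))"
        using that by simp
      ultimately show ?thesis by simp
    qed
    fix i assume i: "i \<in> I"
    have "Z - {x i} = insert 0 (insert (-1) (x ` (I - {i})))"
      using notin i inj by (auto simp: Z_def inj_on_def)
    moreover have "0 \<notin> insert (-1) (x ` (I - {i}))" "-1 \<notin> x ` (I - {i})" using notin by auto
    moreover have inj': "inj_on x (I - {i})" using inj by (rule inj_on_subset) auto
    ultimately have "(\<Prod>y\<in>Z - {x i}. x i - y) = x i * ((x i + 1) * (\<Prod>j\<in>I - {i}. x i - x j))"
      using I by (simp add: prod.reindex[OF inj'])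
    also have "(\<Prod>j\<in>I - {i}. x i - x j) = (-1) ^ (card I - 1) * (\<Prod>j\<in>I - {i}. x j - x i)"
    proof -
      have "(\<Prod>j\<in>I - {i}. x i - x j) = (\<Prod>j\<in>I - {i}. (-1) * (x j - x i))"
        by (intro prod.cong) auto
      then show ?thesis using I i by (simp only: prod.distrib) simp
    qed
    finally have den: "(\<Prod>y\<in>Z - {x i}. x i - y)
       = x i * ((x i + 1) * ((-1) ^ (card I - 1) * (\<Prod>j\<in>I - {i}. x j - x i)))" .
    have "poly p (x i) = (1 - x i * x i) * (\<Prod>j\<in>I - {i}. 1 - x i * x j)"
      using I i by (simp add: p_def poly_prod prod.remove[of I i] left_diff_distrib mult.assoc)
    also have "1 - x i * x i = (1 - x i) * (x i + 1)" by (simp add: algebra_simps)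
    finally have num: "poly p (x i) = (1 - x i) * (x i + 1) * (\<Prod>j\<in>I - {i}. 1 - x i * x j)" .
    have "x i + 1 \<noteq> 0" "x i \<noteq> 0" using nz[OF i] by (auto simp: eq_neg_iff_add_eq_0)
    moreover have "(\<Prod>j\<in>I - {i}. x j - x i) \<noteq> 0"
      using I i inj by (auto simp: inj_on_def)
    moreover have "(-1 :: 'a) ^ (card I - 1) * (-1) ^ (card I - 1) = 1"
      by (metis left_minus_one_mult_self mult.right_neutral)
    ultimately show "poly p (x i) / (\<Prod>y\<in>Z - {x i}. x i - y)
      = (-1) ^ (card I - 1) * ((1 - x i) / x i * (\<Prod>j\<in>I - {i}. (1 - x i * x j) / (x j - x i)))"
      unfolding num den prod_dividef by (rule cancel)
  qed
  finally have eq: "1 / (\<Prod>i\<in>I. - x i) - (\<Prod>i\<in>I. 1 + x i) / (\<Prod>i\<in>I. - (1 + x i))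
     + (\<Sum>i\<in>I. (-1) ^ (card I - 1) * ((1 - x i) / x i * (\<Prod>j\<in>I - {i}. (1 - x i * x j) / (x j - x i)))) = 0"
    by simp
  have neg: "(\<Prod>i\<in>I. - f i) = (-1) ^ card I * (\<Prod>i\<in>I. f i)" for f :: "'b \<Rightarrow> 'a"
    using prod.distrib[of "\<lambda>_. -1" f I] by simp
  define X where "X = (\<Prod>i\<in>I. x i)"
  define Y where "Y = (\<Prod>i\<in>I. 1 + x i)"
  define S where "S = (\<Sum>i\<in>I. (1 - x i) / x i * (\<Prod>j\<in>I - {i}. (1 - x i * x j) / (x j - x i)))"
  have X: "X \<noteq> 0" and Y: "Y \<noteq> 0" using nz I by (auto simp: X_def Y_def eq_neg_iff_add_eq_0 add.commute)
  have "1 / ((-1) ^ card I * X) - Y / ((-1) ^ card I * Y) + (-1) ^ (card I - 1) * S = 0"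
    using eq unfolding neg by (simp add: X_def Y_def S_def sum_distrib_left)
  then have "S = (1 - X) / X"
  proof (cases "I = {}")
    case True
    then show ?thesis by (simp add: S_def X_def)
  next
    case False
    define e :: 'a where "e = (-1) ^ (card I - 1)"
    have "e * e = 1" unfolding e_def by (metis left_minus_one_mult_self mult.right_neutral)
    moreover have "(-1) ^ card I = - e"
      using False I unfolding e_def by (cases "card I") auto
    moreover assume "1 / ((-1) ^ card I * X) - Y / ((-1) ^ card I * Y) + (-1) ^ (card I - 1) * S = 0"
    ultimately have "1 / (- e * X) - 1 / (- e) + e * S = 0" "e \<noteq> 0"
      using Y by (auto simp: e_def)
    then have "e * (1 / (- e * X)) - e * (1 / (- e)) + (e * e) * S = 0"
      by (metis distrib_left mult.assoc mult_zero_right right_diff_distrib)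
    moreover have "e * (1 / (- e * X)) = - (1 / X)" "e * (1 / (- e)) = -1"
      using \<open>e \<noteq> 0\<close> X by (simp_all add: divide_simps)
    ultimately have "S * (e * e) = 1 / X - 1"
      using \<open>e * e = 1\<close> by (simp add: algebra_simps eq_neg_iff_add_eq_0)
    then show ?thesis using X \<open>e * e = 1\<close> by (simp add: diff_divide_distrib)
  qed
  then show ?thesis by (simp add: S_def X_def)
qed

text \<open>Expanded for moduli below 1, this is the sum over all tuples v of positive exponents of
  \<open>ord_sign I v\<close> times x^v. General finite index sets occur because coefficients are
  found by removing one variable at a time.\<close>

definition littlewood :: "nat set \<Rightarrow> (nat \<Rightarrow> complex) \<Rightarrow> complex" where
  "littlewood I x = (\<Prod>j\<in>I. x j / (1 - x j))
     * (\<Prod>m\<in>I. \<Prod>j\<in>{j\<in>I. j < m}. (x m - x j) / (1 - x j * x m))"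

text \<open>Collects all factors that contain x_i. The factors with an index below i have the
  opposite orientation, which gives the power of -1.\<close>

lemma littlewood_remove:
  assumes I: "finite I" "i \<in> I"
  shows "littlewood I x = x i / (1 - x i) * (-1) ^ card {j\<in>I. j < i}
     * (\<Prod>j\<in>I - {i}. (x j - x i) / (1 - x i * x j)) * littlewood (I - {i}) x"
proof -
  define F where "F j m = (x m - x j) / (1 - x j * x m)" for j m
  let ?I = "I - {i}"
  have "(\<Prod>m\<in>I. \<Prod>j\<in>{j\<in>I. j < m}. F j m)
     = (\<Prod>j\<in>{j\<in>I. j < i}. F j i) * (\<Prod>m\<in>?I. \<Prod>j\<in>{j\<in>I. j < m}. F j m)"
    using I by (simp add: prod.remove)
  also have "(\<Prod>m\<in>?I. \<Prod>j\<in>{j\<in>I. j < m}. F j m)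
     = (\<Prod>m\<in>?I. (if i < m then F i m else 1) * (\<Prod>j\<in>{j\<in>?I. j < m}. F j m))"
  proof (intro prod.cong refl)
    fix m assume "m \<in> ?I"
    show "(\<Prod>j\<in>{j\<in>I. j < m}. F j m) = (if i < m then F i m else 1) * (\<Prod>j\<in>{j\<in>?I. j < m}. F j m)"
    proof (cases "i < m")
      case True
      then have "{j\<in>I. j < m} = insert i {j\<in>?I. j < m}" using I by auto
      then show ?thesis using True I by simp
    next
      case False
      then have "{j\<in>I. j < m} = {j\<in>?I. j < m}" by auto
      then show ?thesis using False by simp
    qed
  qed
  also have "(\<Prod>j\<in>{j\<in>I. j < i}. F j i) = (\<Prod>m\<in>?I. if m < i then F m i else 1)"
  proof -
    have "{j\<in>I. j < i} = {j\<in>?I. j < i}" by auto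
    then show ?thesis using I by (simp only: prod.inter_filter finite_Diff)
  qed
  also have "(\<Prod>m\<in>?I. if m < i then F m i else 1)
      * (\<Prod>m\<in>?I. (if i < m then F i m else 1) * (\<Prod>j\<in>{j\<in>?I. j < m}. F j m))
     = (\<Prod>m\<in>?I. (if m < i then -1 else 1) * F i m) * (\<Prod>m\<in>?I. \<Prod>j\<in>{j\<in>?I. j < m}. F j m)"
  proof -
    have "(if m < i then F m i else 1) * (if i < m then F i m else 1) = (if m < i then -1 else 1) * F i m"
      if "m \<in> ?I" for m
      using that by (auto simp: F_def divide_simps mult.commute)
    then show ?thesis unfolding prod.distrib[symmetric]
      by (intro prod.cong refl) (simp only: mult.assoc[symmetric])
  qed
  also have "(\<Prod>m\<in>?I. (if m < i then -1 else 1) * F i m) = (-1) ^ card {j\<in>I. j < i} * (\<Prod>m\<in>?I. F i m)"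
  proof -
    have "(\<Prod>m\<in>?I. if m < i then -1 else (1::complex)) = (\<Prod>m\<in>{j\<in>?I. j < i}. -1)"
      using I by (subst prod.inter_filter[symmetric]) auto
    also have "{j\<in>?I. j < i} = {j\<in>I. j < i}" by auto
    finally show ?thesis by (simp add: prod.distrib)
  qed
  finally have "(\<Prod>m\<in>I. \<Prod>j\<in>{j\<in>I. j < m}. F j m)
    = (-1) ^ card {j\<in>I. j < i} * (\<Prod>m\<in>?I. F i m) * (\<Prod>m\<in>?I. \<Prod>j\<in>{j\<in>?I. j < m}. F j m)" .
  then show ?thesis
    using I unfolding littlewood_def F_def by (simp add: prod.remove[of I i] mult_ac)
qed

text \<open>In the expansion, multiplication by 1 - prod x cancels all tuples except those whose
  least exponent is 1. By \<open>littlewood_remove\<close> each summand is the full kernel times a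
  term of the partial fraction sum; distinct values of modulus below 1 keep all denominators
  nonzero.\<close>

lemma littlewood_recursion:
  assumes I: "finite I" and inj: "inj_on x I" and x: "\<And>i. i \<in> I \<Longrightarrow> x i \<noteq> 0 \<and> norm (x i) < 1"
  shows "(1 - (\<Prod>i\<in>I. x i)) * littlewood I x
     = (\<Prod>i\<in>I. x i) * (\<Sum>i\<in>I. (-1) ^ card {j\<in>I. j < i} * littlewood (I - {i}) x)"
proof -
  have ne1: "1 - x i * x j \<noteq> 0" "1 - x i \<noteq> 0" "x i \<noteq> -1" if "i \<in> I" "j \<in> I" for i j
  proof -
    have "norm (x i * x j) < 1 * 1"
      unfolding norm_mult using x that by (intro mult_strict_mono') auto
    then show "1 - x i * x j \<noteq> 0" by auto
    show "1 - x i \<noteq> 0" "x i \<noteq> -1" using x[of i] that by auto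
  qed
  have eq: "(-1) ^ card {j\<in>I. j < i} * littlewood (I - {i}) x
      = littlewood I x * ((1 - x i) / x i * (\<Prod>j\<in>I - {i}. (1 - x i * x j) / (x j - x i)))"
    if i: "i \<in> I" for i
  proof -
    define A where "A = (\<Prod>j\<in>I - {i}. (x j - x i) / (1 - x i * x j))"
    define e :: complex where "e = (-1) ^ card {j\<in>I. j < i}"
    have "e * e = 1" unfolding e_def by (metis left_minus_one_mult_self mult.right_neutral)
    have "A * (\<Prod>j\<in>I - {i}. (1 - x i * x j) / (x j - x i)) = 1"
      unfolding A_def prod.distrib[symmetric]
    proof (rule prod.neutral, rule ballI)
      fix j assume j: "j \<in> I - {i}"
      then have "x j - x i \<noteq> 0" using inj i by (auto simp: inj_on_def)
      then show "(x j - x i) / (1 - x i * x j) * ((1 - x i * x j) / (x j - x i)) = 1"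
        using ne1[of i j] i j by simp
    qed
    moreover have "x i / (1 - x i) * ((1 - x i) / x i) = 1"
      using ne1(2)[of i] x[OF i] i by simp
    moreover have "littlewood I x * ((1 - x i) / x i * (\<Prod>j\<in>I - {i}. (1 - x i * x j) / (x j - x i)))
      = e * littlewood (I - {i}) x * (A * (\<Prod>j\<in>I - {i}. (1 - x i * x j) / (x j - x i)))
         * (x i / (1 - x i) * ((1 - x i) / x i))"
      by (simp only: littlewood_remove[OF I i] A_def e_def mult_ac)
    ultimately show ?thesis by (simp add: e_def)
  qed
  have X: "(\<Prod>i\<in>I. x i) \<noteq> 0" using x I by auto
  have "(\<Sum>i\<in>I. (-1) ^ card {j\<in>I. j < i} * littlewood (I - {i}) x)
     = littlewood I x * (\<Sum>i\<in>I. (1 - x i) / x i * (\<Prod>j\<in>I - {i}. (1 - x i * x j) / (x j - x i)))"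
    unfolding sum_distrib_left by (intro sum.cong refl eq)
  also have "\<dots> = littlewood I x * ((1 - (\<Prod>i\<in>I. x i)) / (\<Prod>i\<in>I. x i))"
    using ne1(3) x by (subst partial_fraction_one_minus_prod[OF I inj]) auto
  finally show ?thesis using X by simp
qed

section \<open>Fourier coefficients of the Littlewood kernel\<close>

text \<open>The angles are centred at \<open>\<pi>/2\<close>, so that the points \<open>0\<close> and \<open>\<pi>\<close> at which the symbol can have
  maximal modulus are interior points.\<close>

definition circle :: "real measure" where
  "circle = density lborel (\<lambda>x. indicator {- (pi / 2)..3 * pi / 2} x / (2 * pi))"

lemma sets_circle [measurable_cong, simp]: "sets circle = sets borel"
  by (simp add: circle_def)

lemma space_circle [simp]: "space circle = UNIV"
  by (simp add: circle_def)

lemma integral_circle: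
  fixes f :: "real \<Rightarrow> 'a :: {banach, second_countable_topology}"
  assumes "f \<in> borel_measurable borel"
  shows "(\<integral>x. f x \<partial>circle)
    = (1 / (2 * pi)) *\<^sub>R (\<integral>x. indicator {- (pi / 2)..3 * pi / 2} x *\<^sub>R f x \<partial>lborel)"
proof -
  have "(\<integral>x. f x \<partial>circle) = (\<integral>x. (indicator {- (pi / 2)..3 * pi / 2} x / (2 * pi)) *\<^sub>R f x \<partial>lborel)"
    unfolding circle_def using assms by (intro integral_density) auto
  also have "\<dots> = (\<integral>x. (1 / (2 * pi)) *\<^sub>R (indicator {- (pi / 2)..3 * pi / 2} x *\<^sub>R f x) \<partial>lborel)"
    by (intro Bochner_Integration.integral_cong) (auto simp: field_simps)
  finally show ?thesis by (simp only: integral_scaleR_right)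
qed

lemma prob_space_circle: "prob_space circle"
proof
  have "emeasure circle (space circle) = (\<integral>\<^sup>+x. ennreal (1 / (2 * pi)) * indicator {- (pi / 2)..3 * pi / 2} x \<partial>lborel)"
    unfolding circle_def by (subst emeasure_density) (auto intro!: nn_integral_cong simp: indicator_def)
  also have "\<dots> = ennreal (1 / (2 * pi)) * ennreal (3 * pi / 2 - - (pi / 2))"
    by (subst nn_integral_cmult_indicator) auto
  also have "\<dots> = 1"
    by (simp add: ennreal_mult[symmetric])
  finally show "emeasure circle (space circle) = 1" .
qed

interpretation circle: prob_space circle by (rule prob_space_circle)
interpretation tors: product_sigma_finite "\<lambda>_. circle"
  by (rule product_sigma_finite.intro) (rule circle.sigma_finite_measure_axioms)

abbreviation torus :: "nat set \<Rightarrow> (nat \<Rightarrow> real) measure" where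
  "torus I \<equiv> PiM I (\<lambda>_. circle)"

lemma prob_space_torus: "prob_space (torus I)"
  by (rule prob_space_PiM) (rule prob_space_circle)

lemma integrable_torus_bounded:
  fixes f :: "(nat \<Rightarrow> real) \<Rightarrow> complex"
  assumes "f \<in> borel_measurable (torus I)" "\<And>y. norm (f y) \<le> B"
  shows "integrable (torus I) f"
proof -
  interpret prob_space "torus I" by (rule prob_space_torus)
  show ?thesis using assms by (intro integrable_const_bound[of _ B]) auto
qed

lemma integral_circle_exp:
  fixes a :: int
  shows "(\<integral>y. exp (- of_int a * Complex r y) \<partial>circle) = (if a = 0 then 1 else 0)"
proof (cases "a = 0")
  case True
  then show ?thesis using circle.prob_space by simp
next
  case False
  define F where "F y = exp (- of_int a * Complex r y) / (- of_int a * \<i>)" for y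
  have meas: "(\<lambda>y. exp (- of_int a * Complex r y)) \<in> borel_measurable borel"
    unfolding Complex_eq by measurable
  have "(\<integral>y. indicator {- (pi / 2)..3 * pi / 2} y *\<^sub>R exp (- of_int a * Complex r y) \<partial>lborel)
     = F (3 * pi / 2) - F (- (pi / 2))"
  proof (rule integral_FTC_atLeastAtMost)
    show "- (pi / 2) \<le> 3 * pi / 2" using pi_gt_zero by linarith
    show "continuous_on {- (pi / 2)..3 * pi / 2} (\<lambda>y. exp (- of_int a * Complex r y))"
      unfolding Complex_eq by (intro continuous_intros)
    fix y :: real
    have "((\<lambda>z. exp (- of_int a * (of_real r + \<i> * z)) / (- of_int a * \<i>)) has_field_derivative
        exp (- of_int a * (of_real r + \<i> * of_real y))) (at (of_real y))"
      using False by (auto intro!: derivative_eq_intros simp: field_simps)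
    then show "(F has_vector_derivative exp (- of_int a * Complex r y)) (at y within {- (pi / 2)..3 * pi / 2})"
      unfolding F_def Complex_eq by (rule has_vector_derivative_real_field)
  qed
  also have "F (3 * pi / 2) = F (- (pi / 2))"
  proof -
    have "- of_int a * Complex r (3 * pi / 2) = - of_int a * Complex r (- (pi / 2)) + of_real (2 * of_int (-a) * pi) * \<i>"
      by (simp add: complex_eq_iff field_simps)
    then have "exp (- of_int a * Complex r (3 * pi / 2)) = exp (- of_int a * Complex r (- (pi / 2)))"
      by (simp only: exp_eq) (intro exI[of _ "-a"], simp)
    then show ?thesis by (simp add: F_def)
  qed
  finally show ?thesis
    using False unfolding integral_circle[OF meas] by simp
qed

text \<open>Here \<open>r\<close> lists the logarithms of the radii, so the Littlewood series converges when these are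
  negative.\<close>

definition littlewood_coeff :: "nat set \<Rightarrow> (nat \<Rightarrow> real) \<Rightarrow> (nat \<Rightarrow> int) \<Rightarrow> complex" where
  "littlewood_coeff I r v = (\<integral>y. (\<Prod>j\<in>I. exp (- of_int (v j) * Complex (r j) (y j)))
      * littlewood I (\<lambda>j. exp (Complex (r j) (y j))) \<partial>torus I)"

lemma measurable_Complex [measurable]:
  "f \<in> borel_measurable M \<Longrightarrow> g \<in> borel_measurable M \<Longrightarrow> (\<lambda>x. Complex (f x) (g x)) \<in> borel_measurable M"
  by (subst borel_measurable_complex_iff) auto

lemma measurable_littlewood [measurable]:
  assumes "\<And>j. j \<in> I \<Longrightarrow> (\<lambda>y. f y j) \<in> borel_measurable M"
  shows "(\<lambda>y. littlewood I (f y)) \<in> borel_measurable M"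
  unfolding littlewood_def using assms by (intro borel_measurable_times borel_measurable_prod borel_measurable_divide borel_measurable_diff) auto

lemma littlewood_bounded:
  assumes r: "\<And>j. j \<in> I \<Longrightarrow> r j < 0"
  shows "norm (littlewood I (\<lambda>j. exp (Complex (r j) (y j))))
    \<le> (\<Prod>j\<in>I. 1 / (1 - exp (r j))) * (\<Prod>m\<in>I. \<Prod>j\<in>{j\<in>I. j < m}. 2 / (1 - exp (r j + r m)))"
proof -
  have lower: "1 - exp a \<le> norm (1 - exp (Complex a b))" for a b
    using norm_triangle_ineq2[of 1 "exp (Complex a b)"] by simp
  have "norm (exp (Complex (r j) (y j)) / (1 - exp (Complex (r j) (y j)))) \<le> 1 / (1 - exp (r j))" if "j \<in> I" for j
    unfolding norm_divide using r[OF that] lower by (intro frac_le) auto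
  moreover have "norm ((exp (Complex (r m) (y m)) - exp (Complex (r j) (y j))) /
      (1 - exp (Complex (r j) (y j)) * exp (Complex (r m) (y m)))) \<le> 2 / (1 - exp (r j + r m))"
    if "j \<in> I" "m \<in> I" for j m
  proof -
    have "exp (Complex (r j) (y j)) * exp (Complex (r m) (y m)) = exp (Complex (r j + r m) (y j + y m))"
      by (simp add: exp_add[symmetric] complex_add)
    moreover have "norm (exp (Complex (r m) (y m)) - exp (Complex (r j) (y j))) \<le> 1 + 1"
      using r that by (intro norm_triangle_le_diff add_mono) (auto simp: less_imp_le)
    ultimately show ?thesis
      unfolding norm_divide using r[OF that(1)] r[OF that(2)] lower by (intro frac_le) auto
  qed
  ultimately show ?thesis
    unfolding littlewood_def norm_mult prod_norm[symmetric]
    by (intro mult_mono prod_mono conjI prod_nonneg ballI) (auto simp: less_imp_le[OF r] add_nonpos_nonpos)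
qed

lemma littlewood_coeff_measurable:
  "J \<subseteq> I \<Longrightarrow> (\<lambda>y. (\<Prod>j\<in>I. exp (- of_int (v j) * Complex (r j) (y j)))
      * littlewood J (\<lambda>j. exp (Complex (r j) (y j)))) \<in> borel_measurable (torus I)"
  by (intro borel_measurable_times borel_measurable_prod measurable_littlewood) (auto intro!: borel_measurable_exp measurable_Complex)

lemma littlewood_coeff_integrand_bounded:
  assumes r: "\<And>j. j \<in> I \<Longrightarrow> r j < 0" and "J \<subseteq> I"
  shows "norm ((\<Prod>j\<in>I. exp (- of_int (v j) * Complex (r j) (y j))) * littlewood J (\<lambda>j. exp (Complex (r j) (y j))))
    \<le> exp (- (\<Sum>j\<in>I. of_int (v j) * r j)) * ((\<Prod>j\<in>J. 1 / (1 - exp (r j))) * (\<Prod>m\<in>J. \<Prod>j\<in>{j\<in>J. j < m}. 2 / (1 - exp (r j + r m))))"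
proof -
  have "norm (\<Prod>j\<in>I. exp (- of_int (v j) * Complex (r j) (y j))) = (\<Prod>j\<in>I. exp (- (of_int (v j) * r j)))"
    unfolding prod_norm[symmetric] by (intro prod.cong) auto
  also have "\<dots> = exp (- (\<Sum>j\<in>I. of_int (v j) * r j))"
    by (cases "finite I") (auto simp: exp_sum sum_negf[symmetric])
  finally show ?thesis
    unfolding norm_mult using littlewood_bounded[of J r y] assms by (intro mult_mono) auto
qed

text \<open>Multiplication by \<open>1 - \<Prod>x\<close> gives the difference on the left, and in the \<open>i\<close>-th summand on the right of
  \<open>littlewood_recursion\<close> the only power of \<open>x i\<close> is the first one, which forces \<open>v i = 1\<close>.\<close>

lemma littlewood_coeff_step:
  assumes I: "finite I" and r: "\<And>j. j \<in> I \<Longrightarrow> r j < 0" and inj: "inj_on r I"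
  shows "littlewood_coeff I r v - littlewood_coeff I r (\<lambda>j. v j - 1)
    = (\<Sum>i\<in>I. (-1) ^ card {j\<in>I. j < i} * (if v i = 1 then littlewood_coeff (I - {i}) r (\<lambda>j. v j - 1) else 0))"
proof -
  define E where "E v y = (\<Prod>j\<in>I. exp (- of_int (v j) * Complex (r j) (y j)))" for v :: "nat \<Rightarrow> int" and y
  define x where "x y j = exp (Complex (r j) (y j))" for y and j :: nat
  have int: "integrable (torus I) (\<lambda>y. E v y * littlewood J (x y))" if "J \<subseteq> I" for v J
    unfolding E_def x_def using littlewood_coeff_measurable[OF that] littlewood_coeff_integrand_bounded[OF r that]
    by (rule integrable_torus_bounded)
  have pt: "E v y * littlewood I (x y) - E (\<lambda>j. v j - 1) y * littlewood I (x y)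
     = (\<Sum>i\<in>I. (-1) ^ card {j\<in>I. j < i} * (E (\<lambda>j. v j - 1) y * littlewood (I - {i}) (x y)))" for y
  proof -
    have E1: "E (\<lambda>j. v j - 1) y = E v y * (\<Prod>j\<in>I. x y j)"
      unfolding E_def x_def prod.distrib[symmetric] exp_add[symmetric]
      by (intro prod.cong refl arg_cong[where f = exp]) (simp add: algebra_simps)
    \<comment> \<open>Different moduli make the points distinct at all angles; this is why the radii
      are required to be distinct.\<close>
    have inj': "inj_on (x y) I"
    proof (rule inj_onI)
      fix i j assume "i \<in> I" "j \<in> I" "x y i = x y j"
      then have "norm (x y i) = norm (x y j)" by simp
      then have "r i = r j" by (simp add: x_def)
      then show "i = j" using inj \<open>i \<in> I\<close> \<open>j \<in> I\<close> by (auto simp: inj_on_def)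
    qed
    have "E v y * littlewood I (x y) - E (\<lambda>j. v j - 1) y * littlewood I (x y) = E v y * ((1 - (\<Prod>j\<in>I. x y j)) * littlewood I (x y))"
      by (simp add: E1 algebra_simps)
    also have "(1 - (\<Prod>j\<in>I. x y j)) * littlewood I (x y)
       = (\<Prod>i\<in>I. x y i) * (\<Sum>i\<in>I. (-1) ^ card {j\<in>I. j < i} * littlewood (I - {i}) (x y))"
      by (rule littlewood_recursion[OF I inj']) (auto simp: x_def r)
    finally show ?thesis by (simp add: E1 sum_distrib_left mult_ac)
  qed
  have one: "(\<integral>y. E (\<lambda>j. v j - 1) y * littlewood (I - {i}) (x y) \<partial>torus I)
     = (if v i = 1 then littlewood_coeff (I - {i}) r (\<lambda>j. v j - 1) else 0)" if i: "i \<in> I" for i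
  proof -
    let ?I = "I - {i}" and ?v = "\<lambda>j. v j - 1"
    have ins: "insert i ?I = I" using i by auto
    have "(\<integral>y. E ?v y * littlewood ?I (x y) \<partial>torus I)
       = (\<integral>y. (\<integral>t. E ?v (y(i := t)) * littlewood ?I (x (y(i := t))) \<partial>circle) \<partial>torus ?I)"
      using tors.product_integral_insert[of ?I i "\<lambda>y. E ?v y * littlewood ?I (x y)", unfolded ins] int[of ?I ?v] I by auto
    also have "\<dots> = (\<integral>y. (\<Prod>j\<in>?I. exp (- of_int (?v j) * Complex (r j) (y j))) * littlewood ?I (x y)
        * (\<integral>t. exp (- of_int (v i - 1) * Complex (r i) t) \<partial>circle) \<partial>torus ?I)"
    proof (intro Bochner_Integration.integral_cong refl)
      fix y
      have "E ?v (y(i := t)) = exp (- of_int (v i - 1) * Complex (r i) t)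
          * (\<Prod>j\<in>?I. exp (- of_int (?v j) * Complex (r j) (y j)))" for t
        unfolding E_def using I i by (simp add: prod.remove)
      moreover have "littlewood ?I (x (y(i := t))) = littlewood ?I (x y)" for t
        unfolding littlewood_def x_def by (intro arg_cong2[where f = "(*)"] prod.cong) auto
      ultimately have "E ?v (y(i := t)) * littlewood ?I (x (y(i := t)))
        = (\<Prod>j\<in>?I. exp (- of_int (?v j) * Complex (r j) (y j))) * littlewood ?I (x y)
          * exp (- of_int (v i - 1) * Complex (r i) t)" for t
        by (simp only: mult_ac)
      then show "(\<integral>t. E ?v (y(i := t)) * littlewood ?I (x (y(i := t))) \<partial>circle)
        = (\<Prod>j\<in>?I. exp (- of_int (?v j) * Complex (r j) (y j))) * littlewood ?I (x y)
        * (\<integral>t. exp (- of_int (v i - 1) * Complex (r i) t) \<partial>circle)"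
        by (simp only: integral_mult_right_zero)
    qed
    also have "\<dots> = (if v i = 1 then littlewood_coeff ?I r ?v else 0)"
      unfolding integral_circle_exp by (simp add: littlewood_coeff_def x_def[abs_def])
    finally show ?thesis .
  qed
  have "littlewood_coeff I r v - littlewood_coeff I r (\<lambda>j. v j - 1)
     = (\<integral>y. E v y * littlewood I (x y) - E (\<lambda>j. v j - 1) y * littlewood I (x y) \<partial>torus I)"
    unfolding Bochner_Integration.integral_diff[OF int[OF order_refl] int[OF order_refl]]
    by (simp add: littlewood_coeff_def E_def x_def[abs_def])
  also have "\<dots> = (\<Sum>i\<in>I. (-1) ^ card {j\<in>I. j < i} * (\<integral>y. E (\<lambda>j. v j - 1) y * littlewood (I - {i}) (x y) \<partial>torus I))"
    unfolding pt using int by (subst Bochner_Integration.integral_sum) auto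
  finally show ?thesis by (simp add: one)
qed

text \<open>Lowering all exponents by N multiplies the bound of the integrand by the N-th power of
  the product of the radii, which is less than 1.\<close>

lemma littlewood_coeff_tendsto_0:
  assumes I: "finite I" "I \<noteq> {}" and r: "\<And>j. j \<in> I \<Longrightarrow> r j < 0"
  shows "(\<lambda>N. littlewood_coeff I r (\<lambda>j. v j - int N)) \<longlonglongrightarrow> 0"
proof (rule Lim_null_comparison)
  define C where "C = (\<Prod>j\<in>I. 1 / (1 - exp (r j))) * (\<Prod>m\<in>I. \<Prod>j\<in>{j\<in>I. j < m}. 2 / (1 - exp (r j + r m)))"
  define a where "a = exp (\<Sum>j\<in>I. r j)"
  define B where "B = exp (- (\<Sum>j\<in>I. of_int (v j) * r j))"
  have "norm (littlewood_coeff I r (\<lambda>j. v j - int N)) \<le> B * C * a ^ N" for N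
  proof -
    interpret prob_space "torus I" by (rule prob_space_torus)
    have "exp (- (\<Sum>j\<in>I. of_int (v j - int N) * r j)) = B * a ^ N"
      by (simp add: B_def a_def exp_of_nat_mult[symmetric] exp_add[symmetric] algebra_simps sum_subtractf sum_distrib_left)
    then have bd2: "norm ((\<Prod>j\<in>I. exp (- of_int (v j - int N) * Complex (r j) (y j))) * littlewood I (\<lambda>j. exp (Complex (r j) (y j)))) \<le> B * C * a ^ N" for y
      using littlewood_coeff_integrand_bounded[of I r I "\<lambda>j. v j - int N" y] r by (simp add: C_def mult_ac)
    have bd1: "integrable (torus I) (\<lambda>y. (\<Prod>j\<in>I. exp (- of_int (v j - int N) * Complex (r j) (y j))) * littlewood I (\<lambda>j. exp (Complex (r j) (y j))))"
      using littlewood_coeff_measurable[OF order_refl] bd2 by (rule integrable_torus_bounded)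
    have "norm (littlewood_coeff I r (\<lambda>j. v j - int N))
      \<le> (\<integral>y. norm ((\<Prod>j\<in>I. exp (- of_int (v j - int N) * Complex (r j) (y j))) * littlewood I (\<lambda>j. exp (Complex (r j) (y j)))) \<partial>torus I)"
      unfolding littlewood_coeff_def by (rule integral_norm_bound)
    also have "\<dots> \<le> (\<integral>y. B * C * a ^ N \<partial>torus I)"
      by (rule integral_mono[OF integrable_norm[OF bd1] _ bd2]) simp
    finally have "norm (littlewood_coeff I r (\<lambda>j. v j - int N)) \<le> (\<integral>y. B * C * a ^ N \<partial>torus I)" .
    then show ?thesis using prob_space by simp
  qed
  then show "\<forall>\<^sub>F N in sequentially. norm (littlewood_coeff I r (\<lambda>j. v j - int N)) \<le> B * C * a ^ N" by simp
  have "(\<Sum>j\<in>I. r j) < 0"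
    using I r sum_strict_mono[of I r "\<lambda>_. 0"] by auto
  then have "(\<lambda>N. a ^ N) \<longlonglongrightarrow> 0" unfolding a_def by (intro LIMSEQ_power_zero) auto
  then show "(\<lambda>N. B * C * a ^ N) \<longlonglongrightarrow> 0"
    by (rule tendsto_mult_right_zero)
qed

text \<open>Telescoping \<open>littlewood_coeff_step\<close>: all exponents are lowered by 1 again
  and again, and the coefficient fades away. The i-th summand appears only when the exponent of x_i
  has come down to 1, that is, for \<open>v i\<close> at least 1 and after \<open>v i - 1\<close>
  shifts.\<close>

lemma littlewood_coeff_recursion:
  assumes I: "finite I" "I \<noteq> {}" and r: "\<And>j. j \<in> I \<Longrightarrow> r j < 0" and inj: "inj_on r I"
  shows "littlewood_coeff I r v = (\<Sum>i\<in>I. (-1) ^ card {j\<in>I. j < i} * (if v i \<ge> 1 then littlewood_coeff (I - {i}) r (\<lambda>j. v j - v i) else 0))"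
proof -
  define e where "e i = (-1 :: complex) ^ card {j\<in>I. j < i}" for i
  have fin: "littlewood_coeff I r v - littlewood_coeff I r (\<lambda>j. v j - int N)
     = (\<Sum>i\<in>I. e i * (if 1 \<le> v i \<and> v i \<le> int N then littlewood_coeff (I - {i}) r (\<lambda>j. v j - v i) else 0))" for N
  proof (induction N)
    case (Suc N)
    have "littlewood_coeff I r (\<lambda>j. v j - int N) - littlewood_coeff I r (\<lambda>j. v j - int (Suc N))
      = (\<Sum>i\<in>I. e i * (if v i = int (Suc N) then littlewood_coeff (I - {i}) r (\<lambda>j. v j - v i) else 0))"
      using littlewood_coeff_step[OF I(1) r inj, of "\<lambda>j. v j - int N"] unfolding e_def
      by (auto simp: algebra_simps intro!: sum.cong)
    then have "littlewood_coeff I r v - littlewood_coeff I r (\<lambda>j. v j - int (Suc N))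
      = (\<Sum>i\<in>I. e i * (if 1 \<le> v i \<and> v i \<le> int N then littlewood_coeff (I - {i}) r (\<lambda>j. v j - v i) else 0))
       + (\<Sum>i\<in>I. e i * (if v i = int (Suc N) then littlewood_coeff (I - {i}) r (\<lambda>j. v j - v i) else 0))"
      using Suc by (simp add: algebra_simps)
    also have "\<dots> = (\<Sum>i\<in>I. e i * (if 1 \<le> v i \<and> v i \<le> int (Suc N) then littlewood_coeff (I - {i}) r (\<lambda>j. v j - v i) else 0))"
      unfolding sum.distrib[symmetric] by (intro sum.cong refl) auto
    finally show ?case .
  qed (auto intro!: sum.neutral)
  define K where "K = nat (Max (insert 1 (v ` I)))"
  have K: "v i \<le> int N" if "N \<ge> K" "i \<in> I" for i N
  proof -
    have "v i \<le> Max (insert 1 (v ` I))" using I that by (intro Max_ge) auto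
    then show ?thesis using that unfolding K_def by linarith
  qed
  have "(\<lambda>N. littlewood_coeff I r v - littlewood_coeff I r (\<lambda>j. v j - int N)) \<longlonglongrightarrow> littlewood_coeff I r v - 0"
    by (intro tendsto_intros littlewood_coeff_tendsto_0 I r)
  moreover have "\<forall>\<^sub>F N in sequentially. littlewood_coeff I r v - littlewood_coeff I r (\<lambda>j. v j - int N)
     = (\<Sum>i\<in>I. e i * (if v i \<ge> 1 then littlewood_coeff (I - {i}) r (\<lambda>j. v j - v i) else 0))"
    using eventually_ge_at_top[of K] by eventually_elim (unfold fin, intro sum.cong refl, auto dest: K)
  ultimately have "(\<lambda>N. \<Sum>i\<in>I. e i * (if v i \<ge> 1 then littlewood_coeff (I - {i}) r (\<lambda>j. v j - v i) else 0)) \<longlonglongrightarrow> littlewood_coeff I r v - 0"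
    by (rule Lim_transform_eventually)
  then show ?thesis by (simp add: LIMSEQ_const_iff e_def)
qed

text \<open>The sign of the permutation that sorts the values of \<open>v\<close> on
  \<open>I\<close>, and 0 if two of them agree.\<close>

definition ord_sign :: "nat set \<Rightarrow> (nat \<Rightarrow> int) \<Rightarrow> int" where
  "ord_sign I v = (\<Prod>m\<in>I. \<Prod>j\<in>{j\<in>I. j < m}. sgn (v m - v j))"

lemma ord_sign_remove_min:
  assumes I: "finite I" "i \<in> I" and min: "\<And>j. j \<in> I - {i} \<Longrightarrow> v i < v j"
  shows "ord_sign I v = (-1) ^ card {j\<in>I. j < i} * ord_sign (I - {i}) v"
proof -
  let ?I = "I - {i}"
  have "(\<Prod>j\<in>{j\<in>I. j < i}. sgn (v i - v j)) = (\<Prod>j\<in>{j\<in>I. j < i}. -1)"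
    using min by (intro prod.cong refl) auto
  moreover have "(\<Prod>j\<in>{j\<in>I. j < m}. sgn (v m - v j)) = (\<Prod>j\<in>{j\<in>?I. j < m}. sgn (v m - v j))" if "m \<in> ?I" for m
  proof (cases "i < m")
    case True
    then have "{j\<in>I. j < m} = insert i {j\<in>?I. j < m}" using I by auto
    then show ?thesis using min[OF that] I by simp
  next
    case False
    then have "{j\<in>I. j < m} = {j\<in>?I. j < m}" by auto
    then show ?thesis by simp
  qed
  ultimately show ?thesis
    using I unfolding ord_sign_def by (simp add: prod.remove)
qed

text \<open>Schur's identity read coefficientwise. In the recursion the summand of i survives only
  if \<open>v i\<close> is strictly the least value, so at most one does; if the least value is
  attained twice, none is left and \<open>ord_sign\<close> is 0 as well.\<close>

lemma littlewood_coeff_eq: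
  assumes "finite I" "\<And>j. j \<in> I \<Longrightarrow> r j < 0" "inj_on r I"
  shows "littlewood_coeff I r v = (if \<forall>j\<in>I. 1 \<le> v j then of_int (ord_sign I v) else 0)"
  using assms
proof (induction "card I" arbitrary: I v)
  case 0
  interpret prob_space "torus {}" by (rule prob_space_torus)
  from 0 have "I = {}" by simp
  then show ?case using prob_space by (simp add: littlewood_coeff_def littlewood_def ord_sign_def)
next
  case (Suc n)
  then have ne: "I \<noteq> {}" by auto
  have IH: "littlewood_coeff (I - {i}) r (\<lambda>j. v j - v i)
      = (if \<forall>j\<in>I - {i}. 1 \<le> v j - v i then of_int (ord_sign (I - {i}) (\<lambda>j. v j - v i)) else 0)"
    if "i \<in> I" for i
    using Suc that by (intro Suc.hyps(1)) (auto intro: inj_on_subset)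
  have sh: "ord_sign J (\<lambda>j. v j - c) = ord_sign J v" for J c
    by (simp add: ord_sign_def)
  have summand: "(-1) ^ card {j\<in>I. j < i} * (if v i \<ge> 1 then littlewood_coeff (I - {i}) r (\<lambda>j. v j - v i) else 0)
      = (if 1 \<le> v i \<and> (\<forall>j\<in>I - {i}. v i < v j) then of_int (ord_sign I v) else (0::complex))"
    if i: "i \<in> I" for i
  proof (cases "1 \<le> v i \<and> (\<forall>j\<in>I - {i}. v i < v j)")
    case True
    have "\<forall>j\<in>I - {i}. 1 \<le> v j - v i"
    proof
      fix j assume "j \<in> I - {i}"
      then have "v i < v j" using True by blast
      then show "1 \<le> v j - v i" by linarith
    qed
    then show ?thesis
      using ord_sign_remove_min[of I i v] Suc.prems i IH[OF i] True by (simp add: sh)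
  next
    case False
    then have "\<not> (1 \<le> v i \<and> (\<forall>j\<in>I - {i}. 1 \<le> v j - v i))"
      by (auto simp: int_one_le_iff_zero_less)
    then show ?thesis using IH[OF i] False by auto
  qed
  have "littlewood_coeff I r v = (\<Sum>i\<in>I. (-1) ^ card {j\<in>I. j < i} * (if v i \<ge> 1 then littlewood_coeff (I - {i}) r (\<lambda>j. v j - v i) else 0))"
    using Suc.prems ne by (intro littlewood_coeff_recursion) auto
  also have "\<dots> = (\<Sum>i\<in>I. if 1 \<le> v i \<and> (\<forall>j\<in>I - {i}. v i < v j) then of_int (ord_sign I v) else 0)"
    by (rule sum.cong[OF refl summand])
  also have "\<dots> = (if \<forall>j\<in>I. 1 \<le> v j then of_int (ord_sign I v) else 0)"
  proof (cases "\<exists>i\<in>I. 1 \<le> v i \<and> (\<forall>j\<in>I - {i}. v i < v j)")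
    case True
    then obtain i where i: "i \<in> I" "1 \<le> v i" "\<forall>j\<in>I - {i}. v i < v j" by auto
    have "(\<Sum>i\<in>I. if 1 \<le> v i \<and> (\<forall>j\<in>I - {i}. v i < v j) then of_int (ord_sign I v) else (0::complex))
       = (\<Sum>m\<in>{i}. of_int (ord_sign I v))"
    proof (rule sum.mono_neutral_cong_right)
      show "finite I" "{i} \<subseteq> I" using i Suc.prems(1) by auto
      show "\<forall>m\<in>I - {i}. (if 1 \<le> v m \<and> (\<forall>j\<in>I - {m}. v m < v j) then of_int (ord_sign I v) else (0::complex)) = 0"
      proof
        fix m assume m: "m \<in> I - {i}"
        then have "v i < v m" "i \<in> I - {m}" using i by auto
        then have "\<not> (\<forall>j\<in>I - {m}. v m < v j)" by (meson less_asym)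
        then show "(if 1 \<le> v m \<and> (\<forall>j\<in>I - {m}. v m < v j) then of_int (ord_sign I v) else (0::complex)) = 0"
          by (intro if_not_P) blast
      qed
    qed (use i in auto)
    moreover have "\<forall>j\<in>I. 1 \<le> v j"
    proof
      fix j assume "j \<in> I"
      then have "j = i \<or> v i < v j" using i by blast
      then show "1 \<le> v j" using i(2) by auto
    qed
    ultimately show ?thesis by simp
  next
    case False
    have "ord_sign I v = 0" if pos: "\<forall>j\<in>I. 1 \<le> v j"
    proof -
      have "Min (v ` I) \<in> v ` I" using Suc.prems(1) ne by (intro Min_in) auto
      then obtain i where i: "i \<in> I" "v i = Min (v ` I)" by auto
      have le: "v i \<le> v j" if "j \<in> I" for j
        using that Suc.prems(1) by (simp add: i(2))
      have "\<exists>j\<in>I - {i}. \<not> v i < v j" using False i(1) pos by blast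
      then obtain j where j': "j \<in> I" "j \<noteq> i" "\<not> v i < v j" by blast
      with le[of j] have "v j = v i" by simp
      note j = j'(1,2) this
      have zero: "ord_sign I v = 0" if "p \<in> I" "q \<in> I" "p < q" "v p = v q" for p q
      proof -
        have "(\<Prod>j\<in>{j\<in>I. j < q}. sgn (v q - v j)) = 0"
          using that Suc.prems(1) by (intro prod_zero bexI[of _ p]) auto
        then have "\<exists>m\<in>I. (\<Prod>j\<in>{j\<in>I. j < m}. sgn (v m - v j)) = 0"
          using that(2) by blast
        then show ?thesis
          unfolding ord_sign_def by (rule prod_zero[OF Suc.prems(1)])
      qed
      show ?thesis using zero[of i j] zero[of j i] i(1) j by (cases "j < i") auto
    qed
    moreover have "(\<Sum>i\<in>I. if 1 \<le> v i \<and> (\<forall>j\<in>I - {i}. v i < v j) then of_int (ord_sign I v) else (0::complex)) = 0"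
      using False by (intro sum.neutral) auto
    ultimately show ?thesis by simp
  qed
  finally show ?case .
qed

section \<open>Reduction to atomic walks\<close>

definition stays :: "nat \<Rightarrow> rvec \<Rightarrow> rvec list \<Rightarrow> bool" where
  "stays k u s \<longleftrightarrow> (\<forall>i\<le>length s. (\<lambda>l. u l + vsum (take i s) l) \<in> chamber k)"

lemma vsum_Nil [simp]: "vsum [] = (\<lambda>_. 0)"
  and vsum_Cons: "vsum (a # s) = (\<lambda>l. a l + vsum s l)"
  by (auto simp: vsum_def)

lemma stays_Nil [simp]: "stays k u [] \<longleftrightarrow> u \<in> chamber k"
  by (simp add: stays_def)

lemma stays_Cons: "stays k u (a # s) \<longleftrightarrow> u \<in> chamber k \<and> stays k (\<lambda>l. u l + a l) s"
  unfolding stays_def by (auto simp: All_less_Suc2 less_Suc_eq_le[symmetric] vsum_Cons add.assoc)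

lemma stays_append: "stays k u (s @ t) \<longleftrightarrow> stays k u s \<and> stays k (\<lambda>l. u l + vsum s l) t"
  by (induction s arbitrary: u) (auto simp: stays_Cons vsum_Cons add.assoc, auto simp: stays_def)

text \<open>Transfer operator of the atomic walk that is killed outside the chamber.\<close>

definition step_op :: "nat \<Rightarrow> rvec set \<Rightarrow> (rvec \<Rightarrow> real) \<Rightarrow> rvec \<Rightarrow> real" where
  "step_op k A g u = (if u \<in> chamber k then \<Sum>a\<in>A. g (\<lambda>l. u l + a l) else 0)"

definition walk_count :: "nat \<Rightarrow> rvec set \<Rightarrow> nat \<Rightarrow> rvec \<Rightarrow> real" where
  "walk_count k A m = (step_op k A ^^ m) (indicator (chamber k))"

lemma sum_lists_0: "(\<Sum>s | set s \<subseteq> A \<and> length s = 0. f s) = f []"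
proof -
  have eq: "{s. set s \<subseteq> A \<and> length s = 0} = {[]}" by auto
  show ?thesis unfolding eq by simp
qed

lemma sum_lists_Suc:
  "(\<Sum>s | set s \<subseteq> A \<and> length s = Suc m. f s) = (\<Sum>a\<in>A. \<Sum>s | set s \<subseteq> A \<and> length s = m. f (a # s))"
proof -
  have "{s. set s \<subseteq> A \<and> length s = Suc m} = (\<lambda>(a, s). a # s) ` (A \<times> {s. set s \<subseteq> A \<and> length s = m})"
    by (auto simp: length_Suc_conv image_iff)
  moreover have "inj_on (\<lambda>(a, s). a # s) (A \<times> {s. set s \<subseteq> A \<and> length s = m})"
    by (auto simp: inj_on_def)
  ultimately show ?thesis
    by (simp add: sum.reindex sum.cartesian_product case_prod_unfold)
qed

lemma sum_walks_eq_step_op: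
  assumes g: "\<And>u. u \<notin> chamber k \<Longrightarrow> g u = 0"
  shows "(\<Sum>s | set s \<subseteq> A \<and> length s = m. if stays k u s then g (\<lambda>l. u l + vsum s l) else 0)
    = (step_op k A ^^ m) g u"
proof (induction m arbitrary: u)
  case 0
  show ?case unfolding sum_lists_0 using g by simp
next
  case (Suc m)
  show ?case
  proof (cases "u \<in> chamber k")
    case True
    then show ?thesis
      unfolding sum_lists_Suc using Suc
      by (simp add: stays_Cons vsum_Cons add.assoc[symmetric] step_op_def[of k A "(step_op k A ^^ m) g"] cong: if_cong)
  next
    case False
    then show ?thesis unfolding sum_lists_Suc by (simp add: stays_Cons step_op_def)
  qed
qed

lemma walk_weight_eq:
  "walk_weight k S w n u = (\<Sum>ss | set ss \<subseteq> S \<and> length ss = n. if stays k u (concat ss) then prod_list (map w ss) else 0)"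
  if "finite S"
proof -
  have eq: "{ss. ss \<in> lists S \<and> length ss = n \<and> stays_in_chamber k u ss}
     = {ss \<in> {ss. set ss \<subseteq> S \<and> length ss = n}. stays k u (concat ss)}"
    by (auto simp: stays_in_chamber_def stays_def)
  show ?thesis unfolding walk_weight_def eq
    using that by (subst sum.inter_filter) (auto intro: finite_lists_length_eq)
qed

lemma walk_weight_Suc:
  assumes "finite S"
  shows "walk_weight k S w (Suc n) u
    = (\<Sum>s\<in>S. if stays k u s then w s * walk_weight k S w n (\<lambda>l. u l + vsum s l) else 0)"
  unfolding walk_weight_eq[OF assms] sum_lists_Suc
  by (intro sum.cong refl) (auto simp: stays_append sum_distrib_left if_distrib intro!: sum.cong)

lemma walk_weight_outside: "finite S \<Longrightarrow> u \<notin> chamber k \<Longrightarrow> walk_weight k S w n u = 0"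
  by (subst walk_weight_eq, assumption) (intro sum.neutral ballI, auto simp: stays_def)

text \<open>The atoms are corrected from the last to the first: transitivity gives a \<rho> that
  sends the atom at position j to the desired one, and applying it to the prefix of length j + 1
  does not disturb the atoms already corrected.\<close>

lemma prefix_invariant_length:
  assumes inv: "prefix_invariant k S w"
    and trans: "\<And>a b. a \<in> A \<Longrightarrow> b \<in> A \<Longrightarrow> \<exists>\<rho>\<in>signed_perms k. \<rho> a = b"
    and S: "S \<subseteq> lists A" and s: "s \<in> S" and t: "t \<in> lists A" "length t = length s"
  shows "t \<in> S \<and> w t = w s"
proof -
  have "\<exists>s'\<in>S. w s' = w s \<and> length s' = length s \<and> drop j s' = drop j t" if "j \<le> length s" for j
    using that
  proof (induction j rule: inc_induct)
    case base
    then show ?case using s t by (intro bexI[of _ s]) auto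
  next
    case (step j)
    then obtain s' where s': "s' \<in> S" "w s' = w s" "length s' = length s" "drop (Suc j) s' = drop (Suc j) t" by auto
    have "s' ! j \<in> A" "t ! j \<in> A"
      using s' S t step by (auto simp: in_lists_conv_set subset_iff)
    then obtain \<rho> where \<rho>: "\<rho> \<in> signed_perms k" "\<rho> (s' ! j) = t ! j" using trans by blast
    let ?s = "map \<rho> (take (Suc j) s') @ drop (Suc j) s'"
    have mem: "Suc j \<in> {1..length s'}" using s' step by auto
    have "?s \<in> S \<and> w ?s = w s'"
      using inv s'(1) \<rho>(1) mem unfolding prefix_invariant_def by blast
    moreover have "drop j ?s = drop j t"
    proof -
      have "drop j ?s = [\<rho> (s' ! j)] @ drop (Suc j) t"
        using s' step by (simp add: take_Suc_conv_app_nth)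
      then show ?thesis using \<rho>(2) step t by (simp add: Cons_nth_drop_Suc)
    qed
    ultimately show ?case using s' step t(2) by (intro bexI[of _ ?s]) auto
  qed
  from this[of 0] show ?thesis by auto
qed

lemma step_op_sum:
  "step_op k A (\<lambda>u. \<Sum>i\<in>X. c i * g i u) u = (\<Sum>i\<in>X. c i * step_op k A (g i) u)"
  by (simp add: step_op_def sum_distrib_left sum.swap[of _ A])

definition poly_walk :: "nat \<Rightarrow> rvec set \<Rightarrow> real poly \<Rightarrow> rvec \<Rightarrow> real" where
  "poly_walk k A p u = (\<Sum>m\<le>degree p. coeff p m * walk_count k A m u)"

lemma poly_walk_altdef: "degree p \<le> D \<Longrightarrow> poly_walk k A p u = (\<Sum>m\<le>D. coeff p m * walk_count k A m u)"
  unfolding poly_walk_def by (rule sum.mono_neutral_left) (auto intro!: coeff_eq_0)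

lemma poly_walk_0: "poly_walk k A 0 u = 0"
  by (simp add: poly_walk_def)

lemma poly_walk_add: "poly_walk k A (p + q) u = poly_walk k A p u + poly_walk k A q u"
proof -
  let ?D = "max (degree p) (degree q)"
  show ?thesis
    using poly_walk_altdef[of p ?D] poly_walk_altdef[of q ?D] poly_walk_altdef[of "p + q" ?D] degree_add_le_max[of p q]
    by (simp add: algebra_simps sum.distrib)
qed

lemma poly_walk_smult: "poly_walk k A (Polynomial.smult c p) u = c * poly_walk k A p u"
  using poly_walk_altdef[of "Polynomial.smult c p" "degree p" k A u]
  by (simp add: poly_walk_def sum_distrib_left mult.assoc)

lemma poly_walk_sum: "poly_walk k A (\<Sum>i\<in>X. p i) u = (\<Sum>i\<in>X. poly_walk k A (p i) u)"
  by (induction X rule: infinite_finite_induct) (auto simp: poly_walk_0 poly_walk_add)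

text \<open>Multiplication of the polynomial by x becomes one more step of the walk, so that
  products of polynomials turn into compositions of operators.\<close>

lemma poly_walk_pCons: "poly_walk k A (pCons 0 p) u = step_op k A (poly_walk k A p) u"
proof -
  have "poly_walk k A (pCons 0 p) u = (\<Sum>m\<le>Suc (degree p). coeff (pCons 0 p) m * walk_count k A m u)"
    by (rule poly_walk_altdef) (auto simp: degree_pCons_le)
  also have "\<dots> = (\<Sum>m\<le>degree p. coeff p m * walk_count k A (Suc m) u)"
    by (subst sum.atMost_Suc_shift) simp
  also have "\<dots> = step_op k A (poly_walk k A p) u"
    using step_op_sum[where X = "{..degree p}" and c = "coeff p" and g = "walk_count k A"]
    by (simp add: poly_walk_def[abs_def] walk_count_def)
  finally show ?thesis .
qed

lemma poly_walk_monom_mult: "poly_walk k A (monom 1 m * p) u = (step_op k A ^^ m) (poly_walk k A p) u"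
proof (induction m arbitrary: u)
  case (Suc m)
  have "monom 1 (Suc m) * p = pCons 0 (monom 1 m * p)" by (simp add: monom_Suc)
  then show ?case using Suc by (simp add: poly_walk_pCons step_op_def)
qed (simp add: monom_0)

lemma pderiv_sum: "pderiv (\<Sum>i\<in>X. p i) = (\<Sum>i\<in>X. pderiv (p i))"
  by (induction X rule: infinite_finite_induct) (auto simp: pderiv_add)

section \<open>Composite steps whose weight depends on their length only\<close>

locale length_weights =
  fixes k :: nat and A :: "rvec set" and S :: "rvec list set" and w :: "rvec list \<Rightarrow> real"
    and L :: "nat set" and wl :: "nat \<Rightarrow> real"
  assumes finA: "finite A" and finL: "finite L"
    and S_eq: "S = {s. set s \<subseteq> A \<and> length s \<in> L}"
    and w_eq: "s \<in> S \<Longrightarrow> w s = wl (length s)"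
begin

definition gf :: "real poly" where
  "gf = (\<Sum>m\<in>L. monom (wl m) m)"

lemma sum_S: "(\<Sum>s\<in>S. f s) = (\<Sum>m\<in>L. \<Sum>s | set s \<subseteq> A \<and> length s = m. f s)"
proof -
  have "S = (\<Union>m\<in>L. {s. set s \<subseteq> A \<and> length s = m})" by (auto simp: S_eq)
  then show ?thesis
    by (simp only:) (subst sum.UNION_disjoint, auto simp: finL finA intro: finite_lists_length_eq)
qed

lemma finS: "finite S"
proof -
  have "S = (\<Union>m\<in>L. {s. set s \<subseteq> A \<and> length s = m})" by (auto simp: S_eq)
  then show ?thesis using finL finA by (auto intro: finite_lists_length_eq)
qed

text \<open>All composite steps of length m together act as the m-th power of the transfer operator,
  since the condition on their inner positions is that of the atomic walk. This is multiplication by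
  x^m under \<open>poly_walk\<close>.\<close>

lemma walk_weight_eq_poly_walk: "walk_weight k S w n u = poly_walk k A (gf ^ n) u"
proof (induction n arbitrary: u)
  case 0
  show ?case unfolding walk_weight_eq[OF finS] sum_lists_0 by (simp add: poly_walk_def walk_count_def)
next
  case (Suc n)
  have "walk_weight k S w (Suc n) u
      = (\<Sum>m\<in>L. \<Sum>s | set s \<subseteq> A \<and> length s = m. wl m * (if stays k u s then walk_weight k S w n (\<lambda>l. u l + vsum s l) else 0))"
    unfolding walk_weight_Suc[OF finS] sum_S
    by (intro sum.cong refl) (use S_eq w_eq in auto)
  also have "\<dots> = (\<Sum>m\<in>L. wl m * (step_op k A ^^ m) (walk_weight k S w n) u)"
    unfolding sum_distrib_left[symmetric]
    by (intro sum.cong refl arg_cong2[where f = "(*)"] sum_walks_eq_step_op walk_weight_outside finS)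
  also have "\<dots> = (\<Sum>m\<in>L. poly_walk k A (monom (wl m) m * gf ^ n) u)"
  proof (intro sum.cong refl)
    fix m
    have "monom (wl m) m * gf ^ n = Polynomial.smult (wl m) (monom 1 m * gf ^ n)"
      by (metis mult.right_neutral mult_smult_left smult_monom)
    moreover have "walk_weight k S w n = poly_walk k A (gf ^ n)" using Suc by auto
    ultimately show "wl m * (step_op k A ^^ m) (walk_weight k S w n) u = poly_walk k A (monom (wl m) m * gf ^ n) u"
      by (simp add: poly_walk_smult poly_walk_monom_mult)
  qed
  also have "\<dots> = poly_walk k A (gf ^ Suc n) u"
    by (simp add: poly_walk_sum[symmetric] sum_distrib_right[symmetric] gf_def)
  finally show ?case .
qed

lemma step_gf_one_eq: "step_gf_one k S w = poly gf (card A)"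
proof -
  have "step_gf_one k S w = (\<Sum>m\<in>L. \<Sum>s | set s \<subseteq> A \<and> length s = m. wl m)"
    unfolding step_gf_one_def step_gf_def sum_S by (intro sum.cong refl) (use S_eq w_eq in auto)
  then show ?thesis
    by (simp add: gf_def poly_sum poly_monom card_lists_length_eq finA mult.commute)
qed

text \<open>Both moments share one induction: when the square of the extended sum is expanded, the
  mixed term drops out by the vanishing first moment.\<close>

lemma sum_lists_vsum:
  assumes "(\<Sum>a\<in>A. a l) = 0"
  shows "(\<Sum>s | set s \<subseteq> A \<and> length s = m. vsum s l) = 0"
    and "(\<Sum>s | set s \<subseteq> A \<and> length s = m. (vsum s l)\<^sup>2) = real m * card A ^ (m - 1) * (\<Sum>a\<in>A. (a l)\<^sup>2)"
proof -
  have "(\<Sum>s | set s \<subseteq> A \<and> length s = m. vsum s l) = 0 \<and>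
    (\<Sum>s | set s \<subseteq> A \<and> length s = m. (vsum s l)\<^sup>2) = real m * card A ^ (m - 1) * (\<Sum>a\<in>A. (a l)\<^sup>2)"
  proof (induction m)
    case 0
    show ?case unfolding sum_lists_0 by simp
  next
    case (Suc m)
    let ?X = "{s. set s \<subseteq> A \<and> length s = m}"
    have cX: "card ?X = card A ^ m" by (simp add: card_lists_length_eq finA)
    have 1: "(\<Sum>s | set s \<subseteq> A \<and> length s = Suc m. vsum s l) = 0"
      unfolding sum_lists_Suc vsum_Cons using Suc assms by (simp add: sum.distrib sum_distrib_left[symmetric])
    have "(\<Sum>s | set s \<subseteq> A \<and> length s = Suc m. (vsum s l)\<^sup>2)
      = (\<Sum>a\<in>A. \<Sum>s\<in>?X. (a l)\<^sup>2 + 2 * a l * vsum s l + (vsum s l)\<^sup>2)"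
      unfolding sum_lists_Suc vsum_Cons by (simp add: power2_sum add_ac)
    also have "\<dots> = card ?X * (\<Sum>a\<in>A. (a l)\<^sup>2) + card A * (\<Sum>s\<in>?X. (vsum s l)\<^sup>2)"
      using Suc by (simp add: sum.distrib sum_distrib_left[symmetric])
    also have "\<dots> = real (Suc m) * card A ^ (Suc m - 1) * (\<Sum>a\<in>A. (a l)\<^sup>2)"
      unfolding cX using Suc by (cases m) (simp_all add: algebra_simps)
    finally show ?case using 1 by simp
  qed
  then show "(\<Sum>s | set s \<subseteq> A \<and> length s = m. vsum s l) = 0"
    "(\<Sum>s | set s \<subseteq> A \<and> length s = m. (vsum s l)\<^sup>2) = real m * card A ^ (m - 1) * (\<Sum>a\<in>A. (a l)\<^sup>2)"
    by auto
qed

text \<open>A power t^b contributes b (b - 1) at t = 1. The linear parts sum to 0, and the second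
  moments, proportional to m card(A)^(m-1), assemble to the derivative of \<open>gf\<close>.\<close>

lemma step_gf_snd_deriv_one_eq:
  assumes l: "l \<in> {1..k}" and zero: "(\<Sum>a\<in>A. a l) = 0"
  shows "step_gf_snd_deriv_one k S w l = poly (pderiv gf) (card A) * (\<Sum>a\<in>A. (a l)\<^sup>2)"
proof -
  define f where "f t = step_gf k S w ((\<lambda>_. 1)(l := t))" for t
  have f: "f t = (\<Sum>s\<in>S. w s * t powr vsum s l)" for t
  proof -
    have "(\<Prod>j = 1..k. ((\<lambda>_. 1)(l := t)) j powr vsum s j) = t powr vsum s l" for s
      using l by (subst prod.remove[of _ l]) (auto intro!: prod.neutral)
    then show ?thesis by (simp add: f_def step_gf_def)
  qed
  have d1: "deriv f t = (\<Sum>s\<in>S. w s * (vsum s l * t powr (vsum s l - 1)))" if "t > 0" for t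
    unfolding f[abs_def] using that by (intro DERIV_imp_deriv DERIV_sum DERIV_cmult has_real_derivative_powr)
  have "deriv (deriv f) 1 = deriv (\<lambda>t. \<Sum>s\<in>S. w s * (vsum s l * t powr (vsum s l - 1))) 1"
  proof (rule deriv_cong_ev)
    \<comment> \<open>The formula for the first derivative is available for t > 0 only, hence in a
      neighbourhood of 1.\<close>
    show "\<forall>\<^sub>F t in nhds 1. deriv f t = (\<Sum>s\<in>S. w s * (vsum s l * t powr (vsum s l - 1)))"
      using eventually_nhds_in_open[of "{0<..}" "1::real"] by (auto elim!: eventually_mono simp: d1)
  qed simp
  also have "\<dots> = (\<Sum>s\<in>S. w s * (vsum s l * ((vsum s l - 1) * 1 powr (vsum s l - 1 - 1))))"
    by (intro DERIV_imp_deriv DERIV_sum DERIV_cmult has_real_derivative_powr) simp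
  also have "\<dots> = (\<Sum>s\<in>S. w s * ((vsum s l)\<^sup>2 - vsum s l))"
    by (intro sum.cong refl) (simp add: power2_eq_square algebra_simps)
  also have "\<dots> = (\<Sum>m\<in>L. \<Sum>s | set s \<subseteq> A \<and> length s = m. wl m * ((vsum s l)\<^sup>2 - vsum s l))"
    unfolding sum_S by (intro sum.cong refl) (use S_eq w_eq in auto)
  also have "\<dots> = (\<Sum>m\<in>L. wl m * (real m * card A ^ (m - 1) * (\<Sum>a\<in>A. (a l)\<^sup>2)))"
    unfolding sum_distrib_left[symmetric] sum_subtractf sum_lists_vsum[OF zero] by simp
  also have "\<dots> = poly (pderiv gf) (card A) * (\<Sum>a\<in>A. (a l)\<^sup>2)"
    by (simp only: gf_def pderiv_sum poly_sum pderiv_monom poly_monom sum_distrib_right) (intro sum.cong refl, simp)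
  finally show ?thesis
    by (simp add: step_gf_snd_deriv_one_def numeral_2_eq_2 f_def[abs_def])
qed

end

lemma length_weights_exists:
  assumes comp: "composite_step_set A S w" and inv: "prefix_invariant k S w" and A: "finite A"
    and trans: "\<And>a b. a \<in> A \<Longrightarrow> b \<in> A \<Longrightarrow> \<exists>\<rho>\<in>signed_perms k. \<rho> a = b"
  obtains wl where "length_weights A S w (length ` S) wl"
proof -
  have S: "S \<subseteq> lists A" "finite S" using comp by (auto simp: composite_step_set_def)
  have len: "t \<in> S \<and> w t = w s" if "s \<in> S" "set t \<subseteq> A" "length t = length s" for s t
    using prefix_invariant_length[OF inv trans S(1) that(1)] that by auto
  define wl where "wl m = w (SOME s. s \<in> S \<and> length s = m)" for m
  have "w s = wl (length s)" if "s \<in> S" for s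
  proof -
    have "(SOME t. t \<in> S \<and> length t = length s) \<in> S \<and> length (SOME t. t \<in> S \<and> length t = length s) = length s"
      by (rule someI[of _ s]) (use that in auto)
    then have "w (SOME t. t \<in> S \<and> length t = length s) = w s"
      using len[OF that] S(1) by blast
    then show ?thesis by (simp add: wl_def)
  qed
  moreover have "S = {s. set s \<subseteq> A \<and> length s \<in> length ` S}"
    using S(1) len by (auto simp: image_iff)
  ultimately have "length_weights A S w (length ` S) wl"
    using A S(2) unfolding length_weights_def by auto
  then show ?thesis by (rule that)
qed

section \<open>Alternants\<close>

text \<open>Equal to -2 sinh(b z). With this sign the exponential exp(- b z), which extracts the
  coefficient of exponent b, counts positively.\<close>

definition sinh_diff :: "real \<Rightarrow> complex \<Rightarrow> complex" where
  "sinh_diff b z = exp (- of_real b * z) - exp (of_real b * z)"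

definition alternant :: "nat \<Rightarrow> (nat \<Rightarrow> real) \<Rightarrow> (nat \<Rightarrow> complex) \<Rightarrow> complex" where
  "alternant k b z = (\<Sum>p | p permutes {..<k}. of_int (sign p) * (\<Prod>i<k. sinh_diff (b (p i)) (z i)))"

lemma leibniz_det:
  "(\<Sum>p | p permutes {..<k}. of_int (sign p) * (\<Prod>i<k. f i (p i))) = Determinant.det (Matrix.mat k k (\<lambda>(i, j). f i j))"
  (is "?L = Determinant.det ?A")
proof -
  have "Determinant.det ?A = (\<Sum>p | p permutes {0..<k}. of_int (sign p) * (\<Prod>i = 0..<k. ?A $$ (i, p i)))"
    by (rule det_def') simp
  also have "\<dots> = (\<Sum>p | p permutes {0..<k}. of_int (sign p) * (\<Prod>i = 0..<k. f i (p i)))"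
    by (intro sum.cong refl arg_cong2[where f = "(*)"] prod.cong) (auto dest: permutes_in_image)
  finally show ?thesis by (simp add: atLeast0LessThan)
qed

lemma alternant_det: "alternant k b z = Determinant.det (Matrix.mat k k (\<lambda>(i, j). sinh_diff (b j) (z i)))"
  unfolding alternant_def by (rule leibniz_det)

lemma alternant_wall_eq:
  assumes "i < k" "j < k" "i \<noteq> j" "b i = b j"
  shows "alternant k b z = 0"
  unfolding alternant_det
  using assms by (intro Determinant.det_identical_columns[where i = i and j = j and n = k]) (auto intro!: eq_vecI)

lemma alternant_wall_0:
  assumes "i < k" "b i = 0"
  shows "alternant k b z = 0"
  unfolding alternant_def
proof (intro sum.neutral ballI)
  fix p assume "p \<in> {p. p permutes {..<k}}"
  then have p: "p permutes {..<k}" by simp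
  obtain i' where i': "p i' = i" using permutes_surj[OF p] by (metis surjD)
  then have "i' < k" using permutes_in_image[OF p, of i'] assms by simp
  then have "(\<Prod>i<k. sinh_diff (b (p i)) (z i)) = 0"
    using assms i' by (intro prod_zero bexI[of _ i']) (auto simp: sinh_diff_def)
  then show "of_int (sign p) * (\<Prod>i<k. sinh_diff (b (p i)) (z i)) = 0" by simp
qed

lemma sgn_vandermonde_eq_ord_sign: "of_int (ord_sign {..<k} v) = (sgn (vandermonde k (\<lambda>i. of_int (v i))) :: real)"
proof -
  have "{j \<in> {..<k}. j < m} = {..<m}" if "m \<in> {..<k}" for m using that by auto
  moreover have "of_int (sgn (a - b)) = (sgn (of_int a - of_int b) :: real)" for a b :: int
    by (simp add: sgn_if)
  moreover have "sgn (\<Prod>i\<in>X. f i) = (\<Prod>i\<in>X. sgn (f i))" for f :: "nat \<Rightarrow> real" and X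
    by (induction X rule: infinite_finite_induct) (auto simp: sgn_mult)
  ultimately show ?thesis unfolding ord_sign_def vandermonde_def of_int_prod by simp
qed

lemma vandermonde_pos:
  fixes t :: "nat \<Rightarrow> real"
  assumes "\<And>i j. i < j \<Longrightarrow> j < k \<Longrightarrow> t i < t j"
  shows "vandermonde k t > 0"
  unfolding vandermonde_def using assms by (intro prod_pos) auto

lemma ord_sign_permute:
  assumes p: "p permutes {..<k}" and v: "\<And>i j. i < j \<Longrightarrow> j < k \<Longrightarrow> v i < v j"
  shows "ord_sign {..<k} (\<lambda>i. v (p i)) = sign p"
proof -
  have "vandermonde k (\<lambda>i. real_of_int (v (p i))) = of_int (sign p) * vandermonde k (\<lambda>i. of_int (v i))"
    using vandermonde_permute[OF p, of "\<lambda>i. real_of_int (v i)"] by (simp add: comp_def)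
  moreover have "vandermonde k (\<lambda>i. real_of_int (v i)) > 0"
    using v by (intro vandermonde_pos) auto
  ultimately have "real_of_int (ord_sign {..<k} (\<lambda>i. v (p i))) = of_int (sign p)"
    unfolding sgn_vandermonde_eq_ord_sign by (simp add: sgn_mult sign_def)
  then show ?thesis by linarith
qed

abbreviation polar :: "(nat \<Rightarrow> real) \<Rightarrow> (nat \<Rightarrow> real) \<Rightarrow> nat \<Rightarrow> complex" where
  "polar r y \<equiv> (\<lambda>j. Complex (r j) (y j))"

text \<open>The factor \<open>exp (- e/2 \<Sum>z)\<close> with \<open>e = 1\<close> makes the exponents integral when \<open>b\<close> lies in
  \<open>(\<int> + 1/2)\<^sup>k\<close>.\<close>

definition walk_integrand :: "nat \<Rightarrow> nat \<Rightarrow> (nat \<Rightarrow> real) \<Rightarrow> (nat \<Rightarrow> complex) \<Rightarrow> complex" where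
  "walk_integrand k e b z = alternant k b z * littlewood {..<k} (\<lambda>j. exp (z j)) * (\<Prod>j<k. exp (- (of_nat e / 2) * z j))"

lemma walk_integrand_measurable:
  "(\<lambda>y. walk_integrand k e b (polar r y)) \<in> borel_measurable (torus {..<k})"
  unfolding walk_integrand_def alternant_def sinh_diff_def
  by (intro borel_measurable_times borel_measurable_prod measurable_littlewood borel_measurable_sum borel_measurable_diff)
     (auto intro!: borel_measurable_exp measurable_Complex)

text \<open>Expand the k differences of exponentials; the subset \<open>X\<close> collects the
  places where the second exponential is chosen. There the extracted exponent is e - \<beta>, at
  most 0, while the kernel has positive exponents only, so the empty \<open>X\<close> alone
  survives. Its coefficient is the sign of p, which squares away, and each of the k! permutations
  contributes 1.\<close>

lemma integral_walk_integrand: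
  assumes r: "\<And>j. j < k \<Longrightarrow> r j < 0" and inj: "inj_on r {..<k}"
    and e: "e \<le> 1" and b: "\<And>j. j < k \<Longrightarrow> b j = of_int (\<beta> j) - of_nat e / 2"
    and pos: "\<And>j. j < k \<Longrightarrow> 1 \<le> \<beta> j" and mono: "\<And>i j. i < j \<Longrightarrow> j < k \<Longrightarrow> \<beta> i < \<beta> j"
  shows "(\<integral>y. walk_integrand k e b (polar r y) \<partial>torus {..<k}) = fact k"
proof -
  let ?K = "{..<k}"
  define v where "v p X j = (if j \<in> X then int e - \<beta> (p j) else \<beta> (p j))" for p :: "nat \<Rightarrow> nat" and X j
  define E where "E p X y = (\<Prod>j\<in>?K. exp (- of_int (v p X j) * Complex (r j) (y j))) * littlewood ?K (\<lambda>j. exp (Complex (r j) (y j)))"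
    for p X y
  have int: "integrable (torus ?K) (E p X)" for p X
    unfolding E_def[abs_def] using littlewood_coeff_measurable[OF order_refl] littlewood_coeff_integrand_bounded[of ?K r ?K, OF _ order_refl] r
    by (intro integrable_torus_bounded) auto
  have val: "(\<integral>y. E p X y \<partial>torus ?K) = (if X = {} then of_int (sign p) else 0)"
    if p: "p permutes ?K" and X: "X \<subseteq> ?K" for p X
  proof -
    have eq: "(\<integral>y. E p X y \<partial>torus ?K) = (if \<forall>j\<in>?K. 1 \<le> v p X j then of_int (ord_sign ?K (v p X)) else 0)"
      using littlewood_coeff_eq[of ?K r "v p X"] r inj unfolding E_def[abs_def] by (simp add: littlewood_coeff_def)
    have pk: "p j < k" if "j < k" for j using permutes_in_image[OF p] that by auto
    show ?thesis
    proof (cases "X = {}")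
      case True
      then have "v p X = (\<lambda>j. \<beta> (p j))" by (auto simp: v_def)
      then show ?thesis using True pos pk ord_sign_permute[OF p mono] unfolding eq by auto
    next
      case False
      then obtain j where j: "j \<in> X" "j < k" using X by auto
      then have "v p X j < 1" using pos[OF pk[OF j(2)]] e by (simp add: v_def)
      then show ?thesis using False j unfolding eq by force
    qed
  qed
  have "walk_integrand k e b (polar r y)
      = (\<Sum>p | p permutes ?K. of_int (sign p) * (\<Sum>X\<in>Pow ?K. (-1) ^ card X * E p X y))" for y
  proof -
    have "(\<Prod>i<k. sinh_diff (b (p i)) (polar r y i)) * (\<Prod>j<k. exp (- (of_nat e / 2) * polar r y j))
       = (\<Sum>X\<in>Pow ?K. (-1) ^ card X * (\<Prod>j\<in>?K. exp (- of_int (v p X j) * Complex (r j) (y j))))"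
      if p: "p permutes ?K" for p
    proof -
      have pk: "p j < k" if "j < k" for j using permutes_in_image[OF p] that by auto
      have "sinh_diff (b (p j)) (polar r y j) * exp (- (of_nat e / 2) * polar r y j)
          = exp (- of_int (\<beta> (p j)) * polar r y j) - exp (- of_int (int e - \<beta> (p j)) * polar r y j)"
        if "j < k" for j
        unfolding sinh_diff_def left_diff_distrib exp_add[symmetric] b[OF pk[OF that]]
        by (intro arg_cong2[where f = "(-)"] arg_cong[where f = exp]) (simp_all add: algebra_simps)
      then have "(\<Prod>i<k. sinh_diff (b (p i)) (polar r y i)) * (\<Prod>j<k. exp (- (of_nat e / 2) * polar r y j))
        = (\<Prod>j\<in>?K. exp (- of_int (\<beta> (p j)) * polar r y j) - exp (- of_int (int e - \<beta> (p j)) * polar r y j))"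
        unfolding prod.distrib[symmetric] by (intro prod.cong) auto
      also have "\<dots> = (\<Sum>X\<in>Pow ?K. (-1) ^ card X * (\<Prod>j\<in>X. exp (- of_int (int e - \<beta> (p j)) * polar r y j))
          * (\<Prod>j\<in>?K - X. exp (- of_int (\<beta> (p j)) * polar r y j)))"
        by (rule prod_diff_conv_sum) simp
      also have "\<dots> = (\<Sum>X\<in>Pow ?K. (-1) ^ card X * (\<Prod>j\<in>?K. exp (- of_int (v p X j) * Complex (r j) (y j))))"
      proof (intro sum.cong refl)
        fix X assume X: "X \<in> Pow ?K"
        then have "(\<Prod>j\<in>?K. exp (- of_int (v p X j) * Complex (r j) (y j)))
          = (\<Prod>j\<in>?K - X. exp (- of_int (v p X j) * Complex (r j) (y j))) * (\<Prod>j\<in>X. exp (- of_int (v p X j) * Complex (r j) (y j)))"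
          by (intro prod.subset_diff) auto
        then show "(-1) ^ card X * (\<Prod>j\<in>X. exp (- of_int (int e - \<beta> (p j)) * polar r y j))
          * (\<Prod>j\<in>?K - X. exp (- of_int (\<beta> (p j)) * polar r y j))
          = (-1) ^ card X * (\<Prod>j\<in>?K. exp (- of_int (v p X j) * Complex (r j) (y j)))"
          by (simp add: v_def mult_ac)
      qed
      finally show ?thesis .
    qed
    then have "(\<Sum>p | p permutes ?K. of_int (sign p) * ((\<Prod>i<k. sinh_diff (b (p i)) (polar r y i)) * (\<Prod>j<k. exp (- (of_nat e / 2) * polar r y j))
          * littlewood ?K (\<lambda>j. exp (Complex (r j) (y j)))))
       = (\<Sum>p | p permutes ?K. of_int (sign p) * (\<Sum>X\<in>Pow ?K. (-1) ^ card X * E p X y))"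
      by (intro sum.cong refl) (simp add: E_def sum_distrib_right mult.assoc)
    then show ?thesis
      unfolding walk_integrand_def alternant_def sum_distrib_right by (simp add: mult_ac)
  qed
  then have "(\<integral>y. walk_integrand k e b (polar r y) \<partial>torus ?K)
    = (\<Sum>p | p permutes ?K. of_int (sign p) * (\<Sum>X\<in>Pow ?K. (-1) ^ card X * (\<integral>y. E p X y \<partial>torus ?K)))"
    using int by (simp add: Bochner_Integration.integral_sum)
  also have "\<dots> = (\<Sum>p | p permutes ?K. of_int (sign p) * (\<Sum>X\<in>Pow ?K. if X = {} then of_int (sign p) else 0))"
    by (intro sum.cong refl arg_cong2[where f = "(*)"]) (auto simp: val)
  also have "\<dots> = (\<Sum>p | p permutes ?K. 1)"
    by (intro sum.cong refl) (simp add: of_int_mult[symmetric] del: of_int_mult)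
  also have "\<dots> = fact k"
    using card_permutations[of ?K k] by simp
  finally show ?thesis .
qed

section \<open>Hyperbolic sines as polynomials, and central factorials\<close>

fun sinh_poly :: "nat \<Rightarrow> nat \<Rightarrow> complex poly" where
  "sinh_poly e 0 = (if e = 0 then 0 else [:- 1 / 2:])"
| "sinh_poly e (Suc 0) = (if e = 0 then 1 else [:1 / 2:])"
| "sinh_poly e (Suc (Suc n)) = [:2, 1:] * sinh_poly e (Suc n) - sinh_poly e n"

text \<open>The factor 2 in the second case normalises both cases to 2 z + O(z^3); then the constant
  coefficient of \<open>sinh_poly e n\<close> is the coordinate n - e/2 itself in both
  parities.\<close>

definition alternant_factor :: "nat \<Rightarrow> complex \<Rightarrow> complex" where
  "alternant_factor e z = (if e = 0 then exp z - exp (- z) else 2 * (exp (z / 2) - exp (- z / 2)))"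

text \<open>The shift by 2 puts the point z = 0 at the node 0, where divided differences are
  coefficients.\<close>

definition cosh_var :: "complex \<Rightarrow> complex" where
  "cosh_var z = exp z + exp (- z) - 2"

lemma sinh_diff_rec: "sinh_diff (b + 1) z = (2 + cosh_var z) * sinh_diff b z - sinh_diff (b - 1) z"
proof -
  have "exp (- of_real (b + 1) * z) = exp (- of_real b * z) * exp (- z)"
    "exp (of_real (b + 1) * z) = exp (of_real b * z) * exp z"
    "exp (- of_real (b - 1) * z) = exp (- of_real b * z) * exp z"
    "exp (of_real (b - 1) * z) = exp (of_real b * z) * exp (- z)"
    unfolding exp_add[symmetric] by (auto intro!: arg_cong[where f = exp] simp: algebra_simps)
  then show ?thesis unfolding sinh_diff_def cosh_var_def by (simp add: algebra_simps)
qed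

text \<open>sinh(b z) obeys a three-term recursion of Chebyshev type when b moves in steps of 1; the
  parity only changes the starting values b = - e/2 and b = 1 - e/2. For e = 0 the polynomials are
  Chebyshev polynomials of the second kind in 1 + X/2.\<close>

lemma sinh_diff_sinh_poly:
  assumes "e \<le> 1"
  shows "sinh_diff (real n - real e / 2) z = - alternant_factor e z * poly (sinh_poly e n) (cosh_var z)"
  using assms
proof (induction e n rule: sinh_poly.induct)
  case (1 e)
  then have "e = 0 \<or> e = 1" by auto
  then show ?case by (auto simp: sinh_diff_def alternant_factor_def field_simps)
next
  case (2 e)
  then have "e = 0 \<or> e = 1" by auto
  then show ?case by (auto simp: sinh_diff_def alternant_factor_def field_simps)
next
  case (3 e n)
  have "sinh_diff (real (Suc (Suc n)) - real e / 2) z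
      = (2 + cosh_var z) * sinh_diff (real (Suc n) - real e / 2) z - sinh_diff (real n - real e / 2) z"
    using sinh_diff_rec[of "real (Suc n) - real e / 2" z] by (simp add: algebra_simps)
  then show ?case using 3 by (simp add: algebra_simps)
qed

text \<open>The coefficient of s^i in 2 sinh(b z) / \<open>alternant_factor e z\<close>, where s =
  \<open>cosh_var z\<close> and b = n - e/2.\<close>

definition central_factorial :: "nat \<Rightarrow> nat \<Rightarrow> real \<Rightarrow> real" where
  "central_factorial e i b = b * (\<Prod>l = 1..i. b\<^sup>2 - (real l - real e / 2)\<^sup>2) / fact (2 * i + 1)"

lemma central_factorial_shift_0:
  "(b + 1) * (\<Prod>l = 1..Suc i. (b + 1)\<^sup>2 - (real l)\<^sup>2)
     = b * (\<Prod>l = 1..i. b\<^sup>2 - (real l)\<^sup>2) * (b + i + 1) * (b + i + 2)"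
proof (induction i)
  case (Suc i)
  have "(b + 1) * (\<Prod>l = 1..Suc (Suc i). (b + 1)\<^sup>2 - (real l)\<^sup>2)
      = b * (\<Prod>l = 1..i. b\<^sup>2 - (real l)\<^sup>2) * (b + i + 1) * (b + i + 2) * ((b + 1)\<^sup>2 - (real (Suc (Suc i)))\<^sup>2)"
    using Suc.IH by (simp add: mult.assoc[symmetric])
  also have "\<dots> = b * ((\<Prod>l = 1..i. b\<^sup>2 - (real l)\<^sup>2) * (b\<^sup>2 - (real (Suc i))\<^sup>2)) * (b + Suc i + 1) * (b + Suc i + 2)"
    by (simp add: power2_eq_square) (simp add: algebra_simps)
  finally show ?case by simp
qed (simp add: power2_eq_square algebra_simps)

lemma central_factorial_shift_1:
  "(\<Prod>l = 1..Suc i. (b + 1)\<^sup>2 - (real l - 1 / 2)\<^sup>2)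
     = (\<Prod>l = 1..i. b\<^sup>2 - (real l - 1 / 2)\<^sup>2) * (b + i + 1 / 2) * (b + i + 3 / 2)"
proof (induction i)
  case (Suc i)
  have "(\<Prod>l = 1..Suc (Suc i). (b + 1)\<^sup>2 - (real l - 1 / 2)\<^sup>2)
      = (\<Prod>l = 1..i. b\<^sup>2 - (real l - 1 / 2)\<^sup>2) * (b + i + 1 / 2) * (b + i + 3 / 2) * ((b + 1)\<^sup>2 - (real (Suc (Suc i)) - 1 / 2)\<^sup>2)"
    using Suc.IH by simp
  also have "(b + 1)\<^sup>2 - (real (Suc (Suc i)) - 1 / 2)\<^sup>2 = (b - i - 1 / 2) * (b + Suc i + 3 / 2)"
    by (simp add: power2_eq_square field_simps)
  also have "(\<Prod>l = 1..i. b\<^sup>2 - (real l - 1 / 2)\<^sup>2) * (b + i + 1 / 2) * (b + i + 3 / 2) * ((b - i - 1 / 2) * (b + Suc i + 3 / 2))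
     = ((\<Prod>l = 1..i. b\<^sup>2 - (real l - 1 / 2)\<^sup>2) * ((b + i + 1 / 2) * (b - i - 1 / 2))) * (b + i + 3 / 2) * (b + Suc i + 3 / 2)"
    by (simp only: mult_ac)
  also have "(b + i + 1 / 2) * (b - i - 1 / 2) = b\<^sup>2 - (real (Suc i) - 1 / 2)\<^sup>2"
    by (simp add: power2_eq_square field_simps)
  also have "b + i + 3 / 2 = b + Suc i + 1 / 2" by simp
  finally show ?case by simp
qed (simp add: power2_eq_square field_simps)

lemma central_factorial_eq_0:
  assumes "i > 0"
  shows "central_factorial (Suc 0) i (- (1 / 2)) = 0" "central_factorial (Suc 0) i (1 / 2) = 0"
    "central_factorial 0 i 1 = 0"
proof -
  have "(\<Prod>l = 1..i. (1 / 2)\<^sup>2 - (real l - 1 / 2)\<^sup>2) = 0" "(\<Prod>l = 1..i. 1 - (real l)\<^sup>2) = 0"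
    using assms by (intro prod_zero bexI[of _ 1]; simp)+
  then show "central_factorial (Suc 0) i (- (1 / 2)) = 0" "central_factorial (Suc 0) i (1 / 2) = 0"
    "central_factorial 0 i 1 = 0"
    unfolding central_factorial_def by simp_all
qed

text \<open>The recursion of \<open>sinh_poly\<close> compared coefficientwise: a second difference
  in b lowers the index by one. The shift to b - 1 follows from the shift to b + 1 applied to - b,
  since the products are even in b.\<close>

lemma central_factorial_rec:
  assumes "e \<le> 1"
  shows "central_factorial e (Suc i) (b + 1) + central_factorial e (Suc i) (b - 1) - 2 * central_factorial e (Suc i) b
     = central_factorial e i b"
proof -
  define P where "P b = (\<Prod>l = 1..i. b\<^sup>2 - (real l - real e / 2)\<^sup>2)" for b
  define h where "h = real e / 2"
  have P': "(\<Prod>l = 1..Suc i. b\<^sup>2 - (real l - real e / 2)\<^sup>2) = P b * (b\<^sup>2 - (real (Suc i) - h)\<^sup>2)"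
    by (simp add: P_def h_def)
  have even: "P (- b) = P b" by (simp add: P_def)
  have key: "(b + 1) * (\<Prod>l = 1..Suc i. (b + 1)\<^sup>2 - (real l - real e / 2)\<^sup>2)
     + (b - 1) * (\<Prod>l = 1..Suc i. (b - 1)\<^sup>2 - (real l - real e / 2)\<^sup>2)
     - 2 * (b * (\<Prod>l = 1..Suc i. b\<^sup>2 - (real l - real e / 2)\<^sup>2))
     = b * P b * ((2 * real i + 3) * (2 * real i + 2))"
  proof (cases "e = 0")
    case True
    have m: "(- b + 1)\<^sup>2 = (b - 1)\<^sup>2" by (simp add: power2_eq_square algebra_simps)
    have A: "(b + 1) * (\<Prod>l = 1..Suc i. (b + 1)\<^sup>2 - (real l - real e / 2)\<^sup>2) = b * P b * (b + i + 1) * (b + i + 2)"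
      using central_factorial_shift_0[of b i] True by (simp add: P_def)
    have "(- b + 1) * (\<Prod>l = 1..Suc i. (b - 1)\<^sup>2 - (real l - real e / 2)\<^sup>2) = - b * P (- b) * (- b + i + 1) * (- b + i + 2)"
      using central_factorial_shift_0[of "- b" i] True unfolding m by (simp add: P_def)
    then have B: "(b - 1) * (\<Prod>l = 1..Suc i. (b - 1)\<^sup>2 - (real l - real e / 2)\<^sup>2) = b * P b * (- b + i + 1) * (- b + i + 2)"
      unfolding even by (simp add: algebra_simps)
    show ?thesis unfolding A B P' using True
      by (simp add: h_def power2_eq_square) (simp add: algebra_simps)
  next
    case False
    then have e: "e = 1" using assms by simp
    have m: "(- b + 1)\<^sup>2 = (b - 1)\<^sup>2" by (simp add: power2_eq_square algebra_simps)
    have A: "(\<Prod>l = 1..Suc i. (b + 1)\<^sup>2 - (real l - real e / 2)\<^sup>2) = P b * (b + i + 1 / 2) * (b + i + 3 / 2)"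
      using central_factorial_shift_1[of b i] e by (simp add: P_def)
    have B: "(\<Prod>l = 1..Suc i. (b - 1)\<^sup>2 - (real l - real e / 2)\<^sup>2) = P b * (- b + i + 1 / 2) * (- b + i + 3 / 2)"
      using central_factorial_shift_1[of "- b" i] e even unfolding m by (simp add: P_def)
    show ?thesis unfolding A B P' using e
      by (simp add: h_def power2_eq_square) (simp add: field_simps)
  qed
  have f: "fact (2 * Suc i + 1) = (2 * real i + 3) * (2 * real i + 2) * fact (2 * i + 1)"
    by (simp add: algebra_simps)
  have "central_factorial e (Suc i) (b + 1) + central_factorial e (Suc i) (b - 1) - 2 * central_factorial e (Suc i) b
     = (b * P b * ((2 * real i + 3) * (2 * real i + 2))) / fact (2 * Suc i + 1)"
    unfolding key[symmetric] central_factorial_def by (simp add: add_divide_distrib diff_divide_distrib)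
  also have "\<dots> = central_factorial e i b"
    unfolding f central_factorial_def P_def by (simp add: divide_simps add_nonneg_eq_0_iff)
  finally show ?thesis .
qed

lemma coeff_sinh_poly:
  assumes "e \<le> 1"
  shows "coeff (sinh_poly e n) i = of_real (central_factorial e i (real n - real e / 2))"
  using assms
proof (induction e n arbitrary: i rule: sinh_poly.induct)
  case (1 e)
  then have "e = 0 \<or> e = 1" by auto
  then show ?case
    by (cases i) (auto simp: central_factorial_eq_0, auto simp: central_factorial_def)
next
  case (2 e)
  then have "e = 0 \<or> e = 1" by auto
  then show ?case
    by (cases i) (auto simp: central_factorial_eq_0, auto simp: central_factorial_def)
next
  case (3 e n)
  define b where "b = real (Suc n) - real e / 2"
  have IH: "coeff (sinh_poly e (Suc n)) j = of_real (central_factorial e j b)"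
    "coeff (sinh_poly e n) j = of_real (central_factorial e j (b - 1))" for j
    using 3 by (auto simp: b_def algebra_simps)
  have b1: "real (Suc (Suc n)) - real e / 2 = b + 1" by (simp add: b_def)
  show ?case
  proof (cases i)
    case 0
    then show ?thesis unfolding b1 by (simp add: IH central_factorial_def)
  next
    case (Suc j)
    have "coeff (sinh_poly e (Suc (Suc n))) i
       = of_real (2 * central_factorial e (Suc j) b + central_factorial e j b - central_factorial e (Suc j) (b - 1))"
      by (simp add: Suc IH)
    then show ?thesis
      unfolding b1 Suc using central_factorial_rec[OF 3(3), of j b] by (simp add: algebra_simps flip: of_real_add of_real_diff of_real_mult)
  qed
qed

section \<open>Cancellation of the poles of the kernel\<close>

definition kernel_factor :: "nat \<Rightarrow> complex \<Rightarrow> complex" where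
  "kernel_factor e z = (if e = 0 then 1 + exp z else 2 * exp (z / 2))"

text \<open>What is left of the alternant after the poles are cancelled; a polynomial in the nodes
  \<open>s\<close>.\<close>

definition alternant_quotient :: "nat \<Rightarrow> nat \<Rightarrow> (nat \<Rightarrow> nat) \<Rightarrow> (nat \<Rightarrow> complex) \<Rightarrow> complex" where
  "alternant_quotient k e n s = Determinant.det (Matrix.mat k k (\<lambda>(i, j). divided_diff (sinh_poly e (n j)) s i))"

text \<open>\<open>e\<close> is the parity of the starting point and \<open>e'\<close> that of the
  end of the walk. For imaginary z the double product is the squared modulus of the Vandermonde
  product of the exp(z_j).\<close>

definition torus_kernel :: "nat \<Rightarrow> nat \<Rightarrow> nat \<Rightarrow> (nat \<Rightarrow> nat) \<Rightarrow> (nat \<Rightarrow> complex) \<Rightarrow> complex" where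
  "torus_kernel k e e' n z = (\<Prod>i<k. kernel_factor e (z i) * exp (- (of_nat e' / 2) * z i))
     * (\<Prod>m<k. \<Prod>j<m. - (exp ((z m - z j) / 2) - exp (- (z m - z j) / 2))\<^sup>2)
     * alternant_quotient k e n (\<lambda>l. cosh_var (z l))"

lemma alternant_factor_kernel_factor:
  assumes "exp z \<noteq> 1"
  shows "- alternant_factor e z * (exp z / (1 - exp z)) = kernel_factor e z"
proof -
  define a where "a = exp (z / 2)"
  have a: "a \<noteq> 0" "exp z = a * a" "exp (- z) = 1 / (a * a)" "exp (- z / 2) = 1 / a"
    by (simp_all add: a_def exp_add[symmetric] exp_minus inverse_eq_divide)
  have "1 - a * a \<noteq> 0" using assms a by auto
  then show ?thesis
    unfolding alternant_factor_def kernel_factor_def a(2,3,4) a_def[symmetric] using a(1)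
    by (cases "e = 0") (simp_all add: field_simps)
qed

text \<open>The first difference is (e^w - e^z) (1 - e^(-w-z)), whose second factor cancels the
  denominator up to -e^(-w-z).\<close>

lemma cosh_var_pair:
  assumes "exp z * exp w \<noteq> 1"
  shows "(cosh_var w - cosh_var z) * ((exp w - exp z) / (1 - exp z * exp w))
     = - (exp ((w - z) / 2) - exp (- (w - z) / 2))\<^sup>2"
proof -
  define a where "a = exp (w / 2)"
  define c where "c = exp (z / 2)"
  have a: "a \<noteq> 0" "exp w = a * a" "exp (- w) = 1 / (a * a)"
    by (simp_all add: a_def exp_add[symmetric] exp_minus inverse_eq_divide)
  have c: "c \<noteq> 0" "exp z = c * c" "exp (- z) = 1 / (c * c)"
    by (simp_all add: c_def exp_add[symmetric] exp_minus inverse_eq_divide)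
  have ac: "exp ((w - z) / 2) = a / c" "exp (- (w - z) / 2) = c / a"
    by (simp_all add: a_def c_def exp_diff[symmetric] diff_divide_distrib)
  have ne: "1 - c * c * (a * a) \<noteq> 0" using assms a c by auto
  have "(a * a + 1 / (a * a) - 2 - (c * c + 1 / (c * c) - 2)) * (a * a - c * c) * (a * a * (c * c))
     = - ((a * a - c * c)\<^sup>2) * (1 - c * c * (a * a))"
    using a c by (simp add: field_simps power2_eq_square)
  then have "(a * a + 1 / (a * a) - 2 - (c * c + 1 / (c * c) - 2)) * ((a * a - c * c) / (1 - c * c * (a * a)))
     = - ((a * a - c * c)\<^sup>2) / (a * a * (c * c))"
    using ne a c by (simp add: divide_simps)
  also have "\<dots> = - (a / c - c / a)\<^sup>2"
    using a c by (simp add: field_simps power2_eq_square)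
  finally show ?thesis unfolding cosh_var_def ac a(2,3) c(2,3) .
qed

text \<open>The left side has a kernel with poles at real part 0 and is used inside only; the right
  side is regular everywhere and provides the continuation to the torus.\<close>

lemma walk_integrand_eq_torus_kernel:
  assumes z: "\<And>i. i < k \<Longrightarrow> Re (z i) < 0" and e: "e \<le> 1"
    and b: "\<And>j. j < k \<Longrightarrow> b j = real (n j) - real e / 2"
  shows "walk_integrand k e' b z = torus_kernel k e e' n z"
proof -
  define s where "s l = cosh_var (z l)" for l
  have "alternant k b z = (\<Sum>p | p permutes {..<k}. (\<Prod>i<k. - alternant_factor e (z i))
      * (of_int (sign p) * (\<Prod>i<k. poly (sinh_poly e (n (p i))) (s i))))"
    unfolding alternant_def
  proof (intro sum.cong refl)
    fix p assume "p \<in> {p. p permutes {..<k}}"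
    then have p: "p permutes {..<k}" by simp
    have "(\<Prod>i<k. sinh_diff (b (p i)) (z i)) = (\<Prod>i<k. - alternant_factor e (z i) * poly (sinh_poly e (n (p i))) (s i))"
    proof (intro prod.cong refl)
      fix i assume "i \<in> {..<k}"
      then have "p i < k" using permutes_in_image[OF p, of i] by auto
      then show "sinh_diff (b (p i)) (z i) = - alternant_factor e (z i) * poly (sinh_poly e (n (p i))) (s i)"
        using sinh_diff_sinh_poly[OF e] b by (simp add: s_def)
    qed
    then show "of_int (sign p) * (\<Prod>i<k. sinh_diff (b (p i)) (z i)) = (\<Prod>i<k. - alternant_factor e (z i))
      * (of_int (sign p) * (\<Prod>i<k. poly (sinh_poly e (n (p i))) (s i)))"
      by (simp only: prod.distrib mult_ac)
  qed
  also have "\<dots> = (\<Prod>i<k. - alternant_factor e (z i)) * (vandermonde k s * alternant_quotient k e n s)"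
    unfolding sum_distrib_left[symmetric] leibniz_det[where f = "\<lambda>i j. poly (sinh_poly e (n j)) (s i)"] det_poly_eval alternant_quotient_def ..
  finally have alt: "alternant k b z = (\<Prod>i<k. - alternant_factor e (z i)) * (vandermonde k s * alternant_quotient k e n s)" .
  have ne1: "exp (z i) \<noteq> 1" if "i < k" for i
  proof -
    have "norm (exp (z i)) < 1" using z[OF that] by simp
    then show ?thesis by (metis norm_one less_irrefl)
  qed
  have ne2: "exp (z i) * exp (z j) \<noteq> 1" if "i < k" "j < k" for i j
  proof -
    have "norm (exp (z i + z j)) < 1" using z[OF that(1)] z[OF that(2)] by simp
    then show ?thesis by (metis exp_add norm_one less_irrefl)
  qed
  have set: "{j \<in> {..<k}. j < m} = {..<m}" if "m \<in> {..<k}" for m using that by auto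
  have "littlewood {..<k} (\<lambda>j. exp (z j)) = (\<Prod>j<k. exp (z j) / (1 - exp (z j)))
     * (\<Prod>m<k. \<Prod>j<m. (exp (z m) - exp (z j)) / (1 - exp (z j) * exp (z m)))"
    unfolding littlewood_def by (intro arg_cong2[where f = "(*)"] prod.cong refl) (use set in auto)
  then have "walk_integrand k e' b z
     = ((\<Prod>i<k. - alternant_factor e (z i)) * (\<Prod>j<k. exp (z j) / (1 - exp (z j))) * (\<Prod>j<k. exp (- (of_nat e' / 2) * z j)))
      * (vandermonde k s * (\<Prod>m<k. \<Prod>j<m. (exp (z m) - exp (z j)) / (1 - exp (z j) * exp (z m))))
      * alternant_quotient k e n s"
    unfolding walk_integrand_def alt by (simp only: mult_ac)
  also have "(\<Prod>i<k. - alternant_factor e (z i)) * (\<Prod>j<k. exp (z j) / (1 - exp (z j))) * (\<Prod>j<k. exp (- (of_nat e' / 2) * z j))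
     = (\<Prod>i<k. kernel_factor e (z i) * exp (- (of_nat e' / 2) * z i))"
    unfolding prod.distrib[symmetric] using ne1 by (intro prod.cong refl arg_cong2[where f = "(*)"] alternant_factor_kernel_factor) auto
  also have "vandermonde k s * (\<Prod>m<k. \<Prod>j<m. (exp (z m) - exp (z j)) / (1 - exp (z j) * exp (z m)))
     = (\<Prod>m<k. \<Prod>j<m. - (exp ((z m - z j) / 2) - exp (- (z m - z j) / 2))\<^sup>2)"
    unfolding vandermonde_def prod.distrib[symmetric] s_def using ne2 by (intro prod.cong refl cosh_var_pair) auto
  finally show ?thesis by (simp add: torus_kernel_def s_def)
qed

section \<open>An integral formula for walks in the chamber\<close>

definition bdd_fun :: "('a \<Rightarrow> complex) \<Rightarrow> bool" where
  "bdd_fun f \<longleftrightarrow> (\<exists>B. \<forall>x. norm (f x) \<le> B)"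

lemma bdd_fun_const [intro]: "bdd_fun (\<lambda>x. c)"
  by (auto simp: bdd_fun_def)

lemma bdd_fun_add [intro]: "bdd_fun f \<Longrightarrow> bdd_fun g \<Longrightarrow> bdd_fun (\<lambda>x. f x + g x)"
  unfolding bdd_fun_def by (meson add_mono norm_triangle_le)

lemma bdd_fun_minus [intro]: "bdd_fun f \<Longrightarrow> bdd_fun (\<lambda>x. - f x)"
  by (simp add: bdd_fun_def)

lemma bdd_fun_diff [intro]: "bdd_fun f \<Longrightarrow> bdd_fun g \<Longrightarrow> bdd_fun (\<lambda>x. f x - g x)"
  using bdd_fun_add[of f "\<lambda>x. - g x"] bdd_fun_minus[of g] by simp

lemma bdd_fun_mult [intro]:
  assumes "bdd_fun f" "bdd_fun g"
  shows "bdd_fun (\<lambda>x. f x * g x)"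
proof -
  obtain B C where "\<And>x. norm (f x) \<le> B" "\<And>x. norm (g x) \<le> C"
    using assms by (auto simp: bdd_fun_def)
  then have "norm (f x * g x) \<le> B * C" for x
    unfolding norm_mult by (meson mult_mono norm_ge_zero order_trans)
  then show ?thesis by (auto simp: bdd_fun_def)
qed

lemma bdd_fun_sum [intro]: "(\<And>i. i \<in> X \<Longrightarrow> bdd_fun (f i)) \<Longrightarrow> bdd_fun (\<lambda>x. \<Sum>i\<in>X. f i x)"
  by (induction X rule: infinite_finite_induct) auto

lemma bdd_fun_prod [intro]: "(\<And>i. i \<in> X \<Longrightarrow> bdd_fun (f i)) \<Longrightarrow> bdd_fun (\<lambda>x. \<Prod>i\<in>X. f i x)"
  by (induction X rule: infinite_finite_induct) auto

lemma bdd_fun_power [intro]: "bdd_fun f \<Longrightarrow> bdd_fun (\<lambda>x. f x ^ n)"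
  by (induction n) auto

lemma bdd_fun_exp: "(\<And>x. Re (g x) \<le> B) \<Longrightarrow> bdd_fun (\<lambda>x. exp (g x))"
  by (auto simp: bdd_fun_def intro!: exI[of _ "exp B"])

lemma bdd_fun_mpoly:
  "mpoly_fun k f \<Longrightarrow> (\<And>i. i < k \<Longrightarrow> bdd_fun (\<lambda>x. g x i)) \<Longrightarrow> bdd_fun (\<lambda>x. f (g x))"
  by (induction rule: mpoly_fun.induct) auto

lemma mpoly_fun_alternant_quotient: "mpoly_fun k (alternant_quotient k e n)"
  unfolding alternant_quotient_def[abs_def] by (intro mpoly_fun_det mpoly_fun_divided_diff)

text \<open>Steps are measured in units of \<open>d\<close>; the index shift passes from coordinates
  numbered from 1 to variables numbered from 0.\<close>

definition walk_symbol :: "nat \<Rightarrow> rvec set \<Rightarrow> real \<Rightarrow> (nat \<Rightarrow> complex) \<Rightarrow> complex" where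
  "walk_symbol k A d z = (\<Sum>a\<in>A. exp (\<Sum>i<k. of_real (a (Suc i) / d) * z i))"

context
  fixes z :: "'a \<Rightarrow> nat \<Rightarrow> complex" and k :: nat and R :: real
  assumes z: "\<And>x i. i < k \<Longrightarrow> \<bar>Re (z x i)\<bar> \<le> R"
begin

lemma bdd_fun_exp_mult: "i < k \<Longrightarrow> bdd_fun (\<lambda>x. exp (of_real c * z x i))"
proof (rule bdd_fun_exp)
  fix x assume "i < k"
  have "Re (of_real c * z x i) \<le> \<bar>c\<bar> * \<bar>Re (z x i)\<bar>" by (simp flip: abs_mult)
  also have "\<dots> \<le> \<bar>c\<bar> * R" using z[OF \<open>i < k\<close>] by (intro mult_left_mono) auto
  finally show "Re (of_real c * z x i) \<le> \<bar>c\<bar> * R" .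
qed

lemma bdd_fun_walk_symbol: "bdd_fun (\<lambda>x. walk_symbol k A d (z x))"
  unfolding walk_symbol_def exp_sum[OF finite_lessThan]
  by (intro bdd_fun_sum bdd_fun_prod bdd_fun_exp_mult) auto

lemma bdd_fun_torus_kernel: "bdd_fun (\<lambda>x. torus_kernel k e e' n (z x))"
proof -
  have 1: "bdd_fun (\<lambda>x. exp (z x i))" "bdd_fun (\<lambda>x. exp (z x i / 2))" "bdd_fun (\<lambda>x. exp (- z x i))"
    "bdd_fun (\<lambda>x. exp (- z x i / 2))" "bdd_fun (\<lambda>x. exp (- (of_nat e' / 2) * z x i))" if "i < k" for i
    using bdd_fun_exp_mult[OF that, of 1] bdd_fun_exp_mult[OF that, of "1/2"] bdd_fun_exp_mult[OF that, of "-1"]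
      bdd_fun_exp_mult[OF that, of "-1/2"] bdd_fun_exp_mult[OF that, of "- (of_nat e' / 2)"] by simp_all
  have "exp ((z x m - z x j) / 2) = exp (z x m / 2) * exp (- z x j / 2)"
    "exp (- (z x m - z x j) / 2) = exp (- z x m / 2) * exp (z x j / 2)" for x m j
    by (simp_all add: exp_add[symmetric] diff_divide_distrib)
  then have 2: "bdd_fun (\<lambda>x. exp ((z x m - z x j) / 2))" "bdd_fun (\<lambda>x. exp (- (z x m - z x j) / 2))" if "m < k" "j < k" for m j
    using 1 that by auto
  have 3: "bdd_fun (\<lambda>x. kernel_factor e (z x i))" if "i < k" for i
    unfolding kernel_factor_def using 1 that by (cases "e = 0") auto
  have 4: "bdd_fun (\<lambda>x. alternant_quotient k e n (\<lambda>l. cosh_var (z x l)))"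
    unfolding cosh_var_def by (rule bdd_fun_mpoly[OF mpoly_fun_alternant_quotient]) (intro bdd_fun_diff bdd_fun_add bdd_fun_const 1)
  show ?thesis unfolding torus_kernel_def
    by (intro bdd_fun_mult bdd_fun_prod bdd_fun_minus bdd_fun_power bdd_fun_diff 4) (use 1 2 3 in auto)
qed

end

lemma torus_kernel_measurable:
  assumes "\<And>i. i < k \<Longrightarrow> (\<lambda>w. z w i) \<in> borel_measurable M"
  shows "(\<lambda>w. torus_kernel k e e' n (z w)) \<in> borel_measurable M"
proof -
  have [measurable]: "(\<lambda>w. exp (f w)) \<in> borel_measurable M" if "f \<in> borel_measurable M" for f :: "_ \<Rightarrow> complex"
    using that by measurable
  have 1: "(\<lambda>w. alternant_quotient k e n (\<lambda>l. cosh_var (z w l))) \<in> borel_measurable M"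
    by (rule mpoly_fun_measurable[OF mpoly_fun_alternant_quotient]) (use assms in \<open>auto simp: cosh_var_def\<close>)
  have 2: "(\<lambda>w. kernel_factor e (z w i)) \<in> borel_measurable M" if "i < k" for i
    unfolding kernel_factor_def using assms[OF that] by (cases "e = 0") auto
  show ?thesis
    unfolding torus_kernel_def
    by (intro borel_measurable_times borel_measurable_prod borel_measurable_uminus borel_measurable_power borel_measurable_diff 1 2)
       (use assms in auto)
qed

lemma walk_symbol_measurable:
  assumes "\<And>i. i < k \<Longrightarrow> (\<lambda>w. z w i) \<in> borel_measurable M"
  shows "(\<lambda>w. walk_symbol k A d (z w)) \<in> borel_measurable M"
  unfolding walk_symbol_def using assms
  by (intro borel_measurable_sum borel_measurable_exp borel_measurable_times) auto

lemma torus_kernel_tendsto: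
  assumes "\<And>i. i < k \<Longrightarrow> ((\<lambda>N. z N i) \<longlongrightarrow> z' i) F"
  shows "((\<lambda>N. torus_kernel k e e' n (z N)) \<longlongrightarrow> torus_kernel k e e' n z') F"
proof -
  have 1: "((\<lambda>N. alternant_quotient k e n (\<lambda>l. cosh_var (z N l))) \<longlongrightarrow> alternant_quotient k e n (\<lambda>l. cosh_var (z' l))) F"
    by (rule mpoly_fun_tendsto[OF mpoly_fun_alternant_quotient]) (use assms in \<open>auto simp: cosh_var_def intro!: tendsto_intros\<close>)
  have 2: "((\<lambda>N. kernel_factor e (z N i)) \<longlongrightarrow> kernel_factor e (z' i)) F" if "i < k" for i
    unfolding kernel_factor_def using assms[OF that] by (cases "e = 0") (auto intro!: tendsto_intros)
  show ?thesis
    unfolding torus_kernel_def by (intro tendsto_intros tendsto_prod 1 2 assms) auto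
qed

lemma walk_symbol_tendsto:
  assumes "\<And>i. i < k \<Longrightarrow> ((\<lambda>N. z N i) \<longlongrightarrow> z' i) F"
  shows "((\<lambda>N. walk_symbol k A d (z N)) \<longlongrightarrow> walk_symbol k A d z') F"
  unfolding walk_symbol_def using assms by (intro tendsto_intros tendsto_sum) auto

lemma bdd_fun_walk_integrand: "\<forall>j<k. r j < 0 \<Longrightarrow> bdd_fun (\<lambda>y. walk_integrand k e b (polar r y))"
proof -
  assume r: "\<forall>j<k. r j < 0"
  have Re: "\<bar>Re (polar r y i)\<bar> \<le> (\<Sum>j<k. \<bar>r j\<bar>)" if "i < k" for i y
    using that by (auto intro!: member_le_sum)
  have exps: "bdd_fun (\<lambda>x. exp (of_real c * polar r x i))" if "i < k" for c i
    by (rule bdd_fun_exp_mult[OF Re that])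
  have "bdd_fun (\<lambda>y. sinh_diff c (polar r y i))" if "i < k" for i c
    using exps[OF that, of c] exps[OF that, of "-c"] unfolding sinh_diff_def by (intro bdd_fun_diff) simp_all
  moreover have "bdd_fun (\<lambda>y. exp (- (of_nat e / 2) * polar r y i))" if "i < k" for i
    using exps[OF that, of "- (of_nat e / 2)"] by simp
  moreover have "bdd_fun (\<lambda>y. littlewood {..<k} (\<lambda>j. exp (polar r y j)))"
    unfolding bdd_fun_def using littlewood_bounded[of "{..<k}" r] r by blast
  ultimately show ?thesis
    unfolding walk_integrand_def alternant_def by (intro bdd_fun_mult bdd_fun_sum bdd_fun_prod bdd_fun_const) auto
qed

lemma integrable_bdd_fun: "f \<in> borel_measurable (torus I) \<Longrightarrow> bdd_fun f \<Longrightarrow> integrable (torus I) f"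
  unfolding bdd_fun_def using integrable_torus_bounded by blast

lemma walk_count_outside: "u \<notin> chamber k \<Longrightarrow> walk_count k A m u = 0"
  by (cases m) (auto simp: walk_count_def step_op_def)

definition chamber_coords :: "nat \<Rightarrow> (nat \<Rightarrow> real) \<Rightarrow> bool" where
  "chamber_coords k b \<longleftrightarrow> 0 < b 0 \<and> (\<forall>i. Suc i < k \<longrightarrow> b i < b (Suc i))"

text \<open>In units of \<open>d\<close> the coordinates of a walker lie in \<open>\<int>\<close> or in \<open>\<int> + 1/2\<close>, and \<open>adm m b e\<close> says that \<open>m\<close>
  steps from \<open>b\<close> lead to \<open>(\<int> + e/2)\<^sup>k\<close>, where \<open>e \<in> {0, 1}\<close>.\<close>

locale weyl_walk =
  fixes k :: nat and A :: "rvec set" and d :: real and adm :: "nat \<Rightarrow> (nat \<Rightarrow> real) \<Rightarrow> nat \<Rightarrow> bool"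
  assumes k: "k \<ge> 1" and finA: "finite A" and d: "d > 0" and A_vec: "A \<subseteq> vec_space k"
    and symbol_altern: "walk_symbol k A d z * alternant k b z = (\<Sum>a\<in>A. alternant k (\<lambda>i. b i + a (Suc i) / d) z)"
    and adm_step: "adm (Suc m) b e \<Longrightarrow> a \<in> A \<Longrightarrow> adm m (\<lambda>i. b i + a (Suc i) / d) e"
    and adm_0: "adm 0 b e \<Longrightarrow> e \<le> 1 \<and> (\<exists>\<beta>. \<forall>j<k. b j = of_int (\<beta> j) - of_nat e / 2)"
    and adm_wall: "adm m b e \<Longrightarrow> chamber_coords k b \<Longrightarrow> a \<in> A \<Longrightarrow>
      chamber_coords k (\<lambda>i. b i + a (Suc i) / d) \<or> (\<exists>i<k. b i + a (Suc i) / d = 0)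
      \<or> (\<exists>i j. i < k \<and> j < k \<and> i \<noteq> j \<and> b i + a (Suc i) / d = b j + a (Suc j) / d)"
begin

definition coords :: "rvec \<Rightarrow> nat \<Rightarrow> real" where
  "coords u i = u (Suc i) / d"

lemma chamber_iff: "u \<in> chamber k \<longleftrightarrow> u \<in> vec_space k \<and> chamber_coords k (coords u)"
proof -
  have "(\<forall>j\<in>{1..<k}. u j < u (Suc j)) \<longleftrightarrow> (\<forall>i. Suc i < k \<longrightarrow> u (Suc i) < u (Suc (Suc i)))"
    by (auto simp: Ball_def) (metis Suc_le_D Suc_le_eq One_nat_def)
  then show ?thesis
    using d by (auto simp: chamber_def chamber_coords_def coords_def divide_less_cancel zero_less_divide_iff)
qed

lemma coords_add: "coords (\<lambda>l. u l + a l) = (\<lambda>i. coords u i + a (Suc i) / d)"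
  by (auto simp: coords_def add_divide_distrib)

lemma vec_space_add: "u \<in> vec_space k \<Longrightarrow> a \<in> A \<Longrightarrow> (\<lambda>l. u l + a l) \<in> vec_space k"
  using A_vec by (auto simp: vec_space_def subset_iff)

lemma chamber_coords_mono:
  assumes "chamber_coords k b" "i < j" "j < k"
  shows "b i < b j"
  using assms(2,3)
proof (induction j)
  case (Suc j)
  then show ?case using assms(1) by (cases "i = j") (auto simp: chamber_coords_def intro: less_trans)
qed simp

text \<open>Multiplication by the symbol replaces the starting point by its neighbours. Those
  outside the chamber lie on a wall by \<open>adm_wall\<close>, where the alternant vanishes just as
  the number of walks does; \<open>integral_walk_integrand\<close> settles m = 0. The parity
  \<open>e\<close> at the end stays fixed during the induction.\<close>

lemma walk_count_integral_inside:
  assumes r: "\<forall>j<k. r j < 0" and inj: "inj_on r {..<k}"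
  shows "adm m (coords u) e \<Longrightarrow> u \<in> chamber k \<Longrightarrow>
    (\<integral>y. walk_symbol k A d (polar r y) ^ m * walk_integrand k e (coords u) (polar r y) \<partial>torus {..<k})
      = of_real (walk_count k A m u) * fact k"
proof (induction m arbitrary: u)
  case 0
  obtain \<beta> where e: "e \<le> 1" and \<beta>: "\<And>j. j < k \<Longrightarrow> coords u j = of_int (\<beta> j) - of_nat e / 2"
    using adm_0[OF 0(1)] by auto
  have ch: "chamber_coords k (coords u)" using 0 chamber_iff by simp
  have mono: "\<beta> i < \<beta> j" if "i < j" "j < k" for i j
    using chamber_coords_mono[OF ch that] \<beta>[of i] \<beta>[of j] that by simp
  have "1 \<le> \<beta> 0" using ch \<beta>[of 0] k by (auto simp: chamber_coords_def)
  then have "1 \<le> \<beta> j" if "j < k" for j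
    using mono[of 0 j] that by (cases "j = 0") auto
  then have "(\<integral>y. walk_integrand k e (coords u) (polar r y) \<partial>torus {..<k}) = fact k"
    using r by (intro integral_walk_integrand[OF _ inj e \<beta>]) (auto intro: mono)
  then show ?case using 0(2) by (simp add: walk_count_def)
next
  case (Suc m)
  let ?b = "coords u" and ?S = "\<lambda>y. walk_symbol k A d (polar r y)"
  let ?b' = "\<lambda>a i. ?b i + a (Suc i) / d"
  have Re: "\<bar>Re (polar r y i)\<bar> \<le> (\<Sum>j<k. \<bar>r j\<bar>)" if "i < k" for i y
    using that by (auto intro!: member_le_sum)
  have "bdd_fun ?S" by (rule bdd_fun_walk_symbol[OF Re])
  then have int: "integrable (torus {..<k}) (\<lambda>y. ?S y ^ m * walk_integrand k e b (polar r y))" for b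
    by (intro integrable_bdd_fun bdd_fun_mult bdd_fun_power bdd_fun_walk_integrand r
      borel_measurable_times borel_measurable_power walk_integrand_measurable walk_symbol_measurable) (auto intro!: measurable_Complex)
  have "?S y ^ Suc m * walk_integrand k e ?b (polar r y) = (\<Sum>a\<in>A. ?S y ^ m * walk_integrand k e (?b' a) (polar r y))" for y
  proof -
    have "?S y ^ Suc m * walk_integrand k e ?b (polar r y)
      = ?S y ^ m * ((?S y * alternant k ?b (polar r y)) * littlewood {..<k} (\<lambda>j. exp (polar r y j)) * (\<Prod>j<k. exp (- (of_nat e / 2) * polar r y j)))"
      by (simp add: walk_integrand_def mult_ac)
    then show ?thesis
      unfolding symbol_altern walk_integrand_def by (simp only: sum_distrib_left sum_distrib_right)
  qed
  then have "(\<integral>y. ?S y ^ Suc m * walk_integrand k e ?b (polar r y) \<partial>torus {..<k})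
     = (\<Sum>a\<in>A. \<integral>y. ?S y ^ m * walk_integrand k e (?b' a) (polar r y) \<partial>torus {..<k})"
    using int by (simp add: Bochner_Integration.integral_sum)
  also have "\<dots> = (\<Sum>a\<in>A. of_real (walk_count k A m (\<lambda>l. u l + a l)) * fact k)"
  proof (intro sum.cong refl)
    fix a assume a: "a \<in> A"
    let ?u = "\<lambda>l. u l + a l"
    show "(\<integral>y. ?S y ^ m * walk_integrand k e (?b' a) (polar r y) \<partial>torus {..<k}) = of_real (walk_count k A m ?u) * fact k"
    proof (cases "?u \<in> chamber k")
      case True
      then show ?thesis using Suc.IH[of ?u] adm_step[OF Suc.prems(1) a] by (simp add: coords_add)
    next
      case False
      have "u \<in> vec_space k" "chamber_coords k ?b" using Suc.prems chamber_iff by auto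
      then have "\<not> chamber_coords k (?b' a)"
        using False chamber_iff[of ?u] vec_space_add[OF _ a] by (auto simp: coords_add)
      with adm_wall[OF Suc.prems(1) \<open>chamber_coords k ?b\<close> a]
      have "alternant k (?b' a) z = 0" for z
        using alternant_wall_0[of _ k "?b' a" z] alternant_wall_eq[of _ k _ "?b' a" z] by blast
      then show ?thesis using False by (simp add: walk_integrand_def walk_count_outside)
    qed
  qed
  also have "\<dots> = of_real (walk_count k A (Suc m) u) * fact k"
    using Suc.prems(2) by (simp add: walk_count_def step_op_def sum_distrib_right)
  finally show ?case .
qed

theorem walk_count_integral:
  assumes adm: "adm m (coords u) e'" and u: "u \<in> chamber k"
    and e: "e \<le> 1" and n: "\<And>j. j < k \<Longrightarrow> coords u j = real (n j) - real e / 2"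
  shows "(\<integral>y. walk_symbol k A d (polar (\<lambda>_. 0) y) ^ m * torus_kernel k e e' n (polar (\<lambda>_. 0) y) \<partial>torus {..<k})
      = of_real (walk_count k A m u) * fact k"
proof -
  \<comment> \<open>Negative, pairwise distinct, at least -k and tending to 0. The integral does not
    depend on N, and dominated convergence carries its value over to the torus.\<close>
  define r where "r N j = - ((real j + 1) / (real N + 1))" for N j :: nat
  define f where "f z = walk_symbol k A d z ^ m * torus_kernel k e e' n z" for z
  have neg: "\<forall>j<k. r N j < 0" for N by (auto simp: r_def)
  have inj: "inj_on (r N) {..<k}" for N by (auto simp: r_def inj_on_def)
  have lim: "(\<lambda>N. r N j) \<longlonglongrightarrow> 0" for j
    unfolding r_def by real_asymp
  have "\<bar>Re (case x of (N, y) \<Rightarrow> polar (r N) y i)\<bar> \<le> real k" if "i < k" for i and x :: "nat \<times> (nat \<Rightarrow> real)"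
  proof -
    obtain N y where x: "x = (N, y)" by (cases x)
    have "(real i + 1) / (real N + 1) \<le> real k / 1" using that by (intro frac_le) auto
    then show ?thesis by (simp add: x r_def)
  qed
  then have Re: "\<bar>Re ((\<lambda>i. case x of (N, y) \<Rightarrow> polar (r N) y i) i)\<bar> \<le> real k" if "i < k" for i and x :: "nat \<times> (nat \<Rightarrow> real)"
    using that by blast
  have "bdd_fun (\<lambda>x. f (\<lambda>i. case x of (N, y) \<Rightarrow> polar (r N) y i))"
    unfolding f_def using Re by (intro bdd_fun_mult bdd_fun_power bdd_fun_walk_symbol bdd_fun_torus_kernel)
  then obtain B where B: "norm (f (polar (r N) y)) \<le> B" for N y
    unfolding bdd_fun_def by (auto simp: split_paired_all)
  have meas: "(\<lambda>y. f (polar s y)) \<in> borel_measurable (torus {..<k})" for s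
    unfolding f_def by (intro borel_measurable_times borel_measurable_power walk_symbol_measurable torus_kernel_measurable)
      (auto intro!: measurable_Complex)
  interpret prob_space "torus {..<k}" by (rule prob_space_torus)
  have "(\<lambda>N. \<integral>y. f (polar (r N) y) \<partial>torus {..<k}) \<longlonglongrightarrow> (\<integral>y. f (polar (\<lambda>_. 0) y) \<partial>torus {..<k})"
  proof (rule integral_dominated_convergence[where w = "\<lambda>_. B"])
    show "AE y in torus {..<k}. (\<lambda>N. f (polar (r N) y)) \<longlonglongrightarrow> f (polar (\<lambda>_. 0) y)"
      unfolding f_def Complex_eq
      by (intro AE_I2 tendsto_intros walk_symbol_tendsto torus_kernel_tendsto lim)
  qed (use meas B in auto)
  moreover have "(\<integral>y. f (polar (r N) y) \<partial>torus {..<k}) = of_real (walk_count k A m u) * fact k" for N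
  proof -
    have "f (polar (r N) y) = walk_symbol k A d (polar (r N) y) ^ m * walk_integrand k e' (coords u) (polar (r N) y)" for y
      unfolding f_def using neg by (subst walk_integrand_eq_torus_kernel[OF _ e n]) auto
    then show ?thesis using walk_count_integral_inside[OF neg inj adm u] by simp
  qed
  ultimately show ?thesis
    unfolding f_def by (simp add: LIMSEQ_const_iff)
qed

end

section \<open>Vandermonde-weighted Gaussian integrals\<close>

abbreviation euclid :: "nat \<Rightarrow> (nat \<Rightarrow> real) measure" where
  "euclid k \<equiv> PiM {..<k} (\<lambda>_. lborel)"

interpretation lbs: product_sigma_finite "\<lambda>_. lborel :: real measure"
  by (rule product_sigma_finite.intro) (rule sigma_finite_lborel)

text \<open>Checked on boxes, where it is the one-dimensional affine rule in each coordinate. The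
  restriction to \<open>{..<k}\<close> keeps points in the extensional space of the product
  measure.\<close>

lemma euclid_affine:
  assumes b: "b > 0"
  shows "euclid k = density (distr (euclid k) (euclid k) (\<lambda>x. \<lambda>i\<in>{..<k}. a i + b * x i)) (\<lambda>_. ennreal (b ^ k))"
    (is "_ = ?P")
proof (rule lbs.PiM_eqI[symmetric])
  let ?T = "\<lambda>x. \<lambda>i\<in>{..<k}. a i + b * x i"
  have T: "?T \<in> measurable (euclid k) (euclid k)"
    by (rule measurable_restrict) measurable
  fix X :: "nat \<Rightarrow> real set" assume "\<And>i. i \<in> {..<k} \<Longrightarrow> X i \<in> sets lborel"
  then have X: "\<And>i. i < k \<Longrightarrow> X i \<in> sets borel" by simp
  have PX: "Pi\<^sub>E {..<k} X \<in> sets (euclid k)" using X by (intro sets_PiM_I_finite) auto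
  have pre: "(\<lambda>x. a i + b * x) -` X i \<in> sets borel" if "i < k" for i
    using measurable_sets[of "\<lambda>x. a i + b * x" borel borel "X i"] X[OF that] by simp
  have one: "emeasure lborel (X i) = ennreal b * emeasure lborel ((\<lambda>x. a i + b * x) -` X i)" if "i < k" for i
  proof -
    have "emeasure lborel (X i) = emeasure (density (distr lborel borel (\<lambda>x. a i + b * x)) (\<lambda>_. ennreal \<bar>b\<bar>)) (X i)"
      using lborel_real_affine[of b "a i"] b by simp
    also have "\<dots> = ennreal b * emeasure (distr lborel borel (\<lambda>x. a i + b * x)) (X i)"
      using b X[OF that] by (simp add: emeasure_density_const)
    also have "\<dots> = ennreal b * emeasure lborel ((\<lambda>x. a i + b * x) -` X i)"
      using X[OF that] by (simp add: emeasure_distr)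
    finally show ?thesis .
  qed
  have "emeasure ?P (Pi\<^sub>E {..<k} X) = ennreal (b ^ k) * emeasure (distr (euclid k) (euclid k) ?T) (Pi\<^sub>E {..<k} X)"
    using PX by (simp add: emeasure_density_const)
  also have "emeasure (distr (euclid k) (euclid k) ?T) (Pi\<^sub>E {..<k} X)
      = emeasure (euclid k) (?T -` Pi\<^sub>E {..<k} X \<inter> space (euclid k))"
    by (rule emeasure_distr[OF T PX])
  also have "?T -` Pi\<^sub>E {..<k} X \<inter> space (euclid k) = Pi\<^sub>E {..<k} (\<lambda>i. (\<lambda>x. a i + b * x) -` X i)"
    by (auto simp: space_PiM PiE_iff)
  also have "emeasure (euclid k) \<dots> = (\<Prod>i<k. emeasure lborel ((\<lambda>x. a i + b * x) -` X i))"
    using pre by (intro lbs.emeasure_PiM) auto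
  also have "ennreal (b ^ k) * \<dots> = (\<Prod>i<k. ennreal b * emeasure lborel ((\<lambda>x. a i + b * x) -` X i))"
    using b by (simp add: prod.distrib ennreal_power)
  also have "\<dots> = (\<Prod>i<k. emeasure lborel (X i))"
    using one by simp
  finally show "emeasure ?P (Pi\<^sub>E {..<k} X) = (\<Prod>i<k. emeasure lborel (X i))" .
qed simp_all

lemma integral_euclid_affine:
  fixes f :: "(nat \<Rightarrow> real) \<Rightarrow> real"
  assumes b: "b > 0" and f: "f \<in> borel_measurable (euclid k)"
  shows "(\<integral>x. f x \<partial>euclid k) = b ^ k * (\<integral>x. f (\<lambda>i\<in>{..<k}. a i + b * x i) \<partial>euclid k)"
    and "integrable (euclid k) f \<Longrightarrow> integrable (euclid k) (\<lambda>x. f (\<lambda>i\<in>{..<k}. a i + b * x i))"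
proof -
  let ?T = "\<lambda>x. \<lambda>i\<in>{..<k}. a i + b * x i"
  have T: "?T \<in> measurable (euclid k) (euclid k)"
    by (rule measurable_restrict) measurable
  have "(\<integral>x. f x \<partial>euclid k) = (\<integral>x. f x \<partial>density (distr (euclid k) (euclid k) ?T) (\<lambda>_. ennreal (b ^ k)))"
    by (subst euclid_affine[OF b, of k a]) (rule refl)
  also have "\<dots> = (\<integral>x. b ^ k *\<^sub>R f x \<partial>distr (euclid k) (euclid k) ?T)"
    using b f by (intro integral_density) auto
  also have "\<dots> = b ^ k * (\<integral>x. f (?T x) \<partial>euclid k)"
    using f T by (simp add: integral_distr)
  finally show "(\<integral>x. f x \<partial>euclid k) = b ^ k * (\<integral>x. f (?T x) \<partial>euclid k)" .
  assume "integrable (euclid k) f"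
  then have "integrable (density (distr (euclid k) (euclid k) ?T) (\<lambda>_. ennreal (b ^ k))) f"
    by (subst (asm) euclid_affine[OF b, of k a])
  then have "integrable (distr (euclid k) (euclid k) ?T) (\<lambda>x. b ^ k *\<^sub>R f x)"
    using b f by (subst (asm) integrable_density) auto
  then show "integrable (euclid k) (\<lambda>x. f (?T x))"
    using b f T by (simp add: integrable_distr_eq)
qed

lemma torus_density:
  "torus {..<k} = density (euclid k) (\<lambda>x. ennreal (\<Prod>i<k. indicator {- (pi / 2)..3 * pi / 2} (x i) / (2 * pi)))"
    (is "_ = ?P")
proof (rule tors.PiM_eqI[symmetric])
  have "sets ?P = sets (euclid k)" by simp
  also have "\<dots> = sets (torus {..<k})" by (rule sets_PiM_cong) auto
  finally show "sets ?P = sets (torus {..<k})" .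
next
  let ?g = "\<lambda>x :: real. indicator {- (pi / 2)..3 * pi / 2} x / (2 * pi) :: real"
  have [measurable]: "(\<lambda>x. ennreal (\<Prod>i<k. ?g (x i))) \<in> borel_measurable (euclid k)"
    by measurable
  fix X :: "nat \<Rightarrow> real set" assume "\<And>i. i \<in> {..<k} \<Longrightarrow> X i \<in> sets circle"
  then have X: "\<And>i. i < k \<Longrightarrow> X i \<in> sets borel" by simp
  have PX: "Pi\<^sub>E {..<k} X \<in> sets (euclid k)" using X by (intro sets_PiM_I_finite) auto
  have "emeasure ?P (Pi\<^sub>E {..<k} X) = (\<integral>\<^sup>+x. ennreal (\<Prod>i<k. ?g (x i)) * indicator (Pi\<^sub>E {..<k} X) x \<partial>euclid k)"
    using PX by (intro emeasure_density) auto
  also have "\<dots> = (\<integral>\<^sup>+x. (\<Prod>i<k. ennreal (?g (x i)) * indicator (X i) (x i)) \<partial>euclid k)"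
  proof (intro nn_integral_cong)
    fix x assume x: "x \<in> space (euclid k)"
    have "indicator (Pi\<^sub>E {..<k} X) x = (\<Prod>i<k. indicator (X i) (x i) :: ennreal)"
      using x by (auto simp: space_PiM PiE_iff indicator_def intro!: prod.neutral[symmetric])
    then show "ennreal (\<Prod>i<k. ?g (x i)) * indicator (Pi\<^sub>E {..<k} X) x = (\<Prod>i<k. ennreal (?g (x i)) * indicator (X i) (x i))"
      by (simp add: prod.distrib prod_ennreal)
  qed
  also have "\<dots> = (\<Prod>i<k. \<integral>\<^sup>+x. ennreal (?g x) * indicator (X i) x \<partial>lborel)"
    using X by (intro lbs.product_nn_integral_prod) auto
  also have "\<dots> = (\<Prod>i<k. emeasure circle (X i))"
    using X unfolding circle_def by (intro prod.cong refl emeasure_density[symmetric]) auto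
  finally show "emeasure ?P (Pi\<^sub>E {..<k} X) = (\<Prod>i<k. emeasure circle (X i))" .
qed simp

lemma measurable_torus_eq: "measurable (torus {..<k}) N = measurable (euclid k) N"
  by (rule measurable_cong_sets[OF sets_PiM_cong refl]) auto

lemma integral_torus:
  fixes f :: "(nat \<Rightarrow> real) \<Rightarrow> real"
  assumes "f \<in> borel_measurable (torus {..<k})"
  shows "(\<integral>y. f y \<partial>torus {..<k})
    = (1 / (2 * pi)) ^ k * (\<integral>x. (\<Prod>i<k. indicator {- (pi / 2)..3 * pi / 2} (x i)) * f x \<partial>euclid k)"
    and "integrable (torus {..<k}) f \<Longrightarrow>
      integrable (euclid k) (\<lambda>x. (\<Prod>i<k. indicator {- (pi / 2)..3 * pi / 2} (x i)) * f x)"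
proof -
  let ?g = "\<lambda>x :: real. indicator {- (pi / 2)..3 * pi / 2} x / (2 * pi) :: real"
  have f: "f \<in> borel_measurable (euclid k)" using assms by (simp add: measurable_torus_eq)
  have [measurable]: "(\<lambda>x. \<Prod>i<k. ?g (x i)) \<in> borel_measurable (euclid k)" by measurable
  have nonneg: "0 \<le> (\<Prod>i<k. ?g (x i))" for x by (intro prod_nonneg) auto
  have eq: "(\<Prod>i<k. ?g (x i)) *\<^sub>R f x = (1 / (2 * pi)) ^ k * ((\<Prod>i<k. indicator {- (pi / 2)..3 * pi / 2} (x i)) * f x)" for x
    by (simp add: prod_dividef power_divide)
  have "(\<integral>y. f y \<partial>torus {..<k}) = (\<integral>x. (\<Prod>i<k. ?g (x i)) *\<^sub>R f x \<partial>euclid k)"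
    unfolding torus_density using f nonneg by (intro integral_density) auto
  then show "(\<integral>y. f y \<partial>torus {..<k})
    = (1 / (2 * pi)) ^ k * (\<integral>x. (\<Prod>i<k. indicator {- (pi / 2)..3 * pi / 2} (x i)) * f x \<partial>euclid k)"
    unfolding eq by simp
  assume "integrable (torus {..<k}) f"
  then have "integrable (euclid k) (\<lambda>x. (\<Prod>i<k. ?g (x i)) *\<^sub>R f x)"
    unfolding torus_density using f nonneg by (subst (asm) integrable_density) auto
  then show "integrable (euclid k) (\<lambda>x. (\<Prod>i<k. indicator {- (pi / 2)..3 * pi / 2} (x i)) * f x)"
    unfolding eq using integrable_mult_right[of "(2 * pi) ^ k" "euclid k" "\<lambda>x. (1 / (2 * pi)) ^ k * ((\<Prod>i<k. indicator {- (pi / 2)..3 * pi / 2} (x i)) * f x)"]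
    by (simp add: power_divide)
qed

section \<open>Gaussian weights with the squared Vandermonde product\<close>

definition norm_sq :: "nat \<Rightarrow> (nat \<Rightarrow> real) \<Rightarrow> real" where
  "norm_sq k x = (\<Sum>i<k. (x i)\<^sup>2)"

lemma norm_sq_nonneg [simp]: "0 \<le> norm_sq k x"
  by (simp add: norm_sq_def sum_nonneg)

lemma measurable_norm_sq [measurable]: "norm_sq k \<in> borel_measurable (euclid k)"
  unfolding norm_sq_def[abs_def] by measurable

lemma measurable_vandermonde [measurable]: "(vandermonde k :: _ \<Rightarrow> real) \<in> borel_measurable (euclid k)"
  unfolding vandermonde_def[abs_def]
  by (intro borel_measurable_prod borel_measurable_diff measurable_component_singleton) auto

text \<open>By \<open>integral_gauss_weight_scale\<close> each power of \<open>norm_sq\<close> costs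
  a factor 1/t, so \<open>p\<close> records the order of an error term.\<close>

definition gauss_weight :: "nat \<Rightarrow> nat \<Rightarrow> real \<Rightarrow> (nat \<Rightarrow> real) \<Rightarrow> real" where
  "gauss_weight k p c x = (vandermonde k x)\<^sup>2 * norm_sq k x ^ p * exp (- (c * norm_sq k x))"

lemma gauss_weight_nonneg [simp]: "0 \<le> gauss_weight k p c x"
  by (simp add: gauss_weight_def)

lemma measurable_gauss_weight [measurable]: "gauss_weight k p c \<in> borel_measurable (euclid k)"
  unfolding gauss_weight_def[abs_def] by measurable

lemma vandermonde_sq_le: "(vandermonde k x)\<^sup>2 \<le> (2 * norm_sq k x) ^ (\<Sum>m<k. m)"
proof -
  have "(x m - x j)\<^sup>2 \<le> 2 * norm_sq k x" if "j < m" "m < k" for j m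
  proof -
    have "(x m)\<^sup>2 + (x j)\<^sup>2 = (\<Sum>i\<in>{m, j}. (x i)\<^sup>2)" using that by simp
    also have "\<dots> \<le> norm_sq k x" unfolding norm_sq_def using that by (intro sum_mono2) auto
    finally have "(x m)\<^sup>2 + (x j)\<^sup>2 \<le> norm_sq k x" .
    moreover have "(x m - x j)\<^sup>2 \<le> 2 * ((x m)\<^sup>2 + (x j)\<^sup>2)"
      using zero_le_power2[of "x m + x j"] by (simp add: power2_eq_square algebra_simps)
    ultimately show ?thesis by (meson mult_left_mono order_trans zero_le_numeral)
  qed
  then have "(\<Prod>m<k. \<Prod>j<m. (x m - x j)\<^sup>2) \<le> (\<Prod>m<k. \<Prod>j<m. 2 * norm_sq k x)"
    by (intro prod_mono conjI prod_nonneg ballI) auto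
  then show ?thesis
    by (simp add: vandermonde_def prod_power_distrib[symmetric] power_sum)
qed

lemma power_le_exp: "0 \<le> (x::real) \<Longrightarrow> x ^ n \<le> fact n * exp x"
proof -
  assume x: "0 \<le> x"
  have "(\<Sum>i\<in>{n}. x ^ i /\<^sub>R fact i) \<le> (\<Sum>i. x ^ i /\<^sub>R fact i)"
    using x by (intro sum_le_suminf summable_exp_generic) auto
  then show ?thesis by (simp add: exp_def divide_simps mult.commute)
qed

lemma integrable_gaussian:
  assumes "c > 0"
  shows "integrable lborel (\<lambda>x::real. exp (- (c * x\<^sup>2)))"
proof -
  define s where "s = sqrt (1 / (2 * c))"
  have s: "s > 0" "s\<^sup>2 = 1 / (2 * c)" using assms by (auto simp: s_def)
  have "integrable lborel (\<lambda>x. sqrt (2 * pi * s\<^sup>2) * normal_density 0 s x)"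
    using s by (intro integrable_mult_right integrable_normal_density) auto
  moreover have "sqrt (2 * pi * s\<^sup>2) * normal_density 0 s x = exp (- (c * x\<^sup>2))" for x
    using s(1) assms unfolding normal_density_def s(2) by simp
  ultimately show ?thesis by simp
qed

text \<open>Half of the exponent absorbs the polynomial factors by \<open>power_le_exp\<close>; the
  other half is a product of integrable one-dimensional Gaussians.\<close>

lemma integrable_gauss_weight:
  assumes c: "c > 0"
  shows "integrable (euclid k) (gauss_weight k p c)"
proof -
  define q where "q = (\<Sum>m<k. m)"
  define C where "C = 2 ^ q * (2 / c) ^ (q + p) * fact (q + p)"
  have "integrable (euclid k) (\<lambda>x. \<Prod>i<k. exp (- (c / 2 * (x i)\<^sup>2)))"
    using c by (intro lbs.product_integrable_prod integrable_gaussian) auto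
  then have int: "integrable (euclid k) (\<lambda>x. C * (\<Prod>i<k. exp (- (c / 2 * (x i)\<^sup>2))))" by simp
  have "norm (gauss_weight k p c x) \<le> norm (C * (\<Prod>i<k. exp (- (c / 2 * (x i)\<^sup>2))))" for x
  proof -
    define N where "N = norm_sq k x"
    have N: "N \<ge> 0" by (simp add: N_def)
    have "(c / 2 * N) ^ (q + p) \<le> fact (q + p) * exp (c / 2 * N)"
      using c N by (intro power_le_exp) auto
    then have "(2 / c) ^ (q + p) * (c / 2 * N) ^ (q + p) \<le> (2 / c) ^ (q + p) * (fact (q + p) * exp (c / 2 * N))"
      using c by (intro mult_left_mono) auto
    then have pow: "N ^ (q + p) \<le> (2 / c) ^ (q + p) * (fact (q + p) * exp (c / 2 * N))"
      using c by (simp add: power_mult_distrib[symmetric])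
    have "gauss_weight k p c x \<le> (2 * N) ^ q * N ^ p * exp (- (c * N))"
      unfolding gauss_weight_def N_def q_def using vandermonde_sq_le[of k x] by (intro mult_right_mono) auto
    also have "\<dots> = 2 ^ q * N ^ (q + p) * exp (- (c * N))"
      by (simp add: power_mult_distrib power_add)
    also have "\<dots> \<le> 2 ^ q * ((2 / c) ^ (q + p) * (fact (q + p) * exp (c / 2 * N))) * exp (- (c * N))"
      using pow by (intro mult_right_mono mult_left_mono) auto
    also have "\<dots> = C * (exp (c / 2 * N) * exp (- (c * N)))"
      by (simp add: C_def)
    also have "exp (c / 2 * N) * exp (- (c * N)) = exp (- (c / 2 * N))"
      by (simp add: exp_add[symmetric])
    also have "\<dots> = (\<Prod>i<k. exp (- (c / 2 * (x i)\<^sup>2)))"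
      by (simp add: N_def norm_sq_def exp_sum[symmetric] sum_negf sum_distrib_left)
    finally have "gauss_weight k p c x \<le> C * (\<Prod>i<k. exp (- (c / 2 * (x i)\<^sup>2)))" .
    then show ?thesis using gauss_weight_nonneg[of k p c x] by auto
  qed
  then show ?thesis
    by (intro Bochner_Integration.integrable_bound[OF int] AE_I2) auto
qed

lemma vandermonde_affine: "vandermonde k (\<lambda>i\<in>{..<k}. a + b * x i) = b ^ (\<Sum>m<k. m) * vandermonde k (x :: nat \<Rightarrow> real)"
proof -
  have "vandermonde k (\<lambda>i\<in>{..<k}. a + b * x i) = (\<Prod>m<k. \<Prod>j<m. b * (x m - x j))"
    unfolding vandermonde_def by (intro prod.cong refl) (auto simp: algebra_simps)
  then show ?thesis by (simp add: vandermonde_def prod.distrib power_sum)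
qed

text \<open>The source of the exponent k^2/2: k comes from the volume element, k(k - 1) from the
  squared Vandermonde product.\<close>

lemma sum_lessThan_id: "(k :: nat) + 2 * (\<Sum>m<k. m) = k\<^sup>2"
  by (induction k) (auto simp: power2_eq_square)

lemma integral_gauss_weight_scale:
  assumes c: "c > 0" and t: "t > 0"
  shows "(\<integral>x. gauss_weight k p (c * t) x \<partial>euclid k) = (1 / t) powr (real (k\<^sup>2) / 2 + real p) * (\<integral>x. gauss_weight k p c x \<partial>euclid k)"
proof -
  define b where "b = 1 / sqrt t"
  define q where "q = (\<Sum>m<k. m)"
  have b: "b > 0" "b\<^sup>2 = 1 / t" using t by (auto simp: b_def power_divide)
  have "gauss_weight k p (c * t) (\<lambda>i\<in>{..<k}. 0 + b * x i) = b ^ (2 * q + 2 * p) * gauss_weight k p c x" for x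
  proof -
    have sq: "norm_sq k (\<lambda>i\<in>{..<k}. 0 + b * x i) = b\<^sup>2 * norm_sq k x"
      by (simp add: norm_sq_def power_mult_distrib sum_distrib_left)
    have "c * t * (b\<^sup>2 * norm_sq k x) = c * norm_sq k x" using t by (simp add: b)
    then show ?thesis
      unfolding gauss_weight_def vandermonde_affine sq q_def[symmetric]
      by (simp add: power_mult_distrib power_add power_mult[symmetric] mult.commute)
  qed
  then have "(\<integral>x. gauss_weight k p (c * t) x \<partial>euclid k) = b ^ k * (b ^ (2 * q + 2 * p) * (\<integral>x. gauss_weight k p c x \<partial>euclid k))"
    by (subst integral_euclid_affine(1)[OF b(1), where a = "\<lambda>_. 0"]) auto
  also have "\<dots> = b ^ (k\<^sup>2 + 2 * p) * (\<integral>x. gauss_weight k p c x \<partial>euclid k)"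
    unfolding sum_lessThan_id[of k, symmetric] q_def by (simp add: power_add)
  also have "b ^ (k\<^sup>2 + 2 * p) = (1 / t) powr (real (k\<^sup>2) / 2 + real p)"
  proof -
    have "b = (1 / t) powr (1 / 2)" using t by (simp add: b_def powr_half_sqrt real_sqrt_divide)
    then have "b ^ (k\<^sup>2 + 2 * p) = (1 / t) powr (1 / 2 * real (k\<^sup>2 + 2 * p))"
      using t by (simp add: powr_powr powr_realpow[symmetric])
    then show ?thesis by (simp add: field_simps)
  qed
  finally show ?thesis .
qed

lemma gauss_weight_shift:
  assumes c: "c > 0"
  shows "(\<integral>x. gauss_weight k p c (\<lambda>i\<in>{..<k}. a + 1 * x i) \<partial>euclid k) = (\<integral>x. gauss_weight k p c x \<partial>euclid k)"
    and "integrable (euclid k) (\<lambda>x. gauss_weight k p c (\<lambda>i\<in>{..<k}. a + 1 * x i))"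
  using integral_euclid_affine[of 1 "gauss_weight k p c" k "\<lambda>_. a"] integrable_gauss_weight[OF c] by auto

section \<open>Hermite polynomials and the Mehta integral\<close>

fun hermite :: "nat \<Rightarrow> real poly" where
  "hermite 0 = 1"
| "hermite (Suc n) = pCons 0 (hermite n) - pderiv (hermite n)"

lemma degree_hermite_le: "degree (hermite n) \<le> n"
proof (induction n)
  case (Suc n)
  have "degree (pCons 0 (hermite n)) \<le> Suc n" using Suc degree_pCons_le[of 0 "hermite n"] by linarith
  moreover have "degree (pderiv (hermite n)) \<le> Suc n" using Suc by (simp add: degree_pderiv)
  ultimately show ?case by (simp add: degree_diff_le)
qed simp

lemma coeff_hermite_top: "coeff (hermite n) n = 1"
proof (induction n)
  case (Suc n)
  have "coeff (hermite n) (Suc (Suc n)) = 0" using degree_hermite_le[of n] by (intro coeff_eq_0) simp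
  then show ?case using Suc by (simp add: coeff_pderiv)
qed simp

definition gaussian_mean :: "real poly \<Rightarrow> real" where
  "gaussian_mean p = (\<integral>x. std_normal_density x * poly p x \<partial>lborel)"

lemma integrable_gaussian_mean: "integrable lborel (\<lambda>x. std_normal_density x * poly p x)"
proof -
  have "integrable lborel (\<lambda>x. \<Sum>i\<le>degree p. coeff p i * (std_normal_density x * x ^ i))"
    by (intro Bochner_Integration.integrable_sum integrable_mult_right integrable_std_normal_moment)
  then show ?thesis
    by (simp add: poly_altdef sum_distrib_left mult_ac)
qed

lemma gaussian_mean_add: "gaussian_mean (p + q) = gaussian_mean p + gaussian_mean q"
  unfolding gaussian_mean_def using integrable_gaussian_mean[of p] integrable_gaussian_mean[of q] by (simp add: algebra_simps)

lemma gaussian_mean_diff: "gaussian_mean (p - q) = gaussian_mean p - gaussian_mean q"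
  unfolding gaussian_mean_def using integrable_gaussian_mean[of p] integrable_gaussian_mean[of q] by (simp add: algebra_simps)

lemma gaussian_mean_smult: "gaussian_mean (Polynomial.smult c p) = c * gaussian_mean p"
  unfolding gaussian_mean_def by (simp add: mult.left_commute)

lemma gaussian_mean_sum: "gaussian_mean (\<Sum>i\<in>X. p i) = (\<Sum>i\<in>X. gaussian_mean (p i))"
proof (induction X rule: infinite_finite_induct)
  case (insert x X)
  then show ?case by (simp add: gaussian_mean_add)
qed (simp_all add: gaussian_mean_def)

lemma gaussian_mean_monom_even: "gaussian_mean (monom 1 (2 * j)) = fact (2 * j) / (2 ^ j * fact j)"
  using integral_std_normal_moment_even[of j] by (simp add: gaussian_mean_def poly_monom)

lemma gaussian_mean_monom_odd: "gaussian_mean (monom 1 (2 * j + 1)) = 0"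
  using integral_std_normal_moment_odd[of j] by (simp add: gaussian_mean_def poly_monom)

lemma gaussian_mean_monom_Suc: "gaussian_mean (monom 1 (Suc n)) = real n * gaussian_mean (monom 1 (n - 1))"
proof (cases "even n")
  case True
  then obtain j where j: "n = 2 * j" by auto
  show ?thesis
  proof (cases j)
    case 0
    then show ?thesis using gaussian_mean_monom_odd[of 0] j by simp
  next
    case (Suc i)
    then have "n - 1 = 2 * i + 1" using j by simp
    then show ?thesis using gaussian_mean_monom_odd[of j] gaussian_mean_monom_odd[of i] j by simp
  qed
next
  case False
  then obtain j where j: "n = 2 * j + 1" by (auto elim: oddE)
  have "gaussian_mean (monom 1 (2 * Suc j)) = real (2 * j + 1) * gaussian_mean (monom 1 (2 * j))"
    unfolding gaussian_mean_monom_even by (simp add: divide_simps)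
  then show ?thesis using j by simp
qed

lemma pCons_0_sum: "pCons 0 (\<Sum>i\<in>X. f i) = (\<Sum>i\<in>X. pCons 0 (f i))"
  by (rule poly_eqI) (simp add: coeff_sum coeff_pCons split: nat.split)

text \<open>Gaussian integration by parts, E[x p] = E[p'], obtained from the recursion of the
  moments.\<close>

lemma gaussian_mean_pCons_0: "gaussian_mean (pCons 0 p) = gaussian_mean (pderiv p)"
proof -
  have mon: "gaussian_mean (pCons 0 (monom a i)) = gaussian_mean (pderiv (monom a i))" for a i
  proof -
    have "pCons 0 (monom a i) = Polynomial.smult a (monom 1 (Suc i))"
      by (simp add: smult_monom monom_Suc)
    moreover have "pderiv (monom a i) = Polynomial.smult (a * real i) (monom 1 (i - 1))"
      by (simp add: pderiv_monom smult_monom mult.commute)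
    ultimately show ?thesis
      by (simp only: gaussian_mean_smult gaussian_mean_monom_Suc mult.assoc)
  qed
  have p: "p = (\<Sum>i\<le>degree p. monom (coeff p i) i)"
    by (simp add: poly_as_sum_of_monoms)
  have "pCons 0 p = (\<Sum>i\<le>degree p. pCons 0 (monom (coeff p i) i))"
    by (subst p) (rule pCons_0_sum)
  then have "gaussian_mean (pCons 0 p) = (\<Sum>i\<le>degree p. gaussian_mean (pderiv (monom (coeff p i) i)))"
    by (simp add: gaussian_mean_sum mon)
  also have "\<dots> = gaussian_mean (pderiv (\<Sum>i\<le>degree p. monom (coeff p i) i))"
    by (simp only: pderiv_sum gaussian_mean_sum)
  finally show ?thesis using p by simp
qed

text \<open>Under the Gaussian mean, multiplication by x minus differentiation is adjoint to
  differentiation, so \<open>hermite n\<close> tests the n-th derivative.\<close>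

lemma gaussian_mean_hermite_mult: "gaussian_mean (hermite n * p) = gaussian_mean ((pderiv ^^ n) p)"
proof (induction n arbitrary: p)
  case (Suc n)
  have "gaussian_mean (hermite (Suc n) * p) = gaussian_mean (pCons 0 (hermite n * p)) - gaussian_mean (pderiv (hermite n) * p)"
    by (simp add: left_diff_distrib gaussian_mean_diff)
  also have "\<dots> = gaussian_mean (hermite n * pderiv p)"
    by (simp add: gaussian_mean_pCons_0 pderiv_mult gaussian_mean_add mult.commute)
  also have "\<dots> = gaussian_mean ((pderiv ^^ Suc n) p)"
    by (simp add: Suc funpow_swap1)
  finally show ?case .
qed simp

lemma gaussian_mean_hermite_orthogonal: "gaussian_mean (hermite n * hermite m) = (if n = m then fact n else 0)"
proof -
  have less: "gaussian_mean (hermite n * hermite m) = (if n = m then fact n else 0)" if "m \<le> n" for m n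
  proof -
    have "(pderiv ^^ n) (hermite m) = [:fact n * coeff (hermite m) n:]"
    proof (rule poly_eqI)
      fix i
      have "coeff (hermite m) (i + n) = 0" if "i > 0"
        using degree_hermite_le[of m] \<open>m \<le> n\<close> that by (intro coeff_eq_0) simp
      then show "coeff ((pderiv ^^ n) (hermite m)) i = coeff [:fact n * coeff (hermite m) n:] i"
        by (cases i) (simp_all add: coeff_higher_pderiv pochhammer_fact)
    qed
    moreover have "gaussian_mean [:c:] = c" for c
      using gaussian_mean_smult[of c "monom 1 0"] gaussian_mean_monom_even[of 0] by (simp add: smult_monom monom_0)
    moreover have "coeff (hermite m) n = (if n = m then 1 else 0)"
      using that degree_hermite_le[of m] by (auto simp: coeff_hermite_top intro: coeff_eq_0)
    ultimately show ?thesis by (simp add: gaussian_mean_hermite_mult)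
  qed
  show ?thesis using less[of n m] less[of m n] by (cases "m \<le> n") (auto simp: mult.commute)
qed

text \<open>Since Hermite polynomials are monic, the Vandermonde product is the determinant of their
  values. The square is a sum over pairs of permutations; orthogonality leaves the diagonal pairs,
  each contributing the product of the factorials.\<close>

lemma integral_vandermonde_sq_gaussian:
  "(\<integral>x. (vandermonde k x)\<^sup>2 * (\<Prod>i<k. std_normal_density (x i)) \<partial>euclid k) = fact k * (\<Prod>j<k. fact j)"
proof -
  let ?P = "{p. p permutes {..<k}}"
  define G where "G p q x = (\<Prod>i<k. std_normal_density (x i) * poly (hermite (p i) * hermite (q i)) (x i))" for p q :: "nat \<Rightarrow> nat" and x
  have vandermonde: "vandermonde k x = (\<Sum>p\<in>?P. of_int (sign p) * (\<Prod>i<k. poly (hermite (p i)) (x i)))" for x :: "nat \<Rightarrow> real"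
    using det_poly_eval_triangular[of k hermite x, OF degree_hermite_le] unfolding leibniz_det[where f = "\<lambda>i j. poly (hermite j) (x i)"]
    by (simp add: coeff_hermite_top)
  have "(vandermonde k x)\<^sup>2 * (\<Prod>i<k. std_normal_density (x i)) = (\<Sum>p\<in>?P. \<Sum>q\<in>?P. of_int (sign p) * of_int (sign q) * G p q x)" for x
    unfolding vandermonde power2_eq_square sum_product sum_distrib_right G_def prod.distrib poly_mult
    by (intro sum.cong refl) (simp add: sum_distrib_left mult_ac)
  moreover have "integrable (euclid k) (G p q)" for p q
    unfolding G_def[abs_def] by (intro lbs.product_integrable_prod integrable_gaussian_mean) auto
  ultimately have "(\<integral>x. (vandermonde k x)\<^sup>2 * (\<Prod>i<k. std_normal_density (x i)) \<partial>euclid k)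
     = (\<Sum>p\<in>?P. \<Sum>q\<in>?P. of_int (sign p) * of_int (sign q) * (\<integral>x. G p q x \<partial>euclid k))"
    by (simp add: Bochner_Integration.integral_sum)
  also have "\<dots> = (\<Sum>p\<in>?P. \<Sum>q\<in>?P. if q = p then (\<Prod>j<k. fact j) else 0)"
  proof (intro sum.cong refl)
    fix p q assume p: "p \<in> ?P" and q: "q \<in> ?P"
    have eq: "(\<integral>x. G p q x \<partial>euclid k) = (\<Prod>i<k. if p i = q i then fact (p i) else 0)"
      unfolding G_def
      by (subst lbs.product_integral_prod) (auto intro: integrable_gaussian_mean simp: gaussian_mean_def[symmetric] gaussian_mean_hermite_orthogonal simp del: poly_mult)
    show "of_int (sign p) * of_int (sign q) * (\<integral>x. G p q x \<partial>euclid k) = (if q = p then (\<Prod>j<k. fact j) else 0)"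
    proof (cases "q = p")
      case True
      have "(\<Prod>i<k. fact (p i)) = (\<Prod>j<k. fact j :: real)"
        using p prod.permute[of p "{..<k}" "fact :: nat \<Rightarrow> real"] by (simp add: comp_def)
      moreover have "real_of_int (sign p) * of_int (sign p) = 1" by (simp add: sign_def)
      ultimately show ?thesis using True eq by simp
    next
      case False
      then obtain i where i: "p i \<noteq> q i" by (metis ext)
      have "i < k"
      proof (rule ccontr)
        assume "\<not> i < k"
        then have "p i = i" "q i = i"
          using p q permutes_not_in[of p "{..<k}" i] permutes_not_in[of q "{..<k}" i] by auto
        then show False using i by simp
      qed
      then have "(\<Prod>i<k. if p i = q i then fact (p i) else (0::real)) = 0"
        using i by (intro prod_zero) auto
      then show ?thesis using False eq by simp
    qed
  qed
  also have "\<dots> = fact k * (\<Prod>j<k. fact j)"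
    by (simp add: finite_permutations card_permutations[of "{..<k}" k] sum.delta)
  finally show ?thesis .
qed

lemma integral_gauss_weight_0:
  "(\<integral>x. gauss_weight k 0 (1 / 2) x \<partial>euclid k) = sqrt (2 * pi) ^ k * (fact k * (\<Prod>j<k. fact j))"
proof -
  have "gauss_weight k 0 (1 / 2) x = sqrt (2 * pi) ^ k * ((vandermonde k x)\<^sup>2 * (\<Prod>i<k. std_normal_density (x i)))" for x
  proof -
    have "(\<Prod>i<k. std_normal_density (x i)) = (1 / sqrt (2 * pi)) ^ k * exp (- (norm_sq k x / 2))"
      unfolding std_normal_density_def prod.distrib
      by (simp add: exp_sum[symmetric] norm_sq_def sum_negf sum_divide_distrib)
    then show ?thesis by (simp add: gauss_weight_def power_divide)
  qed
  then show ?thesis by (simp add: integral_vandermonde_sq_gaussian)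
qed

text \<open>All three error weights integrate to the order n^(-k^2/2 - 1): one extra power of
  \<open>norm_sq\<close>, or two with a factor n; the third is centred at (pi, ..., pi) and has the
  integral of the first by translation, which does not affect the Vandermonde product.\<close>

lemma laplace_torus:
  fixes F :: "nat \<Rightarrow> (nat \<Rightarrow> real) \<Rightarrow> real"
  assumes a: "a > 0" and c: "c > 0" "c \<le> a / 2" and C: "C \<ge> 0"
    and int: "\<And>n. integrable (torus {..<k}) (F n)"
    and bound: "\<And>n y. n \<ge> 1 \<Longrightarrow> (\<And>i. i < k \<Longrightarrow> y i \<in> {- (pi / 2)..3 * pi / 2}) \<Longrightarrow>
      \<bar>F n y - g * gauss_weight k 0 (a / 2 * real n) y\<bar>
      \<le> C * (gauss_weight k 1 (c * real n) y + real n * gauss_weight k 2 (c * real n) y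
             + gauss_weight k 1 (c * real n) (\<lambda>i\<in>{..<k}. - pi + 1 * y i))"
  shows "\<exists>D. \<forall>n\<ge>1. \<bar>(\<integral>y. F n y \<partial>torus {..<k})
      - g * (1 / (2 * pi)) ^ k * (sqrt (2 * pi) ^ k * (fact k * (\<Prod>j<k. fact j))) * (1 / (a * real n)) powr (real (k\<^sup>2) / 2)\<bar>
    \<le> D * (1 / real n) powr (real (k\<^sup>2) / 2 + 1)"
proof -
  let ?B = "\<lambda>y :: nat \<Rightarrow> real. \<Prod>i<k. indicator {- (pi / 2)..3 * pi / 2} (y i) :: real"
  define J where "J p = (\<integral>x. gauss_weight k p c x \<partial>euclid k)" for p
  define H where "H n y = gauss_weight k 1 (c * real n) y + real n * gauss_weight k 2 (c * real n) y
             + gauss_weight k 1 (c * real n) (\<lambda>i\<in>{..<k}. - pi + 1 * y i)" for n y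
  define s where "s = real (k\<^sup>2) / 2"
  have H_nonneg: "0 \<le> H n y" for n y by (simp add: H_def)
  have "\<bar>(\<integral>y. F n y \<partial>torus {..<k}) - g * (1 / (2 * pi)) ^ k * (sqrt (2 * pi) ^ k * (fact k * (\<Prod>j<k. fact j))) * (1 / (a * real n)) powr s\<bar>
    \<le> (1 / (2 * pi)) ^ k * ((C + \<bar>g\<bar>) * (2 * J 1 + J 2)) * (1 / real n) powr (s + 1)" if n: "n \<ge> 1" for n
  proof -
    have cn: "c * real n > 0" and an: "a * real n > 0" "a / 2 * real n > 0" using n a c by auto
    define W where "W = gauss_weight k 0 (a / 2 * real n)"
    have intW: "integrable (euclid k) W" unfolding W_def by (rule integrable_gauss_weight[OF an(2)])
    have valW: "(\<integral>y. W y \<partial>euclid k) = sqrt (2 * pi) ^ k * (fact k * (\<Prod>j<k. fact j)) * (1 / (a * real n)) powr s"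
      using integral_gauss_weight_scale[of "1 / 2" "a * real n" k 0] an unfolding W_def integral_gauss_weight_0
      by (simp add: s_def mult.commute)
    have intH: "integrable (euclid k) (H n)"
      unfolding H_def[abs_def]
      by (intro Bochner_Integration.integrable_add integrable_mult_right gauss_weight_shift(2)[OF cn] integrable_gauss_weight[OF cn])
    have valH: "(\<integral>y. H n y \<partial>euclid k) = (2 * J 1 + J 2) * (1 / real n) powr (s + 1)"
    proof -
      have "(\<integral>y. H n y \<partial>euclid k) = (\<integral>x. gauss_weight k 1 (c * real n) x \<partial>euclid k)
         + real n * (\<integral>x. gauss_weight k 2 (c * real n) x \<partial>euclid k) + (\<integral>x. gauss_weight k 1 (c * real n) x \<partial>euclid k)"
        unfolding H_def
        by (subst Bochner_Integration.integral_add Bochner_Integration.integral_add,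
            (intro Bochner_Integration.integrable_add integrable_mult_right gauss_weight_shift(2)[OF cn] integrable_gauss_weight[OF cn])+)+
           (simp only: integral_mult_right_zero gauss_weight_shift(1)[OF cn])
      also have "\<dots> = (1 / real n) powr (s + 1) * J 1 + real n * ((1 / real n) powr (s + 2) * J 2) + (1 / real n) powr (s + 1) * J 1"
        using integral_gauss_weight_scale[OF c(1), of "real n" k] n by (simp add: J_def s_def)
      also have "real n * ((1 / real n) powr (s + 2) * J 2) = (1 / real n) powr (s + 1) * J 2"
      proof -
        have "(1 / real n) powr (s + 2) = (1 / real n) powr ((s + 1) + 1)" by (simp add: add.commute)
        also have "\<dots> = (1 / real n) powr (s + 1) * (1 / real n)"
          using n by (simp only: powr_add) simp
        finally show ?thesis using n by simp
      qed
      finally show ?thesis by (simp add: algebra_simps)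
    qed
    have meas: "F n \<in> borel_measurable (torus {..<k})" using int[of n] by auto
    have intF: "integrable (euclid k) (\<lambda>x. ?B x * F n x)"
      by (rule integral_torus(2)[OF meas int])
    have pt: "\<bar>?B y * F n y - g * W y\<bar> \<le> (C + \<bar>g\<bar>) * H n y" for y
    proof (cases "\<forall>i<k. y i \<in> {- (pi / 2)..3 * pi / 2}")
      case True
      then have "?B y = 1" by (intro prod.neutral) (auto simp: indicator_def)
      then have "\<bar>?B y * F n y - g * W y\<bar> \<le> C * H n y"
        using bound[OF n, of y] True by (simp add: W_def H_def)
      also have "\<dots> \<le> (C + \<bar>g\<bar>) * H n y" using H_nonneg by (intro mult_right_mono) auto
      finally show ?thesis .
    next
      \<comment> \<open>Outside the box the torus part is 0 and |y|^2 is at least 1, so the tail of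
        the Gaussian is below the first error weight. Here c is at most a/2 for the exponentials to
        compare.\<close>
      case False
      then obtain i where i: "i < k" "y i \<notin> {- (pi / 2)..3 * pi / 2}" by auto
      then have B0: "?B y = 0" by (intro prod_zero) (auto intro!: bexI[of _ i])
      have "1 \<le> \<bar>y i\<bar>" using i(2) pi_gt3 by (auto simp: abs_if)
      then have "1 \<le> (y i)\<^sup>2" by (metis abs_1 abs_le_square_iff one_power2)
      also have "\<dots> \<le> norm_sq k y" unfolding norm_sq_def using i(1) by (intro member_le_sum) auto
      finally have N: "1 \<le> norm_sq k y" .
      have "W y \<le> gauss_weight k 1 (c * real n) y"
      proof -
        have "c * real n * norm_sq k y \<le> a / 2 * real n * norm_sq k y"
          using c by (intro mult_right_mono) auto
        then have "exp (- (a / 2 * real n * norm_sq k y)) \<le> norm_sq k y * exp (- (c * real n * norm_sq k y))"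
          using N by (intro order_trans[OF _ mult_right_mono[OF N]]) auto
        then show ?thesis unfolding W_def gauss_weight_def by (simp add: mult.assoc mult_left_mono)
      qed
      also have "\<dots> \<le> H n y" by (simp add: H_def)
      finally have "W y \<le> H n y" .
      moreover have "0 \<le> W y" by (simp add: W_def)
      ultimately have "\<bar>g * W y\<bar> \<le> \<bar>g\<bar> * H n y" by (simp add: abs_mult mult_left_mono)
      also have "\<dots> \<le> (C + \<bar>g\<bar>) * H n y" using H_nonneg C by (intro mult_right_mono) auto
      finally show ?thesis unfolding B0 by simp
    qed
    have "(\<integral>y. ?B y * F n y \<partial>euclid k) - g * (\<integral>y. W y \<partial>euclid k) = (\<integral>y. ?B y * F n y - g * W y \<partial>euclid k)"
      using intF intW by simp
    then have "\<bar>(\<integral>y. ?B y * F n y \<partial>euclid k) - g * (\<integral>y. W y \<partial>euclid k)\<bar> \<le> (\<integral>y. \<bar>?B y * F n y - g * W y\<bar> \<partial>euclid k)"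
      by (simp only: integral_abs_bound)
    also have "\<dots> \<le> (\<integral>y. (C + \<bar>g\<bar>) * H n y \<partial>euclid k)"
      using intF intW intH by (intro integral_mono pt) auto
    also have "\<dots> = (C + \<bar>g\<bar>) * ((2 * J 1 + J 2) * (1 / real n) powr (s + 1))"
      by (simp add: valH)
    finally have main: "\<bar>(\<integral>y. ?B y * F n y \<partial>euclid k) - g * (\<integral>y. W y \<partial>euclid k)\<bar>
       \<le> (C + \<bar>g\<bar>) * ((2 * J 1 + J 2) * (1 / real n) powr (s + 1))" .
    have "(\<integral>y. F n y \<partial>torus {..<k}) - g * (1 / (2 * pi)) ^ k * (sqrt (2 * pi) ^ k * (fact k * (\<Prod>j<k. fact j))) * (1 / (a * real n)) powr s
      = (1 / (2 * pi)) ^ k * ((\<integral>y. ?B y * F n y \<partial>euclid k) - g * (\<integral>y. W y \<partial>euclid k))"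
      unfolding integral_torus(1)[OF meas] valW by (simp add: algebra_simps)
    then show ?thesis
      using mult_left_mono[OF main, of "(1 / (2 * pi)) ^ k"] by (simp add: abs_mult mult_ac)
  qed
  then show ?thesis unfolding s_def by blast
qed

section \<open>Elementary estimates\<close>

lemma abs_power_diff_le:
  fixes x y M :: real
  assumes "\<bar>x\<bar> \<le> M" "\<bar>y\<bar> \<le> M" "M > 0"
  shows "\<bar>x ^ n - y ^ n\<bar> \<le> real n * \<bar>x - y\<bar> * (M ^ n / M)"
proof -
  have "norm ((x / M) ^ n - (y / M) ^ n) \<le> real n * norm (x / M - y / M)"
    using assms by (intro norm_power_diff) auto
  then have "\<bar>x ^ n - y ^ n\<bar> / M ^ n \<le> real n * (\<bar>x - y\<bar> / M)"
    using assms by (simp add: power_divide diff_divide_distrib[symmetric])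
  then show ?thesis using assms by (simp add: pos_divide_le_eq mult_ac)
qed

lemma power_taylor2:
  fixes x :: real
  assumes "\<bar>x\<bar> \<le> 1"
  shows "\<bar>x ^ i - (1 - real i * (1 - x))\<bar> \<le> (real i)\<^sup>2 * (1 - x)\<^sup>2"
proof (induction i)
  case (Suc i)
  have "x ^ Suc i - (1 - real (Suc i) * (1 - x)) = x * (x ^ i - (1 - real i * (1 - x))) + real i * (1 - x)\<^sup>2"
    by (simp add: power2_eq_square algebra_simps)
  then have "\<bar>x ^ Suc i - (1 - real (Suc i) * (1 - x))\<bar> \<le> \<bar>x\<bar> * \<bar>x ^ i - (1 - real i * (1 - x))\<bar> + real i * (1 - x)\<^sup>2"
    by (metis abs_mult abs_of_nonneg abs_triangle_ineq mult_nonneg_nonneg of_nat_0_le_iff zero_le_power2)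
  also have "\<dots> \<le> 1 * ((real i)\<^sup>2 * (1 - x)\<^sup>2) + real i * (1 - x)\<^sup>2"
    using assms Suc by (intro add_mono mult_mono) auto
  also have "\<dots> = ((real i)\<^sup>2 + real i) * (1 - x)\<^sup>2" by (simp add: algebra_simps)
  also have "\<dots> \<le> (real (Suc i))\<^sup>2 * (1 - x)\<^sup>2"
  proof (rule mult_right_mono[OF _ zero_le_power2])
    show "(real i)\<^sup>2 + real i \<le> (real (Suc i))\<^sup>2" by (simp add: power2_eq_square algebra_simps)
  qed
  finally show ?case .
qed simp

lemma coeff_power_nonneg:
  fixes p :: "real poly"
  assumes "\<And>i. coeff p i \<ge> 0"
  shows "coeff (p ^ n) i \<ge> 0"
proof (induction n arbitrary: i)
  case (Suc n)
  show ?case using assms Suc by (simp add: coeff_mult sum_nonneg)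
qed (simp add: coeff_1)

text \<open>With \<open>S(1) = p(r)\<close>, the quotient \<open>p(r x) / p(r)\<close> is the probability generating function of the
  number of atomic steps in a random composite step.\<close>

lemma pgf_estimates:
  fixes p :: "real poly"
  assumes nn: "\<And>i. coeff p i \<ge> 0" and r: "r > 0" and m: "m \<ge> 1" "coeff p m > 0"
  defines "ph \<equiv> \<lambda>x. poly p (r * x) / poly p r"
  shows "poly p r > 0"
    and "\<exists>\<kappa>>0. \<forall>x. 0 \<le> x \<longrightarrow> x \<le> 1 \<longrightarrow> 0 \<le> ph x \<and> ph x \<le> exp (- (\<kappa> * (1 - x)))"
    and "\<exists>C\<ge>0. \<forall>x. \<bar>x\<bar> \<le> 1 \<longrightarrow> \<bar>ph x - (1 - (r * poly (pderiv p) r / poly p r) * (1 - x))\<bar> \<le> C * (1 - x)\<^sup>2"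
    and "poly (pderiv p) r > 0"
proof -
  define t where "t i = coeff p i * r ^ i" for i
  have t: "t i \<ge> 0" for i using nn r by (simp add: t_def)
  have tm: "t m > 0" using m r by (simp add: t_def)
  have mdeg: "m \<le> degree p" using m by (intro le_degree) auto
  have pr: "poly p r = (\<Sum>i\<le>degree p. t i)" by (simp add: poly_altdef t_def)
  have prx: "poly p (r * x) = (\<Sum>i\<le>degree p. t i * x ^ i)" for x
    by (simp add: poly_altdef t_def power_mult_distrib mult_ac)
  have "t m \<le> poly p r" unfolding pr using t mdeg by (intro member_le_sum) auto
  then show pos: "poly p r > 0" using tm by simp
  have dp: "r * poly (pderiv p) r = (\<Sum>i\<le>degree p. real i * t i)"
  proof -
    have "poly (pderiv p) r = (\<Sum>i\<le>degree p. coeff (pderiv p) i * r ^ i)"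
      unfolding poly_altdef by (rule sum.mono_neutral_left) (auto simp: degree_pderiv intro!: coeff_eq_0)
    also have "r * \<dots> = (\<Sum>i\<le>degree p. real (Suc i) * t (Suc i))"
      by (simp add: sum_distrib_left coeff_pderiv t_def mult_ac)
    also have "\<dots> = (\<Sum>i\<le>Suc (degree p). real i * t i)"
      by (subst sum.atMost_Suc_shift) simp
    also have "\<dots> = (\<Sum>i\<le>degree p. real i * t i)"
      by (simp add: t_def coeff_eq_0)
    finally show ?thesis .
  qed
  have "0 < real m * t m" using m tm by simp
  also have "\<dots> \<le> (\<Sum>i\<le>degree p. real i * t i)"
    using t mdeg by (intro member_le_sum) auto
  finally show "poly (pderiv p) r > 0" using r unfolding dp[symmetric] by (simp add: zero_less_mult_iff)
  show "\<exists>\<kappa>>0. \<forall>x. 0 \<le> x \<longrightarrow> x \<le> 1 \<longrightarrow> 0 \<le> ph x \<and> ph x \<le> exp (- (\<kappa> * (1 - x)))"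
  proof (intro exI conjI allI impI)
    \<comment> \<open>The rate is the probability of exactly m atomic steps: x^m is at most x, the
      other terms of p(r) - p(r x) are nonnegative, and 1 - s is at most exp(- s).\<close>
    show "t m / poly p r > 0" using tm pos by simp
    fix x :: real assume x: "0 \<le> x" "x \<le> 1"
    show "0 \<le> ph x" unfolding ph_def prx using t x pos by (intro divide_nonneg_pos sum_nonneg) auto
    have "t m * (1 - x) \<le> t m * (1 - x ^ m)"
      using x m tm power_le_one_iff[of x m] power_decreasing[of 1 m x] by (intro mult_left_mono) auto
    also have "\<dots> \<le> (\<Sum>i\<le>degree p. t i * (1 - x ^ i))"
      using t mdeg x by (intro member_le_sum) (auto simp: power_le_one)
    also have "\<dots> = poly p r - poly p (r * x)"
      unfolding pr prx by (simp add: algebra_simps sum_subtractf)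
    finally have "t m * (1 - x) / poly p r \<le> (poly p r - poly p (r * x)) / poly p r"
      using pos by (intro divide_right_mono) auto
    then have "t m / poly p r * (1 - x) \<le> 1 - ph x"
      using pos by (simp add: ph_def diff_divide_distrib)
    then show "ph x \<le> exp (- (t m / poly p r * (1 - x)))"
      using exp_ge_add_one_self[of "- (t m / poly p r * (1 - x))"] by linarith
  qed
  show "\<exists>C\<ge>0. \<forall>x. \<bar>x\<bar> \<le> 1 \<longrightarrow> \<bar>ph x - (1 - (r * poly (pderiv p) r / poly p r) * (1 - x))\<bar> \<le> C * (1 - x)\<^sup>2"
  proof (intro exI conjI allI impI)
    \<comment> \<open>The constant is the second moment of the number of atomic steps, which sums
      the remainders of \<open>power_taylor2\<close>.\<close>
    show "(\<Sum>i\<le>degree p. t i * (real i)\<^sup>2) / poly p r \<ge> 0"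
      using t pos by (intro divide_nonneg_pos sum_nonneg) auto
    fix x :: real assume x: "\<bar>x\<bar> \<le> 1"
    have "ph x - (1 - (r * poly (pderiv p) r / poly p r) * (1 - x))
       = (\<Sum>i\<le>degree p. t i * (x ^ i - (1 - real i * (1 - x)))) / poly p r"
      unfolding dp using pos
      by (simp add: ph_def prx pr divide_simps) (simp add: algebra_simps sum_subtractf sum.distrib sum_distrib_left)
    also have "\<bar>\<dots>\<bar> \<le> (\<Sum>i\<le>degree p. t i * ((real i)\<^sup>2 * (1 - x)\<^sup>2)) / poly p r"
    proof -
      have "\<bar>\<Sum>i\<le>degree p. t i * (x ^ i - (1 - real i * (1 - x)))\<bar> \<le> (\<Sum>i\<le>degree p. t i * ((real i)\<^sup>2 * (1 - x)\<^sup>2))"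
        using t power_taylor2[OF x]
        by (intro order_trans[OF sum_abs] sum_mono) (auto simp: abs_mult intro!: mult_left_mono)
      then show ?thesis using pos by (simp add: abs_divide divide_right_mono)
    qed
    finally show "\<bar>ph x - (1 - (r * poly (pderiv p) r / poly p r) * (1 - x))\<bar>
      \<le> (\<Sum>i\<le>degree p. t i * (real i)\<^sup>2) / poly p r * (1 - x)\<^sup>2"
      by (simp add: sum_distrib_right mult.assoc)
  qed
qed

lemma sin_sq_bounds: "(sin (t::real))\<^sup>2 \<le> t\<^sup>2" "t\<^sup>2 * (1 - t\<^sup>2 / 3) \<le> (sin t)\<^sup>2"
proof -
  have "\<bar>sin t\<bar> \<le> \<bar>t\<bar>" by (rule abs_sin_x_le_abs_x)
  then show "(sin t)\<^sup>2 \<le> t\<^sup>2" by (simp add: abs_le_square_iff)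
  show "t\<^sup>2 * (1 - t\<^sup>2 / 3) \<le> (sin t)\<^sup>2"
  proof (cases "t\<^sup>2 \<le> 6")
    \<comment> \<open>The lower bound |t| (1 - t^2/6) for |sin t| may be squared only where it is
      nonnegative; beyond that range the claimed bound is negative anyway.\<close>
    case True
    have "\<bar>sin t - t\<bar> \<le> \<bar>t\<bar> ^ 3 / 6"
    proof -
      have sc: "(\<Sum>m<3. sin_coeff m * t ^ m) = t" by (simp add: numeral_3_eq_3 sin_coeff_def)
      have f: "inverse (fact 3 :: real) = 1 / 6" by (simp add: fact_numeral)
      show ?thesis using Maclaurin_sin_bound[of t 3] unfolding sc f by linarith
    qed
    then have "\<bar>t\<bar> - \<bar>t\<bar> ^ 3 / 6 \<le> \<bar>sin t\<bar>" by linarith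
    moreover have "\<bar>t\<bar> ^ 3 = \<bar>t\<bar> * t\<^sup>2" by (simp add: power3_eq_cube power2_eq_square)
    ultimately have 1: "\<bar>t\<bar> * (1 - t\<^sup>2 / 6) \<le> \<bar>sin t\<bar>" by (simp add: algebra_simps)
    have "(1 - x / 6)\<^sup>2 = 1 - x / 3 + x\<^sup>2 / 36" for x :: real
      by (simp add: power2_eq_square field_simps)
    then have "1 - x / 3 \<le> (1 - x / 6)\<^sup>2" for x :: real
      by (metis le_add_same_cancel1 zero_le_divide_iff zero_le_numeral zero_le_power2)
    then have "t\<^sup>2 * (1 - t\<^sup>2 / 3) \<le> t\<^sup>2 * (1 - t\<^sup>2 / 6)\<^sup>2"
      by (simp only: mult_left_mono zero_le_power2)
    also have "\<dots> = (\<bar>t\<bar> * (1 - t\<^sup>2 / 6))\<^sup>2" by (simp add: power_mult_distrib)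
    also have "\<dots> \<le> \<bar>sin t\<bar>\<^sup>2" using 1 True by (intro power_mono) auto
    finally show ?thesis by simp
  next
    case False
    then have "t\<^sup>2 * (1 - t\<^sup>2 / 3) \<le> 0" by (intro mult_nonneg_nonpos) auto
    then show ?thesis by (meson order_trans zero_le_power2)
  qed
qed

lemma cos_bounds: "\<bar>cos (t::real) - (1 - t\<^sup>2 / 2)\<bar> \<le> t ^ 4 / 24" "1 - cos t \<le> t\<^sup>2 / 2"
proof -
  have c: "cos t = 1 - 2 * (sin (t / 2))\<^sup>2" using cos_double_sin[of "t / 2"] by simp
  have "(sin (t / 2))\<^sup>2 \<le> t\<^sup>2 / 4" using sin_sq_bounds(1)[of "t / 2"] by (simp add: power_divide)
  moreover have "t\<^sup>2 / 4 - t ^ 4 / 48 \<le> (sin (t / 2))\<^sup>2"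
    using sin_sq_bounds(2)[of "t / 2"] by (simp add: power_divide algebra_simps eval_nat_numeral)
  ultimately show "\<bar>cos t - (1 - t\<^sup>2 / 2)\<bar> \<le> t ^ 4 / 24" "1 - cos t \<le> t\<^sup>2 / 2"
    unfolding c abs_le_iff by auto
qed

text \<open>The constant 50 is generous: up to pi/2 the Taylor bound gives even t^2/3, and between
  pi/2 and 3 pi/2 the cosine is at most 0 while t^2 is at most 36.\<close>

lemma one_minus_cos_ge:
  assumes "\<bar>t\<bar> \<le> 3 * pi / 2"
  shows "t\<^sup>2 / 50 \<le> 1 - cos t"
proof -
  define s where "s = \<bar>t\<bar>"
  have s: "0 \<le> s" "s \<le> 3 * pi / 2" using assms by (auto simp: s_def)
  have "s\<^sup>2 / 50 \<le> 1 - cos s"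
  proof (cases "s \<le> pi / 2")
    case True
    have "s \<le> 2" using True pi_less_4 by linarith
    then have "s\<^sup>2 \<le> 4" using s power_mono[of s 2 2] by simp
    then have "s\<^sup>2 * s\<^sup>2 \<le> s\<^sup>2 * 4" by (intro mult_left_mono) auto
    then have "s ^ 4 \<le> 4 * s\<^sup>2" by (simp add: eval_nat_numeral)
    moreover have "cos s \<le> 1 - s\<^sup>2 / 2 + s ^ 4 / 24" using cos_bounds(1)[of s] by linarith
    moreover have "0 \<le> s\<^sup>2" by simp
    ultimately show ?thesis by linarith
  next
    case False
    have "0 \<le> sin (s - pi / 2)" using False s by (intro sin_ge_zero) auto
    then have "cos s \<le> 0" by (simp add: sin_diff)
    moreover have "s \<le> 6" using s pi_less_4 by linarith
    then have "s\<^sup>2 \<le> 36" using s power_mono[of s 6 2] by simp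
    ultimately show ?thesis by linarith
  qed
  moreover have "cos s = cos t" by (simp add: s_def abs_if)
  ultimately show ?thesis by (simp add: s_def)
qed

text \<open>Relative errors of the factors add up.\<close>

lemma prod_diff_le:
  fixes f g :: "'a \<Rightarrow> real"
  assumes "\<And>i. i \<in> X \<Longrightarrow> 0 \<le> f i \<and> f i \<le> g i \<and> g i * (1 - \<eta>) \<le> f i" "\<eta> \<ge> 0" "finite X"
  shows "(\<Prod>i\<in>X. g i) - (\<Prod>i\<in>X. f i) \<le> real (card X) * \<eta> * (\<Prod>i\<in>X. g i)"
  using assms(3,1)
proof (induction X rule: finite_induct)
  case (insert x X)
  let ?G = "\<Prod>i\<in>X. g i" and ?F = "\<Prod>i\<in>X. f i"
  have IH: "?G - ?F \<le> real (card X) * \<eta> * ?G" using insert by auto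
  have F: "0 \<le> ?F" "?F \<le> ?G" using insert by (auto intro!: prod_nonneg prod_mono)
  have x: "0 \<le> f x" "f x \<le> g x" "g x - f x \<le> \<eta> * g x" using insert(4)[of x] by (auto simp: algebra_simps)
  have "g x * ?G - f x * ?F = g x * (?G - ?F) + (g x - f x) * ?F" by (simp add: algebra_simps)
  also have "\<dots> \<le> g x * (real (card X) * \<eta> * ?G) + (\<eta> * g x) * ?G"
    using IH F x assms(2) by (intro add_mono mult_mono mult_nonneg_nonneg) auto
  also have "\<dots> = real (card (insert x X)) * \<eta> * (g x * ?G)" using insert(1,2) by (simp add: algebra_simps)
  finally show ?case using insert(1,2) by simp
qed simp

lemma prod_diff_le_double:
  fixes f g :: "nat \<Rightarrow> nat \<Rightarrow> real"
  assumes fg: "\<And>m j. j < m \<Longrightarrow> m < k \<Longrightarrow> 0 \<le> f m j \<and> f m j \<le> g m j \<and> g m j * (1 - \<eta>) \<le> f m j" and \<eta>: "\<eta> \<ge> 0"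
  shows "(\<Prod>m<k. \<Prod>j<m. g m j) - (\<Prod>m<k. \<Prod>j<m. f m j) \<le> real (k * k) * \<eta> * (\<Prod>m<k. \<Prod>j<m. g m j)"
proof -
  define X where "X = (SIGMA m:{..<k}. {..<m})"
  have P: "(\<Prod>m<k. \<Prod>j<m. h m j) = (\<Prod>x\<in>X. h (fst x) (snd x))" for h :: "nat \<Rightarrow> nat \<Rightarrow> real"
    unfolding X_def by (subst prod.Sigma) (auto simp: case_prod_unfold)
  have fin: "finite X" by (simp add: X_def)
  have "X \<subseteq> {..<k} \<times> {..<k}" by (auto simp: X_def)
  then have "card X \<le> k * k" using card_mono[of "{..<k} \<times> {..<k}" X] by simp
  have fgX: "0 \<le> f (fst x) (snd x) \<and> f (fst x) (snd x) \<le> g (fst x) (snd x) \<and> g (fst x) (snd x) * (1 - \<eta>) \<le> f (fst x) (snd x)"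
    if "x \<in> X" for x
    using fg[of "snd x" "fst x"] that by (auto simp: X_def)
  have "(\<Prod>x\<in>X. g (fst x) (snd x)) - (\<Prod>x\<in>X. f (fst x) (snd x)) \<le> real (card X) * \<eta> * (\<Prod>x\<in>X. g (fst x) (snd x))"
    by (rule prod_diff_le[where f = "\<lambda>x. f (fst x) (snd x)" and g = "\<lambda>x. g (fst x) (snd x)", OF fgX \<eta> fin])
  also have "\<dots> \<le> real (k * k) * \<eta> * (\<Prod>x\<in>X. g (fst x) (snd x))"
  proof (intro mult_right_mono)
    show "real (card X) \<le> real (k * k)" using \<open>card X \<le> k * k\<close> by (simp only: of_nat_le_iff)
    show "0 \<le> (\<Prod>x\<in>X. g (fst x) (snd x))"
    proof (rule prod_nonneg)
      fix x assume "x \<in> X"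
      then show "0 \<le> g (fst x) (snd x)" using fg[of "snd x" "fst x"] by (auto simp: X_def)
    qed
  qed (use \<eta> in auto)
  finally show ?thesis by (simp only: P)
qed

section \<open>The kernel on the torus\<close>

abbreviation imag_pt :: "(nat \<Rightarrow> real) \<Rightarrow> nat \<Rightarrow> complex" where
  "imag_pt \<equiv> polar (\<lambda>_. 0)"

lemma exp_imag: "exp (Complex 0 t) = cis t"
  by (simp add: exp_eq_polar)

lemma kernel_factor_imag:
  "kernel_factor e (Complex 0 t) = of_real (2 * (if e = 0 then cos (t / 2) else 1)) * cis (t / 2)"
proof -
  have half: "Complex 0 t / 2 = Complex 0 (t / 2)" by (simp add: complex_eq_iff)
  have "1 + cis t = 2 * of_real (cos (t / 2)) * cis (t / 2)"
    using cos_double_cos[of "t / 2"] sin_double[of "t / 2"]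
    by (simp add: complex_eq_iff power2_eq_square)
  then show ?thesis by (simp add: kernel_factor_def half exp_imag)
qed

text \<open>\<open>kernel_factor\<close> carries the phase y/2 in both parities, and the end parity
  subtracts e' y/2; for e' = 1 no phase is left. The remaining factors, apart from the quotient,
  become real.\<close>

lemma torus_kernel_imag:
  assumes "e' \<le> 1"
  shows "torus_kernel k e e' n (imag_pt y) = of_real (2 ^ k * (\<Prod>i<k. if e = 0 then cos (y i / 2) else 1)
     * (\<Prod>m<k. \<Prod>j<m. (2 * sin ((y m - y j) / 2))\<^sup>2))
     * (cis ((1 - real e') / 2 * (\<Sum>i<k. y i)) * alternant_quotient k e n (\<lambda>l. of_real (2 * cos (y l) - 2)))"
proof -
  have 1: "kernel_factor e (imag_pt y i) * exp (- (of_nat e' / 2) * imag_pt y i)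
      = of_real (2 * (if e = 0 then cos (y i / 2) else 1)) * cis ((1 - real e') / 2 * y i)" for i
  proof -
    have "- (of_nat e' / 2) * imag_pt y i = Complex 0 (- (real e' / 2) * y i)"
      by (simp add: complex_eq_iff)
    then have "exp (- (of_nat e' / 2) * imag_pt y i) = cis (- (real e' / 2) * y i)" by (simp only: exp_imag)
    moreover have "cis (y i / 2) * cis (- (real e' / 2) * y i) = cis ((1 - real e') / 2 * y i)"
      unfolding cis_mult by (rule arg_cong[where f = cis]) (simp add: field_simps)
    ultimately show ?thesis unfolding kernel_factor_imag by (simp add: mult.assoc)
  qed
  have 2: "- (exp ((imag_pt y m - imag_pt y j) / 2) - exp (- (imag_pt y m - imag_pt y j) / 2))\<^sup>2
      = of_real ((2 * sin ((y m - y j) / 2))\<^sup>2)" for m j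
  proof -
    define t where "t = (y m - y j) / 2"
    have a: "(imag_pt y m - imag_pt y j) / 2 = Complex 0 t"
      by (simp add: complex_eq_iff t_def)
    have "- (imag_pt y m - imag_pt y j) / 2 = - ((imag_pt y m - imag_pt y j) / 2)"
      by (rule minus_divide_left[symmetric])
    also have "\<dots> = Complex 0 (- t)" unfolding a by (simp add: complex_eq_iff)
    finally have b: "- (imag_pt y m - imag_pt y j) / 2 = Complex 0 (- t)" .
    have "- (cis t - cis (- t))\<^sup>2 = of_real ((2 * sin t)\<^sup>2)"
      by (simp add: complex_eq_iff power2_eq_square)
    then show ?thesis unfolding a b by (simp add: exp_imag t_def)
  qed
  have 3: "cosh_var (imag_pt y l) = of_real (2 * cos (y l) - 2)" for l
  proof -
    have "- imag_pt y l = Complex 0 (- y l)" by (simp add: complex_eq_iff)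
    then show ?thesis unfolding cosh_var_def by (simp only: exp_imag) (simp add: complex_eq_iff)
  qed
  have 4: "(\<Prod>i<k. cis (c * y i)) = cis (c * (\<Sum>i<k. y i))" for c
    by (induction k) (simp_all add: cis_mult distrib_left)
  have "(\<Prod>i<k. of_real (2 * (if e = 0 then cos (y i / 2) else 1)) * cis ((1 - real e') / 2 * y i))
     = of_real (2 ^ k * (\<Prod>i<k. if e = 0 then cos (y i / 2) else 1)) * cis ((1 - real e') / 2 * (\<Sum>i<k. y i))"
    unfolding prod.distrib 4 of_real_prod[symmetric] by simp
  then show ?thesis
    unfolding torus_kernel_def 1 2 3 of_real_prod[symmetric] by (simp add: mult_ac)
qed

lemma det_of_real:
  "Determinant.det (Matrix.mat k k (\<lambda>(i, j). of_real (f i j) :: complex)) = of_real (Determinant.det (Matrix.mat k k (\<lambda>(i, j). f i j)))"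
proof -
  have "Determinant.det (Matrix.mat k k (\<lambda>(i, j). of_real (f i j) :: complex))
    = (\<Sum>p | p permutes {..<k}. of_int (sign p) * (\<Prod>i<k. of_real (f i (p i))))"
    by (rule leibniz_det[symmetric])
  also have "\<dots> = of_real (\<Sum>p | p permutes {..<k}. of_int (sign p) * (\<Prod>i<k. f i (p i)))"
    by simp
  also have "(\<Sum>p | p permutes {..<k}. of_int (sign p) * (\<Prod>i<k. f i (p i))) = Determinant.det (Matrix.mat k k (\<lambda>(i, j). f i j))"
    by (rule leibniz_det)
  finally show ?thesis .
qed

text \<open>At the origin the divided differences are Taylor coefficients, and the \<open>i\<close>-th one is \<open>b\<close> times a
  monic polynomial of degree \<open>i\<close> in \<open>b\<^sup>2\<close> divided by \<open>(2i+1)!\<close>.\<close>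

lemma alternant_quotient_0:
  assumes e: "e \<le> 1" and b: "\<And>j. j < k \<Longrightarrow> b j = real (n j) - real e / 2"
  shows "alternant_quotient k e n (\<lambda>_. 0) = of_real ((\<Prod>j<k. b j / fact (2 * j + 1)) * vandermonde k (\<lambda>j. (b j)\<^sup>2))"
proof -
  define q where "q i = (\<Prod>l = 1..i. [:- (real l - real e / 2)\<^sup>2, 1:])" for i
  have deg: "degree (q i) = i" for i
    unfolding q_def by (subst degree_prod_eq_sum_degree) auto
  have lead: "coeff (q i) i = 1" for i
    using lead_coeff_prod[of "\<lambda>l. [:- (real l - real e / 2)\<^sup>2, 1:]" "{1..i}"] deg[of i] by (simp add: q_def)
  have cf: "central_factorial e i x = x / fact (2 * i + 1) * poly (q i) (x\<^sup>2)" for i x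
    by (simp add: central_factorial_def q_def poly_prod)
  have "alternant_quotient k e n (\<lambda>_. 0) = Determinant.det (Matrix.mat k k (\<lambda>(i, j). of_real (central_factorial e i (b j)) :: complex))"
    unfolding alternant_quotient_def by (intro arg_cong[where f = Determinant.det] eq_matI) (simp_all add: divided_diff_0 coeff_sinh_poly[OF e] b)
  also have "\<dots> = of_real (Determinant.det (Matrix.mat k k (\<lambda>(i, j). central_factorial e i (b j))))"
    by (rule det_of_real)
  \<comment> \<open>After transposition and up to row and column factors the entries are values of
    monic polynomials of degree j at the squares of the b_i, as
    \<open>det_poly_eval_triangular\<close> requires.\<close>
  also have "Determinant.det (Matrix.mat k k (\<lambda>(i, j). central_factorial e i (b j)))
     = Determinant.det (Matrix.mat k k (\<lambda>(i, j). central_factorial e j (b i)))"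
  proof -
    have "Matrix.mat k k (\<lambda>(i, j). central_factorial e i (b j)) = transpose_mat (Matrix.mat k k (\<lambda>(i, j). central_factorial e j (b i)))"
      by (rule eq_matI) auto
    then show ?thesis by (simp only: Determinant.det_transpose[OF mat_carrier])
  qed
  also have "\<dots> = (\<Sum>p | p permutes {..<k}. of_int (sign p) * (\<Prod>i<k. central_factorial e (p i) (b i)))"
    by (rule leibniz_det[symmetric])
  also have "\<dots> = (\<Sum>p | p permutes {..<k}. (\<Prod>j<k. b j / fact (2 * j + 1)) * (of_int (sign p) * (\<Prod>i<k. poly (q (p i)) ((b i)\<^sup>2))))"
  proof (intro sum.cong refl)
    fix p assume "p \<in> {p. p permutes {..<k}}"
    then have p: "p permutes {..<k}" by simp
    have "(\<Prod>i<k. fact (2 * p i + 1)) = (\<Prod>j<k. fact (2 * j + 1) :: real)"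
      using prod.permute[OF p, of "\<lambda>j. fact (2 * j + 1) :: real"] by (simp add: comp_def)
    then show "of_int (sign p) * (\<Prod>i<k. central_factorial e (p i) (b i))
      = (\<Prod>j<k. b j / fact (2 * j + 1)) * (of_int (sign p) * (\<Prod>i<k. poly (q (p i)) ((b i)\<^sup>2)))"
      unfolding cf prod.distrib prod_dividef by simp
  qed
  also have "\<dots> = (\<Prod>j<k. b j / fact (2 * j + 1)) * Determinant.det (Matrix.mat k k (\<lambda>(i, j). poly (q j) ((b i)\<^sup>2)))"
    unfolding sum_distrib_left[symmetric] by (intro arg_cong2[where f = "(*)"] leibniz_det refl)
  also have "Determinant.det (Matrix.mat k k (\<lambda>(i, j). poly (q j) ((b i)\<^sup>2))) = vandermonde k (\<lambda>j. (b j)\<^sup>2)"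
    using det_poly_eval_triangular[of k q "\<lambda>j. (b j)\<^sup>2"] deg lead by simp
  finally show ?thesis .
qed

abbreviation in_box :: "nat \<Rightarrow> (nat \<Rightarrow> real) \<Rightarrow> bool" where
  "in_box k y \<equiv> \<forall>i<k. y i \<in> {- (pi / 2)..3 * pi / 2}"

lemma sum_norm_cosh_var_le: "(\<Sum>l<k. norm (of_real (2 * cos (y l) - 2) :: complex)) \<le> norm_sq k y"
  unfolding norm_sq_def
proof (intro sum_mono)
  fix l
  have "norm (of_real (2 * cos (y l) - 2) :: complex) = 2 * (1 - cos (y l))"
    unfolding norm_of_real by simp
  moreover have "2 * (1 - cos (y l)) \<le> (y l)\<^sup>2"
    using mult_left_mono[OF cos_bounds(2)[of "y l"], of 2] by simp
  ultimately show "norm (of_real (2 * cos (y l) - 2) :: complex) \<le> (y l)\<^sup>2"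
    by (simp only:)
qed

lemma norm_cosh_var_le: "norm (of_real (2 * cos t - 2) :: complex) \<le> 4"
  unfolding norm_of_real using cos_ge_minus_one[of t] cos_le_one[of t] by linarith

lemma vandermonde_sin_bounds:
  fixes k :: nat and y :: "nat \<Rightarrow> real"
  defines "S \<equiv> (\<Prod>m<k. \<Prod>j<m. (2 * sin ((y m - y j) / 2))\<^sup>2)"
  shows "0 \<le> S" "S \<le> (vandermonde k y)\<^sup>2" "(vandermonde k y)\<^sup>2 - S \<le> real (k * k) * (norm_sq k y / 6) * (vandermonde k y)\<^sup>2"
proof -
  have V: "(vandermonde k y)\<^sup>2 = (\<Prod>m<k. \<Prod>j<m. (y m - y j)\<^sup>2)"
    by (simp add: vandermonde_def prod_power_distrib[symmetric])
  have le: "(2 * sin ((y m - y j) / 2))\<^sup>2 \<le> (y m - y j)\<^sup>2" for m j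
    using sin_sq_bounds(1)[of "(y m - y j) / 2"] by (simp add: power_divide)
  show "0 \<le> S" unfolding S_def by (intro prod_nonneg) auto
  show "S \<le> (vandermonde k y)\<^sup>2" unfolding S_def V using le by (intro prod_mono conjI prod_nonneg ballI) auto
  show "(vandermonde k y)\<^sup>2 - S \<le> real (k * k) * (norm_sq k y / 6) * (vandermonde k y)\<^sup>2"
    unfolding S_def V
  proof (rule prod_diff_le_double)
    fix m j :: nat assume jm: "j < m" "m < k"
    have "(y m)\<^sup>2 + (y j)\<^sup>2 = (\<Sum>i\<in>{m, j}. (y i)\<^sup>2)" using jm by simp
    also have "\<dots> \<le> norm_sq k y" unfolding norm_sq_def using jm by (intro sum_mono2) auto
    finally have "(y m)\<^sup>2 + (y j)\<^sup>2 \<le> norm_sq k y" .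
    moreover have "(y m - y j)\<^sup>2 \<le> 2 * ((y m)\<^sup>2 + (y j)\<^sup>2)"
      using zero_le_power2[of "y m + y j"] by (simp add: power2_eq_square algebra_simps)
    ultimately have "(y m - y j)\<^sup>2 \<le> 2 * norm_sq k y" by (meson mult_left_mono order_trans zero_le_numeral)
    then have "(y m - y j)\<^sup>2 * (1 - norm_sq k y / 6) \<le> (y m - y j)\<^sup>2 * (1 - (y m - y j)\<^sup>2 / 12)"
      by (intro mult_left_mono) auto
    also have "\<dots> \<le> (2 * sin ((y m - y j) / 2))\<^sup>2"
      using sin_sq_bounds(2)[of "(y m - y j) / 2"] by (simp add: power_divide)
    finally show "0 \<le> (2 * sin ((y m - y j) / 2))\<^sup>2 \<and> (2 * sin ((y m - y j) / 2))\<^sup>2 \<le> (y m - y j)\<^sup>2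
      \<and> (y m - y j)\<^sup>2 * (1 - norm_sq k y / 6) \<le> (2 * sin ((y m - y j) / 2))\<^sup>2"
      using le by simp
  qed simp
qed

lemma abs_one_minus_prod_le:
  assumes "\<And>i. i < k \<Longrightarrow> \<bar>f i\<bar> \<le> 1 \<and> \<bar>1 - f i\<bar> \<le> g i"
  shows "\<bar>1 - (\<Prod>i<k. f i)\<bar> \<le> (\<Sum>i<k. g i :: real)"
proof -
  have "norm ((\<Prod>i<k. 1) - (\<Prod>i<k. f i)) \<le> (\<Sum>i<k. norm (1 - f i))"
    using assms by (intro norm_prod_diff) auto
  also have "\<dots> \<le> (\<Sum>i<k. g i)" using assms by (intro sum_mono) auto
  finally show ?thesis by simp
qed

text \<open>Four factors deviate from their model: the cosines from 1, the chords from the angle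
  differences, the phase from 1 and the quotient from its value at 0. Each deviation is
  O(\<open>norm_sq\<close>): in the real part the phase enters as 1 - cos \<theta>, and the nodes 2
  cos y - 2 of the quotient are themselves quadratic in y. All factors are bounded, so no smallness
  of y is required.\<close>

lemma torus_kernel_near_0:
  assumes e: "e \<le> 1" and q0: "alternant_quotient k e n (\<lambda>_. 0) = of_real q0"
  shows "\<exists>C\<ge>0. \<forall>y e'. e' \<le> 1 \<longrightarrow>
    \<bar>Re (torus_kernel k e e' n (imag_pt y)) - 2 ^ k * q0 * (vandermonde k y)\<^sup>2\<bar> \<le> C * ((vandermonde k y)\<^sup>2 * norm_sq k y)"
proof -
  obtain L where L: "L \<ge> 0" and Lip: "\<And>s. (\<forall>i<k. norm (s i) \<le> 4) \<Longrightarrow> norm (alternant_quotient k e n s - alternant_quotient k e n (\<lambda>_. 0)) \<le> L * (\<Sum>i<k. norm (s i))"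
    using mpoly_fun_lipschitz[OF mpoly_fun_alternant_quotient, of 4 k e n] by auto
  define C where "C = 2 ^ k * ((L + \<bar>q0\<bar> * real k / 8) + \<bar>q0\<bar> / 8 + \<bar>q0\<bar> * real (k * k) / 6)"
  have "\<bar>Re (torus_kernel k e e' n (imag_pt y)) - 2 ^ k * q0 * (vandermonde k y)\<^sup>2\<bar> \<le> C * ((vandermonde k y)\<^sup>2 * norm_sq k y)"
    if e': "e' \<le> 1" for y e'
  proof -
    define A where "A = (\<Prod>i<k. if e = 0 then cos (y i / 2) else 1)"
    define S where "S = (\<Prod>m<k. \<Prod>j<m. (2 * sin ((y m - y j) / 2))\<^sup>2)"
    define \<theta> where "\<theta> = (1 - real e') / 2 * (\<Sum>i<k. y i)"
    define Q where "Q = alternant_quotient k e n (\<lambda>l. of_real (2 * cos (y l) - 2))"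
    define R where "R = Re (cis \<theta> * Q)"
    define V where "V = (vandermonde k y)\<^sup>2"
    define N where "N = norm_sq k y"
    have N: "N \<ge> 0" and V: "V \<ge> 0" by (auto simp: N_def V_def)
    have Re_mult: "Re (of_real c * z) = c * Re z" for c z by simp
    have K: "Re (torus_kernel k e e' n (imag_pt y)) = 2 ^ k * A * S * R"
      unfolding torus_kernel_imag[OF e'] A_def S_def R_def Q_def \<theta>_def by (simp only: Re_mult)
    have S: "0 \<le> S" "S \<le> V" "V - S \<le> real (k * k) * (N / 6) * V"
      using vandermonde_sin_bounds[where k = k and y = y] by (auto simp: S_def V_def N_def)
    have A1: "\<bar>A\<bar> \<le> 1"
      unfolding A_def abs_prod by (intro prod_le_1) auto
    have A2: "\<bar>1 - A\<bar> \<le> N / 8"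
    proof -
      have "\<bar>1 - A\<bar> \<le> (\<Sum>i<k. (y i)\<^sup>2 / 8)"
        unfolding A_def
      proof (rule abs_one_minus_prod_le)
        fix i
        have "1 - cos (y i / 2) \<le> (y i)\<^sup>2 / 8"
          using cos_bounds(2)[of "y i / 2"] by (simp add: power_divide)
        then have "\<bar>1 - cos (y i / 2)\<bar> \<le> (y i)\<^sup>2 / 8"
          using cos_le_one[of "y i / 2"] by (simp only: abs_of_nonneg diff_ge_0_iff_ge)
        then show "\<bar>if e = 0 then cos (y i / 2) else 1\<bar> \<le> 1 \<and> \<bar>1 - (if e = 0 then cos (y i / 2) else 1)\<bar> \<le> (y i)\<^sup>2 / 8"
          by (auto simp: abs_if)
      qed
      then show ?thesis by (simp add: N_def norm_sq_def sum_divide_distrib)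
    qed
    have \<theta>: "1 - cos \<theta> \<le> real k * N / 8"
    proof -
      have "\<bar>(1 - real e') / 2\<bar> \<le> 1 / 2" using e' by (cases e') auto
      then have "((1 - real e') / 2)\<^sup>2 \<le> (1 / 2)\<^sup>2" by (metis abs_le_square_iff abs_of_nonneg zero_le_divide_1_iff zero_le_numeral)
      then have "\<theta>\<^sup>2 \<le> (1 / 2)\<^sup>2 * (\<Sum>i<k. y i)\<^sup>2"
        unfolding \<theta>_def power_mult_distrib by (intro mult_right_mono) auto
      also have "\<dots> \<le> (1 / 2)\<^sup>2 * (N * real k)"
        using sum_squared_le_sum_of_squares[of y "{..<k}"] by (intro mult_left_mono) (auto simp: N_def norm_sq_def)
      finally have "\<theta>\<^sup>2 \<le> N * real k / 4" by (simp add: power2_eq_square)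
      then show ?thesis using cos_bounds(2)[of \<theta>] by (simp add: mult.commute)
    qed
    have s4: "\<forall>i<k. norm (of_real (2 * cos (y i) - 2) :: complex) \<le> 4" using norm_cosh_var_le by blast
    have R2: "\<bar>R - q0\<bar> \<le> (L + \<bar>q0\<bar> * real k / 8) * N"
    proof -
      have "R - q0 = Re (cis \<theta> * (Q - of_real q0)) + q0 * (cos \<theta> - 1)"
        by (simp add: R_def algebra_simps)
      also have "\<bar>\<dots>\<bar> \<le> norm (cis \<theta> * (Q - of_real q0)) + \<bar>q0\<bar> * \<bar>cos \<theta> - 1\<bar>"
        by (intro order_trans[OF abs_triangle_ineq] add_mono abs_Re_le_cmod) (simp add: abs_mult)
      also have "\<dots> \<le> L * N + \<bar>q0\<bar> * (real k * N / 8)"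
      proof (intro add_mono mult_left_mono)
        have "norm (Q - of_real q0) \<le> L * (\<Sum>l<k. norm (of_real (2 * cos (y l) - 2) :: complex))"
          using Lip[OF s4] by (simp add: Q_def q0)
        also have "\<dots> \<le> L * N" unfolding N_def using L by (intro mult_left_mono sum_norm_cosh_var_le)
        finally show "norm (cis \<theta> * (Q - of_real q0)) \<le> L * N" by (simp add: norm_mult)
        show "\<bar>cos \<theta> - 1\<bar> \<le> real k * N / 8" using \<theta> cos_le_one[of \<theta>] by linarith
      qed auto
      finally show ?thesis by (simp add: algebra_simps)
    qed
    have "2 ^ k * A * S * R - 2 ^ k * q0 * V = 2 ^ k * (A * S * (R - q0) + q0 * (A - 1) * S - q0 * (V - S))"
      by (simp add: algebra_simps)
    then have "\<bar>2 ^ k * A * S * R - 2 ^ k * q0 * V\<bar> = 2 ^ k * \<bar>A * S * (R - q0) + q0 * (A - 1) * S - q0 * (V - S)\<bar>"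
      by (simp add: abs_mult)
    also have "\<dots> \<le> 2 ^ k * (\<bar>A * S * (R - q0)\<bar> + \<bar>q0 * (A - 1) * S\<bar> + \<bar>q0 * (V - S)\<bar>)"
      by (intro mult_left_mono) auto
    also have "\<dots> \<le> 2 ^ k * (1 * V * ((L + \<bar>q0\<bar> * real k / 8) * N) + \<bar>q0\<bar> * (N / 8) * V + \<bar>q0\<bar> * (real (k * k) * (N / 6) * V))"
      unfolding abs_mult using A1 A2 S R2 N V
      by (intro mult_left_mono add_mono mult_mono mult_nonneg_nonneg) auto
    also have "\<dots> = C * (V * N)"
      by (simp add: C_def algebra_simps)
    finally show ?thesis unfolding K V_def N_def .
  qed
  moreover have "C \<ge> 0" unfolding C_def using L by (intro mult_nonneg_nonneg add_nonneg_nonneg) auto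
  ultimately show ?thesis by blast
qed

text \<open>Each \<open>kernel_factor\<close> with e = 0 vanishes to first order at pi. For k at
  least 2 two such factors give second order; for k = 1 the quotient is real, and the real part of
  the phase supplies a second cos(y/2).\<close>

lemma torus_kernel_near_pi:
  assumes k: "k \<ge> 1"
  shows "\<exists>C\<ge>0. \<forall>y. \<bar>Re (torus_kernel k 0 0 n (imag_pt y))\<bar> \<le> C * ((vandermonde k y)\<^sup>2 * norm_sq k (\<lambda>i. y i - pi))"
proof -
  obtain B where B: "B \<ge> 0" and bd: "\<And>s. (\<forall>i<k. norm (s i) \<le> 4) \<Longrightarrow> norm (alternant_quotient k 0 n s) \<le> B"
    using mpoly_fun_bounded[OF mpoly_fun_alternant_quotient, of 4 k 0 n] by auto
  have "\<bar>Re (torus_kernel k 0 0 n (imag_pt y))\<bar> \<le> 2 ^ k * B * ((vandermonde k y)\<^sup>2 * norm_sq k (\<lambda>i. y i - pi))" for y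
  proof -
    define c where "c i = \<bar>cos (y i / 2)\<bar>" for i
    define S where "S = (\<Prod>m<k. \<Prod>j<m. (2 * sin ((y m - y j) / 2))\<^sup>2)"
    define \<theta> where "\<theta> = (1 / 2) * (\<Sum>i<k. y i)"
    define Q where "Q = alternant_quotient k 0 n (\<lambda>l. of_real (2 * cos (y l) - 2))"
    define V where "V = (vandermonde k y)\<^sup>2"
    define N where "N = norm_sq k (\<lambda>i. y i - pi)"
    have S: "0 \<le> S" "S \<le> V" using vandermonde_sin_bounds[where k = k and y = y] by (auto simp: S_def V_def)
    have Re_mult: "Re (of_real c * z) = c * Re z" for c z by simp
    have "Re (torus_kernel k 0 0 n (imag_pt y)) = 2 ^ k * (\<Prod>i<k. cos (y i / 2)) * S * Re (cis \<theta> * Q)"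
      using torus_kernel_imag[of 0 k 0 n y] unfolding S_def Q_def \<theta>_def by (simp only: Re_mult) simp
    then have K: "\<bar>Re (torus_kernel k 0 0 n (imag_pt y))\<bar> = 2 ^ k * (\<Prod>i<k. c i) * S * \<bar>Re (cis \<theta> * Q)\<bar>"
      using S(1) by (simp only: abs_mult abs_prod c_def) simp
    have c1: "0 \<le> c i" "c i \<le> 1" for i by (auto simp: c_def)
    have c2: "c i \<le> \<bar>y i - pi\<bar>" for i
    proof -
      have "cos (y i / 2) = - sin ((y i - pi) / 2)"
        using sin_diff[of "y i / 2" "pi / 2"] by (simp add: diff_divide_distrib)
      then have "c i \<le> \<bar>(y i - pi) / 2\<bar>" using abs_sin_x_le_abs_x[of "(y i - pi) / 2"] by (simp add: c_def)
      then show ?thesis by simp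
    qed
    have s4: "\<forall>i<k. norm (of_real (2 * cos (y i) - 2) :: complex) \<le> 4" using norm_cosh_var_le by blast
    have Q: "norm Q \<le> B" unfolding Q_def by (rule bd[OF s4])
    have "(\<Prod>i<k. c i) * \<bar>Re (cis \<theta> * Q)\<bar> \<le> N * B"
    proof (cases "k = 1")
      case True
      have "divided_diff (sinh_poly 0 (n 0)) (\<lambda>l. of_real (2 * cos (y l) - 2)) 0
         = of_real (\<Sum>i\<le>degree (sinh_poly 0 (n 0)). central_factorial 0 i (real (n 0)) * (2 * cos (y 0) - 2) ^ i)"
        by (simp add: divided_diff_def poly_altdef coeff_sinh_poly)
      moreover have "Q = divided_diff (sinh_poly 0 (n 0)) (\<lambda>l. of_real (2 * cos (y l) - 2)) 0"
        unfolding Q_def alternant_quotient_def True leibniz_det[symmetric] by (simp add: permutes_sing lessThan_Suc)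
      ultimately obtain x where x: "Q = of_real x" by metis
      have "Re (cis \<theta> * Q) = cos (y 0 / 2) * x" by (simp add: x \<theta>_def True)
      then have "(\<Prod>i<k. c i) * \<bar>Re (cis \<theta> * Q)\<bar> = c 0 * c 0 * \<bar>x\<bar>"
        by (simp add: True c_def abs_mult)
      also have "\<dots> \<le> \<bar>y 0 - pi\<bar> * \<bar>y 0 - pi\<bar> * B"
        using c1 c2[of 0] Q x B by (intro mult_mono mult_nonneg_nonneg) auto
      also have "\<bar>y 0 - pi\<bar> * \<bar>y 0 - pi\<bar> = N" by (simp add: N_def norm_sq_def True power2_eq_square)
      finally show ?thesis .
    next
      case False
      then have k2: "1 < k" using k by simp
      define P where "P = (\<Prod>i\<in>{..<k} - {0} - {1}. c i)"
      have P: "0 \<le> P" "P \<le> 1" unfolding P_def using c1 by (auto intro!: prod_nonneg prod_le_1)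
      have "(\<Prod>i<k. c i) = c 0 * (\<Prod>i\<in>{..<k} - {0}. c i)"
        using k2 by (intro prod.remove) auto
      also have "(\<Prod>i\<in>{..<k} - {0}. c i) = c 1 * P"
        unfolding P_def using k2 by (intro prod.remove) auto
      also have "c 0 * (c 1 * P) \<le> \<bar>y 0 - pi\<bar> * (\<bar>y 1 - pi\<bar> * 1)"
        using c1 c2 P by (intro mult_mono mult_nonneg_nonneg) auto
      also have "\<dots> \<le> \<bar>y 0 - pi\<bar>\<^sup>2 + \<bar>y 1 - pi\<bar>\<^sup>2"
      proof -
        have "a * (b * 1) \<le> a\<^sup>2 + b\<^sup>2" if "0 \<le> a" "0 \<le> b" for a b :: real
        proof -
          have "0 \<le> a * b" using that by simp
          then show ?thesis using sum_squares_bound[of a b] by simp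
        qed
        then show ?thesis by (meson abs_ge_zero)
      qed
      also have "\<dots> = (y 0 - pi)\<^sup>2 + (y 1 - pi)\<^sup>2" by simp
      also have "\<dots> = (\<Sum>i\<in>{0, 1}. (y i - pi)\<^sup>2)" by simp
      also have "\<dots> \<le> N" unfolding N_def norm_sq_def using k2 by (intro sum_mono2) auto
      finally have "(\<Prod>i<k. c i) \<le> N" .
      moreover have "\<bar>Re (cis \<theta> * Q)\<bar> \<le> B"
        using abs_Re_le_cmod[of "cis \<theta> * Q"] Q by (simp add: norm_mult)
      ultimately show ?thesis using c1 B by (intro mult_mono) (auto simp: N_def)
    qed
    note H = this
    have "2 ^ k * S * ((\<Prod>i<k. c i) * \<bar>Re (cis \<theta> * Q)\<bar>) \<le> 2 ^ k * V * (N * B)"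
    proof (rule mult_mono[OF _ H])
      show "2 ^ k * S \<le> 2 ^ k * V" using S(2) by simp
      show "0 \<le> 2 ^ k * V" by (simp add: V_def)
      show "0 \<le> (\<Prod>i<k. c i) * \<bar>Re (cis \<theta> * Q)\<bar>" using c1(1) by (intro mult_nonneg_nonneg prod_nonneg) auto
    qed
    then show ?thesis unfolding K V_def N_def by (simp add: mult_ac)
  qed
  then show ?thesis using B by (intro exI[of _ "2 ^ k * B"]) auto
qed

section \<open>Laplace asymptotics\<close>

text \<open>The upper bound for exp(- t) holds because 1 - t + t^2 times the quadratic Taylor
  minorant of exp t is at least 1.\<close>

lemma exp_minus_taylor: "0 \<le> (t::real) \<Longrightarrow> \<bar>1 - t - exp (- t)\<bar> \<le> t\<^sup>2"
proof -
  assume t: "0 \<le> t"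
  have "1 \<le> (1 - t + t\<^sup>2) * (1 + t + t\<^sup>2 / 2)"
  proof -
    have "(1 - t + t\<^sup>2) * (1 + t + t\<^sup>2 / 2) = 1 + t\<^sup>2 / 2 + t ^ 3 / 2 + t ^ 4 / 2"
      by (simp add: field_simps eval_nat_numeral)
    moreover have "0 \<le> t\<^sup>2 / 2" "0 \<le> t ^ 3 / 2" "0 \<le> t ^ 4 / 2" using t by auto
    ultimately show ?thesis by linarith
  qed
  also have "\<dots> \<le> (1 - t + t\<^sup>2) * exp t"
  proof (rule mult_left_mono[OF exp_lower_Taylor_quadratic[OF t]])
    have "1 - t + t\<^sup>2 = (t - 1 / 2)\<^sup>2 + 3 / 4" by (simp add: power2_eq_square field_simps)
    then show "0 \<le> 1 - t + t\<^sup>2" by simp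
  qed
  finally have "exp (- t) \<le> 1 - t + t\<^sup>2" by (simp add: exp_minus field_simps)
  moreover have "1 - t \<le> exp (- t)" using exp_ge_add_one_self[of "- t"] by simp
  ultimately show ?thesis by linarith
qed

lemma abs_poly_le:
  fixes p :: "real poly"
  assumes "\<And>i. coeff p i \<ge> 0"
  shows "\<bar>poly p x\<bar> \<le> poly p \<bar>x\<bar>"
  unfolding poly_altdef using assms
  by (intro order_trans[OF sum_abs] sum_mono) (auto simp: abs_mult power_abs)

text \<open>\<open>phi\<close> is the symbol on the torus divided by the number of steps, and
  \<open>al\<close> is the variance of one coordinate of a uniformly chosen step, in units of
  \<open>d\<close>.\<close>

locale weyl_walk_asymp = weyl_walk +
  fixes phi :: "(nat \<Rightarrow> real) \<Rightarrow> real" and al C0 :: real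
  assumes A_ne: "A \<noteq> {}"
    and adm_le: "adm m b e \<Longrightarrow> e \<le> 1"
    and symbol_imag: "walk_symbol k A d (imag_pt y) = of_real (real (card A) * phi y)"
    and al: "al > 0" and C0: "C0 \<ge> 0"
    and phi_taylor: "\<bar>phi y - (1 - al * norm_sq k y / 2)\<bar> \<le> C0 * (norm_sq k y)\<^sup>2"
begin

text \<open>The end parity \<open>eps m\<close> varies with m, so the kernel has to stay inside the
  sum over m. The counts of walks are real, which justifies taking real parts.\<close>

lemma poly_walk_integral:
  fixes p :: "real poly"
  assumes u: "u \<in> chamber k" and e: "e \<le> 1" and n: "\<And>j. j < k \<Longrightarrow> coords u j = real (n j) - real e / 2"
    and adm: "\<And>m. adm m (coords u) (eps m)"
  defines "F \<equiv> \<lambda>y. \<Sum>m\<le>degree p. coeff p m * ((real (card A) * phi y) ^ m * Re (torus_kernel k e (eps m) n (imag_pt y)))"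
  shows "integrable (torus {..<k}) F"
    and "(\<integral>y. F y \<partial>torus {..<k}) = poly_walk k A p u * fact k"
proof -
  define f where "f m y = walk_symbol k A d (imag_pt y) ^ m * torus_kernel k e (eps m) n (imag_pt y)" for m y
  have Re0: "\<bar>Re (imag_pt y i)\<bar> \<le> 0" for y i by simp
  have int: "integrable (torus {..<k}) (f m)" for m
    unfolding f_def[abs_def]
    by (intro integrable_bdd_fun bdd_fun_mult bdd_fun_power bdd_fun_walk_symbol[OF Re0] bdd_fun_torus_kernel[OF Re0]
        borel_measurable_times borel_measurable_power walk_symbol_measurable torus_kernel_measurable) (auto intro!: measurable_Complex)
  have Re: "Re (f m y) = (real (card A) * phi y) ^ m * Re (torus_kernel k e (eps m) n (imag_pt y))" for m y
  proof -
    have "Re (of_real c * z) = c * Re z" for c z by simp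
    then show ?thesis unfolding f_def symbol_imag of_real_power[symmetric] by simp
  qed
  have val: "(\<integral>y. Re (f m y) \<partial>torus {..<k}) = walk_count k A m u * fact k" for m
  proof -
    have "(\<integral>y. Re (f m y) \<partial>torus {..<k}) = Re (\<integral>y. f m y \<partial>torus {..<k})"
      by (rule integral_Re[OF int])
    also have "\<dots> = Re (of_real (walk_count k A m u * fact k))"
      unfolding f_def using walk_count_integral[OF adm u e n] by simp
    finally show ?thesis by simp
  qed
  have intRe: "integrable (torus {..<k}) (\<lambda>y. Re (f m y))" for m
    using int[of m] by (rule integrable_Re)
  show "integrable (torus {..<k}) F"
    unfolding F_def Re[symmetric] by (intro Bochner_Integration.integrable_sum integrable_mult_right intRe)
  show "(\<integral>y. F y \<partial>torus {..<k}) = poly_walk k A p u * fact k"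
    unfolding F_def Re[symmetric] poly_walk_def sum_distrib_right
    by (subst Bochner_Integration.integral_sum) (auto intro: intRe simp: val mult.assoc)
qed

text \<open>The second alternative of \<open>decay\<close> admits a further maximum of |phi| at (pi,
  ..., pi), but only when both parities are 0, the case covered by
  \<open>torus_kernel_near_pi\<close>.\<close>

theorem poly_walk_asymptotics:
  fixes P :: "real poly"
  assumes u: "u \<in> chamber k" and e: "e \<le> 1" and n: "\<And>j. j < k \<Longrightarrow> coords u j = real (n j) - real e / 2"
    and adm: "\<And>m. adm m (coords u) (eps m)" and c0: "c0 > 0"
    and decay: "\<And>y. in_box k y \<Longrightarrow> \<bar>phi y\<bar> \<le> 1 - c0 * norm_sq k y
      \<or> (e = 0 \<and> (\<forall>m. eps m = 0) \<and> 1 \<le> norm_sq k y \<and> \<bar>phi y\<bar> \<le> 1 - c0 * norm_sq k (\<lambda>i. y i - pi))"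
    and P: "\<And>i. coeff P i \<ge> 0" and m0: "m0 \<ge> 1" "coeff P m0 > 0"
  defines "q0 \<equiv> (\<Prod>j<k. coords u j / fact (2 * j + 1)) * vandermonde k (\<lambda>j. (coords u j)\<^sup>2)"
  defines "a \<equiv> real (card A) * poly (pderiv P) (card A) / poly P (card A) * al"
  shows "a > 0" and "\<exists>D. \<forall>N\<ge>1. \<bar>poly_walk k A (P ^ N) u / poly P (card A) ^ N
      - 2 ^ k * q0 * (1 / (2 * pi)) ^ k * (sqrt (2 * pi) ^ k * (\<Prod>j<k. fact j)) * (1 / (a * real N)) powr (real (k\<^sup>2) / 2)\<bar>
    \<le> D * (1 / real N) powr (real (k\<^sup>2) / 2 + 1)"
proof -
  define r where "r = real (card A)"
  have r: "r > 0" using A_ne finA by (simp add: r_def card_gt_0_iff)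
  define ph where "ph x = poly P (r * x) / poly P r" for x
  define \<mu> where "\<mu> = r * poly (pderiv P) r / poly P r"
  note pgf = pgf_estimates[OF P r m0]
  have Pr: "poly P r > 0" by (rule pgf(1))
  obtain \<kappa> where \<kappa>: "\<kappa> > 0" and ph_exp: "\<And>x. 0 \<le> x \<Longrightarrow> x \<le> 1 \<Longrightarrow> 0 \<le> ph x \<and> ph x \<le> exp (- (\<kappa> * (1 - x)))"
    using pgf(2) unfolding ph_def by blast
  obtain C2 where C2: "C2 \<ge> 0" and ph_taylor: "\<And>x. \<bar>x\<bar> \<le> 1 \<Longrightarrow> \<bar>ph x - (1 - \<mu> * (1 - x))\<bar> \<le> C2 * (1 - x)\<^sup>2"
    using pgf(3) unfolding ph_def \<mu>_def by blast
  have \<mu>: "\<mu> > 0" unfolding \<mu>_def using r Pr pgf(4) by simp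
  have a_eq: "a = \<mu> * al" by (simp add: a_def \<mu>_def r_def)
  show a: "a > 0" using \<mu> al by (simp add: a_eq)
  have q0: "alternant_quotient k e n (\<lambda>_. 0) = of_real q0"
    unfolding q0_def by (rule alternant_quotient_0[OF e]) (rule n)
  obtain K1 where K1: "K1 \<ge> 0" and near0: "\<And>y e'. e' \<le> 1 \<Longrightarrow>
      \<bar>Re (torus_kernel k e e' n (imag_pt y)) - 2 ^ k * q0 * (vandermonde k y)\<^sup>2\<bar> \<le> K1 * ((vandermonde k y)\<^sup>2 * norm_sq k y)"
    using torus_kernel_near_0[OF e q0] by blast
  obtain K2 where K2: "K2 \<ge> 0" and nearpi: "\<And>y. \<bar>Re (torus_kernel k 0 0 n (imag_pt y))\<bar> \<le> K2 * ((vandermonde k y)\<^sup>2 * norm_sq k (\<lambda>i. y i - pi))"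
    using torus_kernel_near_pi[OF k] by blast
  have eps: "eps m \<le> 1" for m using adm_le[OF adm] .
  define g where "g = 2 ^ k * q0"
  \<comment> \<open>The common rate of all error weights: neither faster than the decay of ph(|phi|)
    given by \<kappa> and c0, nor faster than the limiting Gaussian.\<close>
  define c where "c = min (\<kappa> * c0) (a / 2)"
  have c: "c > 0" "c \<le> a / 2" "c \<le> \<kappa> * c0" using \<kappa> c0 a by (auto simp: c_def)
  \<comment> \<open>Chosen so that 1 - phi is at most L |y|^2 wherever |y|^2 is at most 1/c0: there
    the quartic Taylor error of phi is at most C0/c0 times |y|^2.\<close>
  define L where "L = al / 2 + C0 / c0"
  define C3 where "C3 = C2 * L\<^sup>2 + \<mu> * C0 + (a / 2)\<^sup>2"
  have L: "L \<ge> 0" using al C0 c0 by (simp add: L_def)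
  have C3: "C3 \<ge> 0" unfolding C3_def using C2 \<mu> C0 by (intro add_nonneg_nonneg mult_nonneg_nonneg) auto
  define C where "C = K1 + K2 + \<bar>g\<bar> + \<bar>g\<bar> * C3 * exp (c / c0)"
  have C: "C \<ge> 0" unfolding C_def using K1 K2 C3 by (intro add_nonneg_nonneg mult_nonneg_nonneg) auto
  \<comment> \<open>The distribution of the total number of atomic steps in N composite steps, with
    generating function ph^N. As these weights are nonnegative, a kernel error uniform in m sums up
    to that error times ph(|x|)^N.\<close>
  define wt where "wt N m = coeff (P ^ N) m * r ^ m / poly P r ^ N" for N m
  have wt: "wt N m \<ge> 0" for N m
    unfolding wt_def using coeff_power_nonneg[OF P] r Pr by (intro divide_nonneg_pos mult_nonneg_nonneg) auto
  have wt_sum: "(\<Sum>m\<le>degree (P ^ N). wt N m * x ^ m) = ph x ^ N" for N x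
  proof -
    have "ph x ^ N = poly (P ^ N) (r * x) / poly P r ^ N" by (simp add: ph_def power_divide poly_power)
    also have "poly (P ^ N) (r * x) = (\<Sum>m\<le>degree (P ^ N). coeff (P ^ N) m * (r * x) ^ m)" by (rule poly_altdef)
    finally show ?thesis by (simp add: wt_def sum_divide_distrib power_mult_distrib mult_ac)
  qed
  have ph_abs: "\<bar>ph x\<bar> \<le> ph \<bar>x\<bar>" for x
    unfolding ph_def using abs_poly_le[OF P, of "r * x"] r Pr by (simp add: abs_mult divide_right_mono)
  define F where "F N y = (\<Sum>m\<le>degree (P ^ N). wt N m * (phi y ^ m * Re (torus_kernel k e (eps m) n (imag_pt y))))" for N y
  have F_eq: "F N y = (1 / poly P r ^ N) * (\<Sum>m\<le>degree (P ^ N). coeff (P ^ N) m * ((real (card A) * phi y) ^ m * Re (torus_kernel k e (eps m) n (imag_pt y))))" for N y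
    unfolding F_def wt_def r_def sum_distrib_left by (intro sum.cong refl) (simp add: power_mult_distrib mult_ac)
  have intF: "integrable (torus {..<k}) (F N)" for N
    unfolding F_eq[abs_def] by (intro integrable_mult_right poly_walk_integral(1)[OF u e n adm])
  have valF: "(\<integral>y. F N y \<partial>torus {..<k}) = poly_walk k A (P ^ N) u * fact k / poly P r ^ N" for N
    unfolding F_eq[abs_def] by (subst integral_mult_right_zero) (simp add: poly_walk_integral(2)[OF u e n adm])
  have bound: "\<bar>F N y - g * gauss_weight k 0 (a / 2 * real N) y\<bar>
      \<le> C * (gauss_weight k 1 (c * real N) y + real N * gauss_weight k 2 (c * real N) y
             + gauss_weight k 1 (c * real N) (\<lambda>i\<in>{..<k}. - pi + 1 * y i))"
    if N: "N \<ge> 1" and y: "in_box k y" for N y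
  proof -
    define V where "V = (vandermonde k y)\<^sup>2"
    define Q where "Q = norm_sq k y"
    define Q' where "Q' = norm_sq k (\<lambda>i. y i - pi)"
    define x where "x = phi y"
    define E where "E = exp (- (a / 2 * Q))"
    have V: "V \<ge> 0" and Q: "Q \<ge> 0" and Q': "Q' \<ge> 0" by (auto simp: V_def Q_def Q'_def)
    have EN: "gauss_weight k 0 (a / 2 * real N) y = V * E ^ N"
      by (simp add: gauss_weight_def V_def E_def Q_def exp_of_nat_mult[symmetric] mult_ac)
    have G1: "gauss_weight k 1 (c * real N) y = V * Q * exp (- (c * real N * Q))"
      and G2: "gauss_weight k 2 (c * real N) y = V * Q\<^sup>2 * exp (- (c * real N * Q))"
      by (simp_all add: gauss_weight_def V_def Q_def)
    have "norm_sq k (\<lambda>i\<in>{..<k}. - pi + 1 * y i) = Q'"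
      unfolding norm_sq_def Q'_def by (intro sum.cong refl) (simp add: algebra_simps)
    then have G3: "gauss_weight k 1 (c * real N) (\<lambda>i\<in>{..<k}. - pi + 1 * y i) = V * Q' * exp (- (c * real N * Q'))"
      unfolding gauss_weight_def vandermonde_affine V_def by simp
    have EM: "E \<le> exp (- (c * Q))" "E > 0"
      unfolding E_def using mult_right_mono[OF c(2) Q] by auto
    have phpow: "ph \<bar>x\<bar> ^ N \<le> exp (- (c * real N * q))" if "\<bar>x\<bar> \<le> 1 - c0 * q" "q \<ge> 0" for q
    proof -
      have x1: "0 \<le> \<bar>x\<bar>" "\<bar>x\<bar> \<le> 1" using that c0 by (auto intro: order_trans)
      have "c * q \<le> \<kappa> * c0 * q" using c that by (intro mult_right_mono)
      also have "\<dots> \<le> \<kappa> * (1 - \<bar>x\<bar>)" using that \<kappa> by (simp add: mult.assoc)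
      finally have "ph \<bar>x\<bar> \<le> exp (- (c * q))"
        using ph_exp[OF x1] by (meson exp_le_cancel_iff neg_le_iff_le order_trans)
      then have "ph \<bar>x\<bar> ^ N \<le> exp (- (c * q)) ^ N" using ph_exp[OF x1] by (intro power_mono) auto
      then show ?thesis by (simp add: exp_of_nat_mult[symmetric] mult_ac)
    qed
    have nn: "0 \<le> V * Q * exp (- (c * real N * Q))" "0 \<le> real N * (V * Q\<^sup>2 * exp (- (c * real N * Q)))"
      "0 \<le> V * Q' * exp (- (c * real N * Q'))"
      using V Q Q' by auto
    from decay[OF y] show ?thesis
    proof
      assume x: "\<bar>phi y\<bar> \<le> 1 - c0 * norm_sq k y"
      then have x': "\<bar>x\<bar> \<le> 1 - c0 * Q" by (simp add: x_def Q_def)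
      then have c0Q: "c0 * Q \<le> 1" by (smt (verit) abs_ge_zero)
      have Qc: "Q \<le> 1 / c0" using c0Q c0 by (simp add: pos_le_divide_eq mult.commute)
      have x1: "\<bar>x\<bar> \<le> 1" using x' Q c0 by (smt (verit) mult_nonneg_nonneg)
      \<comment> \<open>Two replacements are made near 0: here the kernel by g times the squared
        Vandermonde product, and in \<open>part2\<close> the power of ph by the Gaussian.\<close>
      have "\<bar>F N y - g * (V * ph x ^ N)\<bar> \<le> ph \<bar>x\<bar> ^ N * (K1 * (V * Q))"
      proof -
        have "F N y - g * (V * ph x ^ N) = (\<Sum>m\<le>degree (P ^ N). wt N m * x ^ m * (Re (torus_kernel k e (eps m) n (imag_pt y)) - g * V))"
          unfolding wt_sum[symmetric] F_def x_def by (simp add: sum_distrib_left sum_subtractf[symmetric] algebra_simps)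
        also have "\<bar>\<dots>\<bar> \<le> (\<Sum>m\<le>degree (P ^ N). wt N m * \<bar>x\<bar> ^ m * (K1 * (V * Q)))"
        proof (intro order_trans[OF sum_abs] sum_mono)
          fix m
          have "\<bar>Re (torus_kernel k e (eps m) n (imag_pt y)) - g * V\<bar> \<le> K1 * (V * Q)"
            using near0[OF eps] by (simp add: g_def V_def Q_def)
          then show "\<bar>wt N m * x ^ m * (Re (torus_kernel k e (eps m) n (imag_pt y)) - g * V)\<bar> \<le> wt N m * \<bar>x\<bar> ^ m * (K1 * (V * Q))"
            unfolding abs_mult power_abs using wt[of N m] by (simp add: mult_left_mono)
        qed
        finally show ?thesis by (simp add: wt_sum sum_distrib_right[symmetric])
      qed
      also have "\<dots> \<le> exp (- (c * real N * Q)) * (K1 * (V * Q))"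
        using phpow[OF x' Q] K1 V Q by (intro mult_right_mono) auto
      finally have part1: "\<bar>F N y - g * (V * ph x ^ N)\<bar> \<le> K1 * (V * Q * exp (- (c * real N * Q)))"
        by (simp add: mult_ac)
      \<comment> \<open>Both ph(phi) and E agree with 1 - a |y|^2/2 up to fourth order;
        \<open>C3\<close> collects the errors of ph, of phi and of the exponential.\<close>
      have diff: "\<bar>ph x - E\<bar> \<le> C3 * Q\<^sup>2"
      proof -
        have "\<bar>x - (1 - al * Q / 2)\<bar> \<le> C0 * Q\<^sup>2" using phi_taylor[of y] by (simp add: x_def Q_def)
        moreover have "C0 * Q\<^sup>2 \<le> C0 / c0 * Q"
        proof -
          have "C0 * Q * Q \<le> C0 * Q * (1 / c0)" using C0 Q Qc by (intro mult_left_mono) auto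
          then show ?thesis by (simp add: power2_eq_square mult_ac)
        qed
        ultimately have "1 - x \<le> L * Q" unfolding L_def by (simp add: algebra_simps abs_le_iff)
        then have "(1 - x)\<^sup>2 \<le> (L * Q)\<^sup>2" using x1 by (intro power_mono) auto
        then have "C2 * (1 - x)\<^sup>2 \<le> C2 * L\<^sup>2 * Q\<^sup>2" using C2 by (simp add: power_mult_distrib mult_left_mono mult.assoc)
        then have 1: "\<bar>ph x - (1 - \<mu> * (1 - x))\<bar> \<le> C2 * L\<^sup>2 * Q\<^sup>2" using ph_taylor[OF x1] by linarith
        have "\<bar>\<mu> * (x - (1 - al * Q / 2))\<bar> \<le> \<mu> * (C0 * Q\<^sup>2)"
          unfolding abs_mult using \<mu> \<open>\<bar>x - (1 - al * Q / 2)\<bar> \<le> C0 * Q\<^sup>2\<close> by simp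
        moreover have "(1 - \<mu> * (1 - x)) - (1 - a / 2 * Q) = \<mu> * (x - (1 - al * Q / 2))"
          by (simp add: a_eq algebra_simps)
        ultimately have 2: "\<bar>(1 - \<mu> * (1 - x)) - (1 - a / 2 * Q)\<bar> \<le> \<mu> * C0 * Q\<^sup>2" by (simp add: mult.assoc)
        have 3: "\<bar>(1 - a / 2 * Q) - E\<bar> \<le> (a / 2)\<^sup>2 * Q\<^sup>2"
          using exp_minus_taylor[of "a / 2 * Q"] a Q by (simp add: E_def power_mult_distrib power_divide)
        have "\<bar>ph x - E\<bar> \<le> C2 * L\<^sup>2 * Q\<^sup>2 + \<mu> * C0 * Q\<^sup>2 + (a / 2)\<^sup>2 * Q\<^sup>2" using 1 2 3 by linarith
        also have "\<dots> = C3 * Q\<^sup>2" by (simp add: C3_def algebra_simps)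
        finally show ?thesis .
      qed
      have "\<bar>ph x ^ N - E ^ N\<bar> \<le> real N * \<bar>ph x - E\<bar> * (exp (- (c * Q)) ^ N / exp (- (c * Q)))"
      proof (rule abs_power_diff_le)
        have "ph \<bar>x\<bar> \<le> exp (- (\<kappa> * (1 - \<bar>x\<bar>)))" using ph_exp[of "\<bar>x\<bar>"] x1 by simp
        also have "\<dots> \<le> exp (- (c * Q))"
        proof -
          have "c * Q \<le> \<kappa> * c0 * Q" using c Q by (intro mult_right_mono)
          also have "\<dots> \<le> \<kappa> * (1 - \<bar>x\<bar>)" using x' \<kappa> by (simp add: mult.assoc)
          finally show ?thesis by simp
        qed
        finally show "\<bar>ph x\<bar> \<le> exp (- (c * Q))" using ph_abs[of x] by linarith
        show "\<bar>E\<bar> \<le> exp (- (c * Q))" using EM by simp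
      qed simp
      \<comment> \<open>The difference of N-th powers retains only N - 1 factors exp(- c Q); the
        missing one costs at most exp(c/c0), since Q is at most 1/c0 here.\<close>
      also have "exp (- (c * Q)) ^ N / exp (- (c * Q)) = exp (c * Q) * exp (- (c * real N * Q))"
      proof -
        have "exp (- (c * Q)) ^ N = exp (- (c * real N * Q))" by (simp add: exp_of_nat_mult[symmetric] mult_ac)
        then show ?thesis by (simp add: exp_minus[of "c * Q"] divide_inverse)
      qed
      also have "real N * \<bar>ph x - E\<bar> * \<dots> \<le> real N * (C3 * Q\<^sup>2) * (exp (c / c0) * exp (- (c * real N * Q)))"
      proof (intro mult_mono mult_left_mono diff)
        have "c * Q \<le> c * (1 / c0)" using c Qc by (intro mult_left_mono) auto
        then show "exp (c * Q) \<le> exp (c / c0)" by simp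
      qed (use C3 in auto)
      finally have "\<bar>ph x ^ N - E ^ N\<bar> \<le> C3 * exp (c / c0) * (real N * (Q\<^sup>2 * exp (- (c * real N * Q))))"
        by (simp add: mult_ac)
      then have "\<bar>g\<bar> * V * \<bar>ph x ^ N - E ^ N\<bar> \<le> \<bar>g\<bar> * V * (C3 * exp (c / c0) * (real N * (Q\<^sup>2 * exp (- (c * real N * Q)))))"
        using V by (intro mult_left_mono) auto
      then have part2: "\<bar>g * (V * ph x ^ N) - g * (V * E ^ N)\<bar> \<le> \<bar>g\<bar> * C3 * exp (c / c0) * (real N * (V * Q\<^sup>2 * exp (- (c * real N * Q))))"
        using V by (simp add: right_diff_distrib[symmetric] abs_mult mult_ac)
      have "\<bar>F N y - g * (V * E ^ N)\<bar> \<le> K1 * (V * Q * exp (- (c * real N * Q))) + \<bar>g\<bar> * C3 * exp (c / c0) * (real N * (V * Q\<^sup>2 * exp (- (c * real N * Q))))"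
        using part1 part2 by linarith
      also have "\<dots> \<le> C * (V * Q * exp (- (c * real N * Q))) + C * (real N * (V * Q\<^sup>2 * exp (- (c * real N * Q))))"
        using K1 K2 C3 nn unfolding C_def by (intro add_mono mult_right_mono) auto
      also have "\<dots> \<le> C * (V * Q * exp (- (c * real N * Q)) + real N * (V * Q\<^sup>2 * exp (- (c * real N * Q))) + V * Q' * exp (- (c * real N * Q')))"
        using C nn by (simp add: distrib_left)
      finally show ?thesis unfolding EN G1 G2 G3 .
    next
      \<comment> \<open>Near the second maximum nothing is approximated: the integrand itself is
        small to second order, and the Gaussian about 0 is absorbed by an error weight since Q is at
        least 1.\<close>
      assume as: "e = 0 \<and> (\<forall>m. eps m = 0) \<and> 1 \<le> norm_sq k y \<and> \<bar>phi y\<bar> \<le> 1 - c0 * norm_sq k (\<lambda>i. y i - pi)"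
      then have x': "\<bar>x\<bar> \<le> 1 - c0 * Q'" and Q1: "1 \<le> Q" by (auto simp: x_def Q'_def Q_def)
      have "\<bar>F N y\<bar> \<le> (\<Sum>m\<le>degree (P ^ N). wt N m * \<bar>x\<bar> ^ m * (K2 * (V * Q')))"
        unfolding F_def
      proof (intro order_trans[OF sum_abs] sum_mono)
        fix m
        have "\<bar>Re (torus_kernel k e (eps m) n (imag_pt y))\<bar> \<le> K2 * (V * Q')"
          using nearpi[of y] as by (simp add: V_def Q'_def)
        then have "wt N m * (\<bar>x\<bar> ^ m * \<bar>Re (torus_kernel k e (eps m) n (imag_pt y))\<bar>) \<le> wt N m * (\<bar>x\<bar> ^ m * (K2 * (V * Q')))"
          using wt[of N m] by (intro mult_left_mono) auto
        then show "\<bar>wt N m * (phi y ^ m * Re (torus_kernel k e (eps m) n (imag_pt y)))\<bar> \<le> wt N m * \<bar>x\<bar> ^ m * (K2 * (V * Q'))"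
          using wt[of N m] by (simp add: abs_mult power_abs x_def mult.assoc)
      qed
      also have "\<dots> = ph \<bar>x\<bar> ^ N * (K2 * (V * Q'))" by (simp add: wt_sum sum_distrib_right[symmetric])
      also have "\<dots> \<le> exp (- (c * real N * Q')) * (K2 * (V * Q'))"
        using phpow[OF x' Q'] K2 V Q' by (intro mult_right_mono) auto
      finally have part1: "\<bar>F N y\<bar> \<le> K2 * (V * Q' * exp (- (c * real N * Q')))" by (simp add: mult_ac)
      have "E ^ N \<le> exp (- (c * Q)) ^ N" using EM by (intro power_mono) auto
      also have "\<dots> = exp (- (c * real N * Q))" by (simp add: exp_of_nat_mult[symmetric] mult_ac)
      also have "\<dots> \<le> Q * exp (- (c * real N * Q))" using Q1 by (simp add: mult_le_cancel_right1)
      finally have "E ^ N \<le> Q * exp (- (c * real N * Q))" .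
      then have "\<bar>g\<bar> * (V * E ^ N) \<le> \<bar>g\<bar> * (V * (Q * exp (- (c * real N * Q))))"
        using V by (intro mult_left_mono) auto
      then have part2: "\<bar>g * (V * E ^ N)\<bar> \<le> \<bar>g\<bar> * (V * Q * exp (- (c * real N * Q)))"
        using V EM by (simp add: abs_mult mult_ac)
      have "\<bar>F N y - g * (V * E ^ N)\<bar> \<le> K2 * (V * Q' * exp (- (c * real N * Q'))) + \<bar>g\<bar> * (V * Q * exp (- (c * real N * Q)))"
        using part1 part2 by linarith
      also have "\<dots> \<le> C * (V * Q' * exp (- (c * real N * Q'))) + C * (V * Q * exp (- (c * real N * Q)))"
        using K1 K2 C3 nn unfolding C_def by (intro add_mono mult_right_mono) auto
      also have "\<dots> \<le> C * (V * Q * exp (- (c * real N * Q)) + real N * (V * Q\<^sup>2 * exp (- (c * real N * Q))) + V * Q' * exp (- (c * real N * Q')))"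
        using C nn by (simp add: distrib_left)
      finally show ?thesis unfolding EN G1 G2 G3 .
    qed
  qed
  have "\<exists>D. \<forall>N\<ge>1. \<bar>(\<integral>y. F N y \<partial>torus {..<k})
      - g * (1 / (2 * pi)) ^ k * (sqrt (2 * pi) ^ k * (fact k * (\<Prod>j<k. fact j))) * (1 / (a * real N)) powr (real (k\<^sup>2) / 2)\<bar>
    \<le> D * (1 / real N) powr (real (k\<^sup>2) / 2 + 1)"
  proof (rule laplace_torus[OF a c(1,2) C intF])
    fix N :: nat and y :: "nat \<Rightarrow> real"
    assume "N \<ge> 1" and "\<And>i. i < k \<Longrightarrow> y i \<in> {- (pi / 2)..3 * pi / 2}"
    then show "\<bar>F N y - g * gauss_weight k 0 (a / 2 * real N) y\<bar>
      \<le> C * (gauss_weight k 1 (c * real N) y + real N * gauss_weight k 2 (c * real N) y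
             + gauss_weight k 1 (c * real N) (\<lambda>i\<in>{..<k}. - pi + 1 * y i))"
      by (intro bound) auto
  qed
  then obtain D where D: "\<forall>N\<ge>1. \<bar>(\<integral>y. F N y \<partial>torus {..<k})
      - g * (1 / (2 * pi)) ^ k * (sqrt (2 * pi) ^ k * (fact k * (\<Prod>j<k. fact j))) * (1 / (a * real N)) powr (real (k\<^sup>2) / 2)\<bar>
    \<le> D * (1 / real N) powr (real (k\<^sup>2) / 2 + 1)" ..
  show "\<exists>D. \<forall>N\<ge>1. \<bar>poly_walk k A (P ^ N) u / poly P (card A) ^ N
      - 2 ^ k * q0 * (1 / (2 * pi)) ^ k * (sqrt (2 * pi) ^ k * (\<Prod>j<k. fact j)) * (1 / (a * real N)) powr (real (k\<^sup>2) / 2)\<bar>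
    \<le> D * (1 / real N) powr (real (k\<^sup>2) / 2 + 1)"
  proof (intro exI allI impI)
    fix N :: nat assume N: "N \<ge> 1"
    define X where "X = poly_walk k A (P ^ N) u / poly P r ^ N
      - 2 ^ k * q0 * (1 / (2 * pi)) ^ k * (sqrt (2 * pi) ^ k * (\<Prod>j<k. fact j)) * (1 / (a * real N)) powr (real (k\<^sup>2) / 2)"
    have "(\<integral>y. F N y \<partial>torus {..<k})
      - g * (1 / (2 * pi)) ^ k * (sqrt (2 * pi) ^ k * (fact k * (\<Prod>j<k. fact j))) * (1 / (a * real N)) powr (real (k\<^sup>2) / 2)
      = fact k * X"
      unfolding valF X_def g_def by (simp add: algebra_simps)
    then have "fact k * \<bar>X\<bar> \<le> D * (1 / real N) powr (real (k\<^sup>2) / 2 + 1)"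
      using D[rule_format, OF N] by (simp add: abs_mult)
    then have "\<bar>X\<bar> \<le> D / fact k * (1 / real N) powr (real (k\<^sup>2) / 2 + 1)"
      by (simp add: field_simps)
    then show "\<bar>poly_walk k A (P ^ N) u / poly P (card A) ^ N
      - 2 ^ k * q0 * (1 / (2 * pi)) ^ k * (sqrt (2 * pi) ^ k * (\<Prod>j<k. fact j)) * (1 / (a * real N)) powr (real (k\<^sup>2) / 2)\<bar>
      \<le> D / fact k * (1 / real N) powr (real (k\<^sup>2) / 2 + 1)"
      by (simp add: X_def r_def)
  qed
qed

end

section \<open>Relative error and the constants of the formula\<close>

lemma relative_error_from_absolute:
  fixes W :: "nat \<Rightarrow> real"
  assumes S1: "S1 > 0" and K: "K > 0" and a: "a > 0"
    and est: "\<And>N. N \<ge> 1 \<Longrightarrow> \<bar>W N / S1 ^ N - K * (1 / (a * real N)) powr s\<bar> \<le> D * (1 / real N) powr (s + 1)"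
  shows "\<exists>\<epsilon> :: nat \<Rightarrow> real. \<epsilon> \<in> O(\<lambda>n. 1 / real n) \<and>
    (\<forall>\<^sub>F n in sequentially. W n = S1 ^ n * (K * (1 / (a * real n)) powr s) * (1 + \<epsilon> n))"
proof (intro exI conjI)
  define M where "M n = K * (1 / (a * real n)) powr s" for n
  define \<epsilon> where "\<epsilon> n = W n / S1 ^ n / M n - 1" for n
  have M: "M n > 0" if "n \<ge> 1" for n using that K a by (simp add: M_def)
  show "\<forall>\<^sub>F n in sequentially. W n = S1 ^ n * (K * (1 / (a * real n)) powr s) * (1 + \<epsilon> n)"
    using eventually_ge_at_top[of 1]
  proof eventually_elim
    case (elim n)
    then show ?case using M[OF elim] S1 by (simp add: \<epsilon>_def M_def[symmetric])
  qed
  show "\<epsilon> \<in> O(\<lambda>n. 1 / real n)"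
  proof (rule bigoI[where c = "D * a powr s / K"])
    show "\<forall>\<^sub>F n in sequentially. norm (\<epsilon> n) \<le> D * a powr s / K * norm (1 / real n)"
      using eventually_ge_at_top[of 1]
    proof eventually_elim
      case (elim n)
      have "\<epsilon> n = (W n / S1 ^ n - M n) / M n" using M[OF elim] by (simp add: \<epsilon>_def diff_divide_distrib)
      then have "\<bar>\<epsilon> n\<bar> = \<bar>W n / S1 ^ n - M n\<bar> / M n" using M[OF elim] by (simp add: abs_divide)
      also have "\<dots> \<le> D * (1 / real n) powr (s + 1) / M n"
        using est[OF elim] M[OF elim] by (intro divide_right_mono) (auto simp: M_def)
      also have "\<dots> = D * a powr s / K * (1 / real n)"
      proof -
        have "(1 / (a * real n)) powr s = (1 / real n) powr s / a powr s"
          using a elim by (simp add: powr_divide powr_mult field_simps)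
        moreover have "(1 / real n) powr (s + 1) = (1 / real n) powr s * (1 / real n)"
          using elim by (simp only: powr_add) simp
        moreover have "(1 / real n) powr s > 0" "a powr s > 0" using elim a by auto
        ultimately show ?thesis unfolding M_def using K by (simp add: field_simps)
      qed
      finally show ?case by simp
    qed
  qed
qed

lemma vandermonde_scale: "vandermonde k (\<lambda>i. c * t i) = c ^ (\<Sum>m<k. m) * vandermonde k (t :: nat \<Rightarrow> real)"
  unfolding vandermonde_def by (simp add: right_diff_distrib[symmetric] prod.distrib power_sum)

lemma vandermonde_product_one_based:
  "(\<Prod>m = 1..k. \<Prod>j = 1..<m. (u m)\<^sup>2 - (u j)\<^sup>2) = vandermonde k (\<lambda>i. (u (Suc i))\<^sup>2 :: real)"
proof -
  have "(\<Prod>m = 1..k. \<Prod>j = 1..<m. (u m)\<^sup>2 - (u j)\<^sup>2) = (\<Prod>m<k. \<Prod>j = 1..<Suc m. (u (Suc m))\<^sup>2 - (u j)\<^sup>2)"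
    by (rule prod.reindex_bij_witness[of _ Suc "\<lambda>m. m - 1"]) auto
  also have "\<dots> = (\<Prod>m<k. \<Prod>j<m. (u (Suc m))\<^sup>2 - (u (Suc j))\<^sup>2)"
  proof (rule prod.cong[OF refl])
    fix m
    show "(\<Prod>j = 1..<Suc m. (u (Suc m))\<^sup>2 - (u j)\<^sup>2) = (\<Prod>j<m. (u (Suc m))\<^sup>2 - (u (Suc j))\<^sup>2)"
      by (rule prod.reindex_bij_witness[of _ Suc "\<lambda>m. m - 1"]) auto
  qed
  finally show ?thesis by (simp add: vandermonde_def)
qed

context weyl_walk_asymp
begin

lemma walk_weight_asymptotics:
  assumes comp: "composite_step_set A S w" and inv: "prefix_invariant k S w"
    and pos: "step_gf_one k S w > 0" and ex: "\<exists>s\<in>S. s \<noteq> [] \<and> w s > 0"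
    and l: "l \<in> {1..k}"
    and trans: "\<And>a b. a \<in> A \<Longrightarrow> b \<in> A \<Longrightarrow> \<exists>\<rho>\<in>signed_perms k. \<rho> a = b"
    and mean: "(\<Sum>a\<in>A. a l) = 0" and var: "(\<Sum>a\<in>A. (a l)\<^sup>2) = real (card A) * al * d\<^sup>2"
    and u: "u \<in> chamber k" and e: "e \<le> 1" and n: "\<And>j. j < k \<Longrightarrow> coords u j = real (n j) - real e / 2"
    and adm: "\<And>m. adm m (coords u) (eps m)" and c0: "c0 > 0"
    and decay: "\<And>y. in_box k y \<Longrightarrow> \<bar>phi y\<bar> \<le> 1 - c0 * norm_sq k y
      \<or> (e = 0 \<and> (\<forall>m. eps m = 0) \<and> 1 \<le> norm_sq k y \<and> \<bar>phi y\<bar> \<le> 1 - c0 * norm_sq k (\<lambda>i. y i - pi))"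
  shows "\<exists>\<epsilon> :: nat \<Rightarrow> real. \<epsilon> \<in> O(\<lambda>n. 1 / real n) \<and>
    (\<forall>\<^sub>F n in sequentially.
      walk_weight k S w n u =
        step_gf_one k S w ^ n
        * (2 / pi) powr (real k / 2)
        * (step_gf_one k S w / (real n * step_gf_snd_deriv_one k S w l)) powr (real (k ^ 2) / 2)
        * (\<Prod>j = 1..k. u j * fact (j - 1) / fact (2 * j - 1))
        * (\<Prod>m = 1..k. \<Prod>j = 1..<m. (u m)\<^sup>2 - (u j)\<^sup>2)
        * (1 + \<epsilon> n))"
proof -
  obtain wl where "length_weights A S w (length ` S) wl"
    using length_weights_exists[OF comp inv finA trans] by blast
  then interpret lw: length_weights k A S w "length ` S" wl .
  have coeff_gf: "coeff lw.gf i = (if i \<in> length ` S then wl i else 0)" for i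
    unfolding lw.gf_def coeff_sum using lw.finL by (simp add: sum.delta')
  have wnn: "w s \<ge> 0" if "s \<in> S" for s using comp that by (simp add: composite_step_set_def)
  have P: "coeff lw.gf i \<ge> 0" for i
  proof (cases "i \<in> length ` S")
    case True
    then obtain s where "s \<in> S" "i = length s" by auto
    then show ?thesis using wnn[of s] lw.w_eq[of s] by (simp add: coeff_gf)
  qed (simp add: coeff_gf)
  obtain s0 where s0: "s0 \<in> S" "s0 \<noteq> []" "w s0 > 0" using ex by auto
  define m0 where "m0 = length s0"
  have m0: "m0 \<ge> 1" "coeff lw.gf m0 > 0"
    using s0 lw.w_eq[OF s0(1)] by (auto simp: m0_def coeff_gf Suc_le_eq)
  define S1 where "S1 = step_gf_one k S w"
  define S2 where "S2 = step_gf_snd_deriv_one k S w l"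
  define r where "r = real (card A)"
  define a where "a = r * poly (pderiv lw.gf) r / poly lw.gf r * al"
  have S1: "S1 = poly lw.gf r" unfolding S1_def r_def by (rule lw.step_gf_one_eq)
  have S1pos: "S1 > 0" using pos by (simp add: S1_def)
  have S2: "S2 = S1 * a * d\<^sup>2"
    using S1pos unfolding S2_def lw.step_gf_snd_deriv_one_eq[OF l mean] var a_def S1 r_def by simp
  define b where "b = coords u"
  define q0 where "q0 = (\<Prod>j<k. b j / fact (2 * j + 1)) * vandermonde k (\<lambda>j. (b j)\<^sup>2)"
  define K where "K = 2 ^ k * q0 * (1 / (2 * pi)) ^ k * (sqrt (2 * pi) ^ k * (\<Prod>j<k. fact j))"
  define s where "s = real (k\<^sup>2) / 2"
  note asym = poly_walk_asymptotics[OF u e n adm c0 decay P m0]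
  have a: "a > 0" using asym(1) by (simp add: a_def r_def)
  obtain D where D: "\<And>N. N \<ge> 1 \<Longrightarrow> \<bar>walk_weight k S w N u / S1 ^ N - K * (1 / (a * real N)) powr s\<bar>
      \<le> D * (1 / real N) powr (s + 1)"
    using asym(2) unfolding lw.walk_weight_eq_poly_walk S1 K_def q0_def b_def a_def r_def s_def by blast
  have ch: "chamber_coords k b" using u chamber_iff by (simp add: b_def)
  have bpos: "b j > 0" if "j < k" for j
    using ch chamber_coords_mono[OF ch, of 0 j] that by (cases "j = 0") (auto simp: chamber_coords_def)
  have vpos: "vandermonde k (\<lambda>j. (b j)\<^sup>2) > 0"
  proof (rule vandermonde_pos)
    fix i j assume ij: "i < j" "j < k"
    then show "(b i)\<^sup>2 < (b j)\<^sup>2"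
      using chamber_coords_mono[OF ch ij] bpos[of i] by (intro power_strict_mono) auto
  qed
  have K: "K > 0" unfolding K_def q0_def using vpos bpos by (intro mult_pos_pos prod_pos) auto
  \<comment> \<open>All powers of \<open>d\<close> cancel: d^k from the u_j and d^(k(k-1)) from the
    differences of squares against d^(-k^2) from S/(n S''). The factor (2/pi)^(k/2) combines 2^k
    from the kernel, (2 pi)^(-k) from the torus and (2 pi)^(k/2) from the Gaussian integral.\<close>
  have main: "S1 ^ N * (2 / pi) powr (real k / 2) * (S1 / (real N * S2)) powr (real (k ^ 2) / 2)
        * (\<Prod>j = 1..k. u j * fact (j - 1) / fact (2 * j - 1)) * (\<Prod>m = 1..k. \<Prod>j = 1..<m. (u m)\<^sup>2 - (u j)\<^sup>2)
     = S1 ^ N * (K * (1 / (a * real N)) powr s)" if N: "N \<ge> 1" for N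
  proof -
    have u_eq: "u (Suc i) = d * b i" for i using d by (simp add: b_def coords_def)
    have 1: "(\<Prod>j = 1..k. u j * fact (j - 1) / fact (2 * j - 1)) = d ^ k * (\<Prod>j<k. fact j) * (\<Prod>j<k. b j / fact (2 * j + 1))"
    proof -
      have "(\<Prod>j = 1..k. u j * fact (j - 1) / fact (2 * j - 1)) = (\<Prod>j<k. u (Suc j) * fact j / fact (2 * j + 1))"
        unfolding One_nat_def prod.atLeast1_atMost_eq by simp
      also have "\<dots> = (\<Prod>j<k. d * (fact j * (b j / fact (2 * j + 1))))"
        by (intro prod.cong refl) (simp add: u_eq)
      finally show ?thesis by (simp only: prod.distrib prod_constant card_lessThan mult.assoc)
    qed
    have 2: "(\<Prod>m = 1..k. \<Prod>j = 1..<m. (u m)\<^sup>2 - (u j)\<^sup>2) = (d\<^sup>2) ^ (\<Sum>m<k. m) * vandermonde k (\<lambda>j. (b j)\<^sup>2)"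
      unfolding vandermonde_product_one_based u_eq power_mult_distrib by (rule vandermonde_scale)
    have 3: "(S1 / (real N * S2)) powr s = (1 / (a * real N)) powr s * (1 / d ^ (k\<^sup>2))"
    proof -
      have "S1 / (real N * S2) = (1 / (a * real N)) * (1 / d\<^sup>2)"
        using S1pos by (simp add: S2 mult_ac)
      moreover have "(1 / d\<^sup>2) powr s = 1 / d ^ (k\<^sup>2)"
      proof -
        have "(1 / d\<^sup>2) powr s = 1 / ((d powr 2) powr s)" using d by (simp add: powr_divide)
        also have "(d powr 2) powr s = d powr real (k\<^sup>2)" by (simp add: powr_powr s_def)
        also have "\<dots> = d ^ (k\<^sup>2)" using d by (rule powr_realpow)
        finally show ?thesis .
      qed
      moreover have "1 / (a * real N) \<ge> 0" using a by simp
      ultimately show ?thesis using d by (simp only: powr_mult)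
    qed
    have 4: "(2 / pi) powr (real k / 2) = 2 ^ k * (1 / (2 * pi)) ^ k * sqrt (2 * pi) ^ k"
    proof -
      have "(2 / pi) powr (real k / 2) = ((2 / pi) powr (1 / 2)) powr real k" by (simp add: powr_powr)
      also have "\<dots> = ((2 / pi) powr (1 / 2)) ^ k" by (rule powr_realpow) simp
      also have "(2 / pi) powr (1 / 2) = sqrt (2 / pi)" by (simp add: powr_half_sqrt)
      also have "sqrt (2 / pi) = 2 * (1 / (2 * pi)) * sqrt (2 * pi)"
      proof -
        have "sqrt pi * sqrt pi = pi" by simp
        then show ?thesis by (simp add: real_sqrt_divide real_sqrt_mult field_simps)
      qed
      finally show ?thesis by (simp only: power_mult_distrib)
    qed
    have 5: "d ^ k * (d\<^sup>2) ^ (\<Sum>m<k. m) = d ^ (k\<^sup>2)"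
      unfolding sum_lessThan_id[of k, symmetric] power_add power_mult ..
    have "S1 ^ N * (2 / pi) powr (real k / 2) * (S1 / (real N * S2)) powr s
        * (\<Prod>j = 1..k. u j * fact (j - 1) / fact (2 * j - 1)) * (\<Prod>m = 1..k. \<Prod>j = 1..<m. (u m)\<^sup>2 - (u j)\<^sup>2)
      = S1 ^ N * (K * (1 / (a * real N)) powr s) * ((d ^ k * (d\<^sup>2) ^ (\<Sum>m<k. m)) * (1 / d ^ (k\<^sup>2)))"
      unfolding 1 2 3 4 K_def q0_def by (simp only: mult_ac)
    also have "(d ^ k * (d\<^sup>2) ^ (\<Sum>m<k. m)) * (1 / d ^ (k\<^sup>2)) = 1" unfolding 5 using d by simp
    finally show ?thesis by (simp add: s_def)
  qed
  obtain \<epsilon> where \<epsilon>: "\<epsilon> \<in> O(\<lambda>n. 1 / real n)"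
    and ev: "\<forall>\<^sub>F n in sequentially. walk_weight k S w n u = S1 ^ n * (K * (1 / (a * real n)) powr s) * (1 + \<epsilon> n)"
    using relative_error_from_absolute[OF S1pos K a D] by blast
  show ?thesis
  proof (intro exI[of _ \<epsilon>] conjI \<epsilon>)
    show "\<forall>\<^sub>F n in sequentially.
      walk_weight k S w n u =
        step_gf_one k S w ^ n
        * (2 / pi) powr (real k / 2)
        * (step_gf_one k S w / (real n * step_gf_snd_deriv_one k S w l)) powr (real (k ^ 2) / 2)
        * (\<Prod>j = 1..k. u j * fact (j - 1) / fact (2 * j - 1))
        * (\<Prod>m = 1..k. \<Prod>j = 1..<m. (u m)\<^sup>2 - (u j)\<^sup>2)
        * (1 + \<epsilon> n)"
      using ev eventually_ge_at_top[of 1]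
    proof eventually_elim
      case (elim N)
      show ?case unfolding elim(1) S1_def[symmetric] S2_def[symmetric] main[OF elim(2)] ..
    qed
  qed
qed

end

section \<open>Axis steps\<close>

text \<open>Reduces \<open>adm_wall\<close> to weak inequalities: a point of the closed chamber that
  is not inside lies on a wall.\<close>

lemma chamber_or_wall:
  assumes k: "k \<ge> 1" and b0: "0 \<le> b 0" and b: "\<And>i. Suc i < k \<Longrightarrow> b i \<le> b (Suc i)"
  shows "chamber_coords k b \<or> (\<exists>i<k. b i = 0) \<or> (\<exists>i j. i < k \<and> j < k \<and> i \<noteq> j \<and> b i = b j)"
proof (rule ccontr)
  assume neg: "\<not> ?thesis"
  then have "b 0 \<noteq> 0" using k by auto
  moreover have "b i < b (Suc i)" if "Suc i < k" for i
  proof -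
    have "b i \<noteq> b (Suc i)" using neg that by (metis Suc_lessD n_not_Suc_n)
    then show ?thesis using b[OF that] by simp
  qed
  ultimately have "chamber_coords k b" using b0 by (auto simp: chamber_coords_def)
  then show False using neg by blast
qed

lemma exp_imag_add: "exp (Complex 0 t) + exp (- Complex 0 t) = of_real (2 * cos t)"
proof -
  have "- Complex 0 t = Complex 0 (- t)" by (simp add: complex_eq_iff)
  then show ?thesis by (simp only: exp_imag) (simp add: complex_eq_iff)
qed

definition axis_vec :: "nat \<Rightarrow> real \<Rightarrow> rvec" where
  "axis_vec j t = (\<lambda>i. if i = Suc j then t else 0)"

lemma rescale_axis_steps:
  "rescale c ` axis_steps k = (\<lambda>(j, t). axis_vec j t) ` ({..<k} \<times> {c, - c})"
proof -
  have "rescale c (rescale s (std_basis (Suc j))) = axis_vec j (c * s)" for s j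
    by (auto simp: rescale_def std_basis_def axis_vec_def)
  note eq = this
  show ?thesis
  proof (intro equalityI subsetI)
    fix x assume "x \<in> rescale c ` axis_steps k"
    then obtain s j where x: "x = rescale c (rescale s (std_basis j))" "s \<in> {-1, 1}" "j \<in> {1..k}"
      by (auto simp: axis_steps_def)
    then have "x = axis_vec (j - 1) (c * s)" using eq[of s "j - 1"] by simp
    then show "x \<in> (\<lambda>(j, t). axis_vec j t) ` ({..<k} \<times> {c, - c})"
      using x by (intro image_eqI[of _ _ "(j - 1, c * s)"]) auto
  next
    fix x assume "x \<in> (\<lambda>(j, t). axis_vec j t) ` ({..<k} \<times> {c, - c})"
    then obtain j t where x: "x = axis_vec j t" "j < k" "t = c \<or> t = - c" by auto
    define s where "s = (if t = c then 1 else - 1 :: real)"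
    have "x = rescale c (rescale s (std_basis (Suc j)))" using x eq[of s j] by (auto simp: s_def)
    moreover have "rescale s (std_basis (Suc j)) \<in> axis_steps k"
      using x unfolding axis_steps_def by (auto simp: s_def intro!: exI[of _ s] exI[of _ "Suc j"])
    ultimately show "x \<in> rescale c ` axis_steps k" by blast
  qed
qed

lemma inj_axis_vec: "c > 0 \<Longrightarrow> inj_on (\<lambda>(j, t). axis_vec j t) ({..<k} \<times> {c, - c})"
  by (auto simp: inj_on_def axis_vec_def fun_eq_iff split: if_splits)

lemma sum_axis_steps:
  assumes "c > 0"
  shows "(\<Sum>a\<in>rescale c ` axis_steps k. f a) = (\<Sum>j<k. f (axis_vec j c) + f (axis_vec j (- c)))"
proof -
  have "(\<Sum>a\<in>rescale c ` axis_steps k. f a) = (\<Sum>(j, t)\<in>{..<k} \<times> {c, - c}. f (axis_vec j t))"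
    unfolding rescale_axis_steps by (subst sum.reindex[OF inj_axis_vec[OF assms]]) (simp add: case_prod_unfold)
  also have "\<dots> = (\<Sum>j<k. \<Sum>t\<in>{c, - c}. f (axis_vec j t))"
    by (simp add: sum.cartesian_product)
  also have "\<dots> = (\<Sum>j<k. f (axis_vec j c) + f (axis_vec j (- c)))"
    using assms by (intro sum.cong refl) simp
  finally show ?thesis .
qed

lemma axis_symbol:
  assumes "c > 0"
  shows "walk_symbol k (rescale c ` axis_steps k) c z = (\<Sum>j<k. exp (z j) + exp (- z j))"
  unfolding walk_symbol_def sum_axis_steps[OF assms]
proof (intro sum.cong refl)
  fix j assume j: "j \<in> {..<k}"
  have "(\<Sum>i<k. of_real (axis_vec j t (Suc i) / c) * z i) = of_real (t / c) * z j" for t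
  proof -
    have "(\<Sum>i<k. of_real (axis_vec j t (Suc i) / c) * z i) = (\<Sum>i<k. if i = j then of_real (t / c) * z j else 0)"
      by (intro sum.cong refl) (auto simp: axis_vec_def)
    then show ?thesis using j by (simp add: sum.delta)
  qed
  then show "exp (\<Sum>i<k. of_real (axis_vec j c (Suc i) / c) * z i) + exp (\<Sum>i<k. of_real (axis_vec j (- c) (Suc i) / c) * z i)
     = exp (z j) + exp (- z j)"
    using assms by simp
qed

text \<open>For fixed p a step in coordinate p(j) changes only the factor of index j, where
  \<open>sinh_diff_rec\<close> applies; summing over j and reindexing by p produces the
  symbol.\<close>

lemma axis_symbol_altern:
  assumes c: "c > 0"
  shows "walk_symbol k (rescale c ` axis_steps k) c z * alternant k b z
    = (\<Sum>a\<in>rescale c ` axis_steps k. alternant k (\<lambda>i. b i + a (Suc i) / c) z)"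
proof -
  define h where "h j s p = (\<Prod>i<k. sinh_diff (b (p i) + (if p i = j then s else 0)) (z i))" for j :: nat and s :: real and p
  have ax: "b i + axis_vec j t (Suc i) / c = b i + (if i = j then t / c else 0)" for i j t
    by (simp add: axis_vec_def)
  have cc: "c / c = 1" "- c / c = -1" using c by auto
  have key: "(\<Sum>j<k. h j 1 p + h j (-1) p) = (\<Sum>j<k. exp (z j) + exp (- z j)) * (\<Prod>i<k. sinh_diff (b (p i)) (z i))"
    if p: "p permutes {..<k}" for p
  proof -
    have "h (p j) 1 p + h (p j) (-1) p = (exp (z j) + exp (- z j)) * (\<Prod>i<k. sinh_diff (b (p i)) (z i))"
      if j: "j < k" for j
    proof -
      have pj: "p i = p j \<longleftrightarrow> i = j" for i using permutes_inj[OF p] by (auto simp: inj_def)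
      have "h (p j) s p = sinh_diff (b (p j) + s) (z j) * (\<Prod>i\<in>{..<k} - {j}. sinh_diff (b (p i)) (z i))" for s
        unfolding h_def pj using j by (subst prod.remove[of _ j]) (auto intro!: prod.cong)
      then have "h (p j) 1 p + h (p j) (-1) p
         = (sinh_diff (b (p j) + 1) (z j) + sinh_diff (b (p j) - 1) (z j)) * (\<Prod>i\<in>{..<k} - {j}. sinh_diff (b (p i)) (z i))"
        by (simp add: algebra_simps)
      also have "sinh_diff (b (p j) + 1) (z j) + sinh_diff (b (p j) - 1) (z j) = (exp (z j) + exp (- z j)) * sinh_diff (b (p j)) (z j)"
        unfolding sinh_diff_rec by (simp add: cosh_var_def)
      finally show ?thesis using j by (simp add: prod.remove[of "{..<k}" j] mult.assoc)
    qed
    then have "(\<Sum>j<k. h (p j) 1 p + h (p j) (-1) p) = (\<Sum>j<k. exp (z j) + exp (- z j)) * (\<Prod>i<k. sinh_diff (b (p i)) (z i))"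
      by (simp add: sum_distrib_right)
    moreover have "(\<Sum>j<k. h (p j) 1 p + h (p j) (-1) p) = (\<Sum>j<k. h j 1 p + h j (-1) p)"
      using sum.permute[OF p, of "\<lambda>j. h j 1 p + h j (-1) p"] by (simp add: comp_def)
    ultimately show ?thesis by simp
  qed
  have "(\<Sum>a\<in>rescale c ` axis_steps k. alternant k (\<lambda>i. b i + a (Suc i) / c) z)
     = (\<Sum>j<k. \<Sum>p | p permutes {..<k}. of_int (sign p) * (h j 1 p + h j (-1) p))"
    unfolding sum_axis_steps[OF c] alternant_def ax h_def cc by (simp add: distrib_left sum.distrib)
  also have "\<dots> = (\<Sum>p | p permutes {..<k}. of_int (sign p) * (\<Sum>j<k. h j 1 p + h j (-1) p))"
    by (subst sum.swap) (simp add: sum_distrib_left)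
  also have "\<dots> = (\<Sum>p | p permutes {..<k}. of_int (sign p) * ((\<Sum>j<k. exp (z j) + exp (- z j)) * (\<Prod>i<k. sinh_diff (b (p i)) (z i))))"
    by (intro sum.cong refl) (simp add: key)
  also have "\<dots> = (\<Sum>j<k. exp (z j) + exp (- z j)) * alternant k b z"
    unfolding alternant_def sum_distrib_left by (intro sum.cong refl) (simp add: mult_ac)
  finally show ?thesis by (simp add: axis_symbol[OF c])
qed

definition axis_adm :: "nat \<Rightarrow> nat \<Rightarrow> (nat \<Rightarrow> real) \<Rightarrow> nat \<Rightarrow> bool" where
  "axis_adm k m b e \<longleftrightarrow> e = 0 \<and> (\<exists>\<beta>. \<forall>j<k. b j = of_int (\<beta> j))"

definition axis_phi :: "nat \<Rightarrow> (nat \<Rightarrow> real) \<Rightarrow> real" where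
  "axis_phi k y = (\<Sum>j<k. cos (y j)) / real k"

lemma card_axis_steps: "c > 0 \<Longrightarrow> card (rescale c ` axis_steps k) = 2 * k"
  using sum_axis_steps[of c "\<lambda>_. 1 :: nat" k] by simp

lemma finite_axis_steps: "finite (rescale c ` axis_steps k)"
  unfolding rescale_axis_steps by simp

lemma axis_weyl_walk:
  assumes k: "k \<ge> 1" and c: "c > 0"
  shows "weyl_walk_asymp k (rescale c ` axis_steps k) c (axis_adm k) (axis_phi k) (1 / real k) 1"
proof
  let ?A = "rescale c ` axis_steps k"
  show "1 \<le> k" "finite ?A" "0 < c" using k c finite_axis_steps by auto
  have A: "\<exists>j<k. \<exists>t\<in>{c, -c}. a = axis_vec j t" if "a \<in> ?A" for a
    using that unfolding rescale_axis_steps by auto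
  show "?A \<subseteq> vec_space k"
    using A by (fastforce simp: vec_space_def axis_vec_def)
  show "walk_symbol k ?A c z * alternant k b z = (\<Sum>a\<in>?A. alternant k (\<lambda>i. b i + a (Suc i) / c) z)" for b z
    by (rule axis_symbol_altern[OF c])
  \<comment> \<open>In units of c a step has integer coordinates, none below -1, and neighbouring
    coordinates approach each other by at most 1. Strict inequalities between integers thus survive
    as weak ones.\<close>
  have delta: "\<exists>\<delta>. (\<forall>i. a (Suc i) / c = of_int (\<delta> i)) \<and> (\<forall>i. \<delta> i \<ge> -1) \<and> (\<forall>i. \<delta> i - \<delta> (Suc i) \<le> 1)"
    if mem: "a \<in> ?A" for a
  proof -
    obtain j t where a: "a = axis_vec j t" "t = c \<or> t = - c" using A[OF mem] by auto
    show ?thesis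
      using a c by (intro exI[of _ "\<lambda>i. if i = j then (if t = c then 1 else -1 :: int) else 0"]) (auto simp: axis_vec_def)
  qed
  show "axis_adm k m (\<lambda>i. b i + a (Suc i) / c) e" if ad: "axis_adm k (Suc m) b e" and mem: "a \<in> ?A" for m b e a
  proof -
    obtain \<beta> where "e = 0" "\<forall>j<k. b j = of_int (\<beta> j)" using ad by (auto simp: axis_adm_def)
    moreover obtain \<delta> where "\<forall>i. a (Suc i) / c = of_int (\<delta> i)" using delta[OF mem] by auto
    ultimately show ?thesis unfolding axis_adm_def by (auto intro!: exI[of _ "\<lambda>i. \<beta> i + \<delta> i"])
  qed
  show "e \<le> 1 \<and> (\<exists>\<beta>. \<forall>j<k. b j = of_int (\<beta> j) - of_nat e / 2)" if "axis_adm k 0 b e" for b e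
    using that by (auto simp: axis_adm_def)
  show "chamber_coords k (\<lambda>i. b i + a (Suc i) / c) \<or> (\<exists>i<k. b i + a (Suc i) / c = 0)
      \<or> (\<exists>i j. i < k \<and> j < k \<and> i \<noteq> j \<and> b i + a (Suc i) / c = b j + a (Suc j) / c)"
    if adm: "axis_adm k m b e" and ch: "chamber_coords k b" and a: "a \<in> ?A" for m b e a
  proof (rule chamber_or_wall[OF k])
    obtain \<beta> where \<beta>: "\<And>j. j < k \<Longrightarrow> b j = of_int (\<beta> j)" using adm by (auto simp: axis_adm_def)
    obtain \<delta> where \<delta>: "\<And>i. a (Suc i) / c = of_int (\<delta> i)" "\<And>i. \<delta> i \<ge> -1" "\<And>i. \<delta> i - \<delta> (Suc i) \<le> 1"
      using delta[OF a] by auto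
    have "\<beta> 0 \<ge> 1" using ch \<beta>[of 0] k by (simp add: chamber_coords_def)
    then have "0 \<le> real_of_int (\<beta> 0 + \<delta> 0)" using \<delta>(2)[of 0] by linarith
    then show "0 \<le> b 0 + a (Suc 0) / c" using \<beta>[of 0] k by (simp add: \<delta>(1))
    fix i assume i: "Suc i < k"
    have "b i < b (Suc i)" using ch i by (auto simp: chamber_coords_def)
    then have "\<beta> i < \<beta> (Suc i)" using \<beta>[of i] \<beta>[of "Suc i"] i by simp
    then have "\<beta> i + \<delta> i \<le> \<beta> (Suc i) + \<delta> (Suc i)" using \<delta>(3)[of i] by linarith
    then have "real_of_int (\<beta> i + \<delta> i) \<le> real_of_int (\<beta> (Suc i) + \<delta> (Suc i))" by (simp only: of_int_le_iff)
    then show "b i + a (Suc i) / c \<le> b (Suc i) + a (Suc (Suc i)) / c" using \<beta>[of i] \<beta>[of "Suc i"] i by (simp add: \<delta>(1))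
  qed
  show "?A \<noteq> {}" using card_axis_steps[OF c, of k] k by auto
  show "e \<le> 1" if "axis_adm k m b e" for m b e using that by (simp add: axis_adm_def)
  show "walk_symbol k ?A c (imag_pt y) = of_real (real (card ?A) * axis_phi k y)" for y
  proof -
    have "real (2 * k) * (C / real k) = 2 * C" for C using k by simp
    then show ?thesis
      unfolding axis_symbol[OF c] exp_imag_add card_axis_steps[OF c] axis_phi_def by (simp only:) (simp add: sum_distrib_left)
  qed
  show "0 < 1 / real k" using k by simp
  show "\<bar>axis_phi k y - (1 - 1 / real k * norm_sq k y / 2)\<bar> \<le> 1 * (norm_sq k y)\<^sup>2" for y
  proof -
    have "axis_phi k y - (1 - 1 / real k * norm_sq k y / 2) = (\<Sum>j<k. cos (y j) - (1 - (y j)\<^sup>2 / 2)) / real k"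
      using k by (simp add: axis_phi_def norm_sq_def sum_subtractf sum.distrib sum_divide_distrib diff_divide_distrib add_divide_distrib mult.commute)
    also have "\<bar>\<dots>\<bar> \<le> (\<Sum>j<k. (y j)\<^sup>2 * norm_sq k y) / real k"
    proof -
      have "\<bar>cos (y j) - (1 - (y j)\<^sup>2 / 2)\<bar> \<le> (y j)\<^sup>2 * norm_sq k y" if "j < k" for j
      proof -
        have "\<bar>cos (y j) - (1 - (y j)\<^sup>2 / 2)\<bar> \<le> y j ^ 4 / 24" by (rule cos_bounds)
        also have "\<dots> \<le> (y j) ^ 4" by simp
        also have "\<dots> = (y j)\<^sup>2 * (y j)\<^sup>2" by (simp flip: power_add)
        also have "\<dots> \<le> (y j)\<^sup>2 * norm_sq k y"
          unfolding norm_sq_def using that by (intro mult_left_mono member_le_sum) auto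
        finally show ?thesis .
      qed
      then have "\<bar>\<Sum>j<k. cos (y j) - (1 - (y j)\<^sup>2 / 2)\<bar> \<le> (\<Sum>j<k. (y j)\<^sup>2 * norm_sq k y)"
        by (intro order_trans[OF sum_abs] sum_mono) auto
      then show ?thesis by (simp add: abs_divide divide_right_mono)
    qed
    also have "\<dots> = (norm_sq k y)\<^sup>2 / real k" by (simp add: sum_distrib_right[symmetric] norm_sq_def power2_eq_square)
    also have "\<dots> \<le> (norm_sq k y)\<^sup>2 / 1" using k by (intro divide_left_mono) auto
    finally show ?thesis by simp
  qed
qed simp_all

text \<open>A nonnegative average of cosines is compared with the maximum at 0, a negative one with
  the point (pi, ..., pi), about which the cosines change sign. The box keeps both distances within
  the range of \<open>one_minus_cos_ge\<close>. In the second case some cosine is negative, so y is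
  away from 0.\<close>

lemma axis_decay:
  assumes k: "k \<ge> 1" and y: "in_box k y"
  shows "\<bar>axis_phi k y\<bar> \<le> 1 - 1 / (50 * real k) * norm_sq k y
    \<or> (1 \<le> norm_sq k y \<and> \<bar>axis_phi k y\<bar> \<le> 1 - 1 / (50 * real k) * norm_sq k (\<lambda>i. y i - pi))"
proof -
  have abs1: "\<bar>y i\<bar> \<le> 3 * pi / 2" "\<bar>y i - pi\<bar> \<le> 3 * pi / 2" if "i < k" for i
  proof -
    have "- (pi / 2) \<le> y i" "y i \<le> 3 * pi / 2" using y that by auto
    moreover have "0 < pi" by simp
    ultimately show "\<bar>y i\<bar> \<le> 3 * pi / 2" "\<bar>y i - pi\<bar> \<le> 3 * pi / 2"
      by (intro abs_leI; linarith)+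
  qed
  have avg: "(\<Sum>i<k. cos (t i)) / real k \<le> 1 - 1 / (50 * real k) * norm_sq k t" if "\<And>i. i < k \<Longrightarrow> \<bar>t i\<bar> \<le> 3 * pi / 2" for t
  proof -
    have "(\<Sum>i<k. cos (t i)) \<le> (\<Sum>i<k. 1 - (t i)\<^sup>2 / 50)"
    proof (intro sum_mono)
      fix i assume "i \<in> {..<k}"
      then show "cos (t i) \<le> 1 - (t i)\<^sup>2 / 50" using one_minus_cos_ge[OF that, of i] by simp
    qed
    also have "\<dots> = real k - norm_sq k t / 50" by (simp add: sum_subtractf norm_sq_def sum_divide_distrib)
    finally have "(\<Sum>i<k. cos (t i)) / real k \<le> (real k - norm_sq k t / 50) / real k" by (intro divide_right_mono) auto
    also have "\<dots> = 1 - 1 / (50 * real k) * norm_sq k t" using k by (simp add: diff_divide_distrib)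
    finally show ?thesis .
  qed
  show ?thesis
  proof (cases "0 \<le> axis_phi k y")
    case True
    have "axis_phi k y \<le> 1 - 1 / (50 * real k) * norm_sq k y"
      unfolding axis_phi_def by (rule avg[OF abs1(1)])
    then show ?thesis using True by simp
  next
    case False
    have "- axis_phi k y = (\<Sum>i<k. cos (y i - pi)) / real k" by (simp add: axis_phi_def sum_negf)
    then have "\<bar>axis_phi k y\<bar> \<le> 1 - 1 / (50 * real k) * norm_sq k (\<lambda>i. y i - pi)"
      using avg[of "\<lambda>i. y i - pi"] abs1(2) False by simp
    moreover have "1 \<le> norm_sq k y"
    proof -
      have "\<not> (0 \<le> (\<Sum>i<k. cos (y i)))" using False k by (auto simp: axis_phi_def)
      then obtain i where i: "i < k" "cos (y i) < 0" by (metis lessThan_iff not_le sum_nonneg)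
      have "\<not> \<bar>y i\<bar> \<le> pi / 2"
      proof
        assume "\<bar>y i\<bar> \<le> pi / 2"
        then have "- (pi / 2) \<le> y i" "y i \<le> pi / 2" by linarith+
        then show False using cos_ge_zero[of "y i"] i(2) by simp
      qed
      then have "1 \<le> \<bar>y i\<bar>" using pi_gt3 by linarith
      then have "1 \<le> (y i)\<^sup>2" by (metis abs_1 abs_le_square_iff one_power2)
      also have "\<dots> \<le> norm_sq k y" unfolding norm_sq_def using i(1) by (intro member_le_sum) auto
      finally show ?thesis .
    qed
    ultimately show ?thesis by blast
  qed
qed

lemma axis_transitive:
  assumes c: "c > 0" and a: "a \<in> rescale c ` axis_steps k" and b: "b \<in> rescale c ` axis_steps k"
  shows "\<exists>\<rho>\<in>signed_perms k. \<rho> a = b"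
proof -
  obtain j t where a': "a = axis_vec j t" "j < k" "t = c \<or> t = - c" using a unfolding rescale_axis_steps by auto
  obtain j' t' where b': "b = axis_vec j' t'" "j' < k" "t' = c \<or> t' = - c" using b unfolding rescale_axis_steps by auto
  define p where "p = Transposition.transpose (Suc j) (Suc j')"
  define s where "s i = (if i = Suc j' \<and> t' \<noteq> t then -1 else 1 :: real)" for i
  have p: "p permutes {1..k}" unfolding p_def using a' b' by (intro permutes_swap_id) auto
  have "p (Suc j') = Suc j" by (simp add: p_def)
  then have pj: "p i = Suc j \<longleftrightarrow> i = Suc j'" for i using permutes_inj[OF p] by (metis injD)
  define \<rho> where "\<rho> = (\<lambda>(x :: rvec) i. if i \<in> {1..k} then s i * x (p i) else 0)"
  have "\<rho> \<in> signed_perms k" unfolding signed_perms_def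
    by (intro CollectI exI[of _ s] exI[of _ p] conjI p) (auto simp: \<rho>_def s_def)
  moreover have "\<rho> a = b"
    unfolding \<rho>_def a' b' axis_vec_def pj using a' b' by (auto simp: s_def fun_eq_iff)
  ultimately show ?thesis by blast
qed

lemma walk_weight_asymptotics_axis:
  assumes k: "k \<ge> 1" and c: "c > 0" and A: "A = rescale c ` axis_steps k"
    and comp: "composite_step_set A S w" and inv: "prefix_invariant k S w"
    and pos: "step_gf_one k S w > 0" and ex: "\<exists>s\<in>S. s \<noteq> [] \<and> w s > 0"
    and u: "u \<in> chamber k \<inter> int_lattice A" and l: "l \<in> {1..k}"
  shows "\<exists>\<epsilon> :: nat \<Rightarrow> real. \<epsilon> \<in> O(\<lambda>n. 1 / real n) \<and>
    (\<forall>\<^sub>F n in sequentially.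
      walk_weight k S w n u =
        step_gf_one k S w ^ n
        * (2 / pi) powr (real k / 2)
        * (step_gf_one k S w / (real n * step_gf_snd_deriv_one k S w l)) powr (real (k ^ 2) / 2)
        * (\<Prod>j = 1..k. u j * fact (j - 1) / fact (2 * j - 1))
        * (\<Prod>m = 1..k. \<Prod>j = 1..<m. (u m)\<^sup>2 - (u j)\<^sup>2)
        * (1 + \<epsilon> n))"
proof -
  interpret weyl_walk_asymp k A c "axis_adm k" "axis_phi k" "1 / real k" 1
    unfolding A by (rule axis_weyl_walk[OF k c])
  have uc: "u \<in> chamber k" using u by simp
  have "\<exists>\<beta>. coords u j = of_int \<beta>" for j
  proof -
    obtain N where N: "u = (\<lambda>i. \<Sum>a\<in>A. of_int (N a) * a i)" using u by (auto simp: int_lattice_def)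
    have "\<exists>\<delta>. a (Suc j) / c = of_int \<delta>" if a: "a \<in> A" for a
    proof -
      obtain i t where "a = axis_vec i t" "t = c \<or> t = - c" using a unfolding A rescale_axis_steps by auto
      then show ?thesis using c by (intro exI[of _ "if i = j then (if t = c then 1 else -1) else 0"]) (auto simp: axis_vec_def)
    qed
    then obtain \<delta> where \<delta>: "\<And>a. a \<in> A \<Longrightarrow> a (Suc j) / c = of_int (\<delta> a)" by metis
    have "coords u j = (\<Sum>a\<in>A. of_int (N a) * (a (Suc j) / c))" by (simp add: coords_def N sum_divide_distrib)
    also have "\<dots> = of_int (\<Sum>a\<in>A. N a * \<delta> a)" by (simp add: \<delta>)
    finally show ?thesis by blast
  qed
  then obtain \<beta> where \<beta>: "\<And>j. coords u j = of_int (\<beta> j)" by metis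
  have ch: "chamber_coords k (coords u)" using uc chamber_iff by simp
  have cpos: "coords u j > 0" if "j < k" for j
    using ch chamber_coords_mono[OF ch, of 0 j] that by (cases "j = 0") (auto simp: chamber_coords_def)
  have \<beta>pos: "\<beta> j > 0" if "j < k" for j using cpos[OF that] \<beta>[of j] by simp
  show ?thesis
  proof (rule walk_weight_asymptotics[where e = 0 and eps = "\<lambda>_. 0" and n = "\<lambda>j. nat (\<beta> j)" and ?c0.0 = "1 / (50 * real k)", OF comp inv pos ex l _ _ _ uc])
    show "\<exists>\<rho>\<in>signed_perms k. \<rho> a = b" if "a \<in> A" "b \<in> A" for a b
      using axis_transitive[OF c] that unfolding A by blast
    obtain l' where l': "l = Suc l'" "l' < k" using l by (cases l) auto
    show "(\<Sum>a\<in>A. a l) = 0"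
      unfolding A sum_axis_steps[OF c] by (intro sum.neutral) (auto simp: axis_vec_def)
    have "(\<Sum>a\<in>A. (a l)\<^sup>2) = (\<Sum>j<k. if j = l' then 2 * c\<^sup>2 else 0)"
      unfolding A sum_axis_steps[OF c] by (intro sum.cong refl) (auto simp: axis_vec_def l')
    also have "\<dots> = 2 * c\<^sup>2" using l' by (simp add: sum.delta)
    finally show "(\<Sum>a\<in>A. (a l)\<^sup>2) = real (card A) * (1 / real k) * c\<^sup>2"
      using k unfolding A card_axis_steps[OF c] by simp
    show "coords u j = real (nat (\<beta> j)) - real 0 / 2" if "j < k" for j
      using \<beta>[of j] \<beta>pos[OF that] by simp
    show "axis_adm k m (coords u) 0" for m using \<beta> by (auto simp: axis_adm_def)
    show "0 < 1 / (50 * real k)" using k by simp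
    show "\<bar>axis_phi k y\<bar> \<le> 1 - 1 / (50 * real k) * norm_sq k y
      \<or> (0 = 0 \<and> (\<forall>m. 0 = 0) \<and> 1 \<le> norm_sq k y \<and> \<bar>axis_phi k y\<bar> \<le> 1 - 1 / (50 * real k) * norm_sq k (\<lambda>i. y i - pi))"
      if "in_box k y" for y using axis_decay[OF k that] by blast
  qed simp
qed

section \<open>Diagonal steps\<close>

definition diag_vec :: "nat \<Rightarrow> (nat \<Rightarrow> real) \<Rightarrow> rvec" where
  "diag_vec k x = (\<lambda>i. if i \<in> {1..k} then x (i - 1) else 0)"

lemma diag_vec_Suc: "i < k \<Longrightarrow> diag_vec k x (Suc i) = x i"
  by (simp add: diag_vec_def)

abbreviation sign_vecs :: "nat \<Rightarrow> real \<Rightarrow> (nat \<Rightarrow> real) set" where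
  "sign_vecs k c \<equiv> PiE {..<k} (\<lambda>_. {c, - c})"

lemma rescale_diagonal_steps:
  "rescale c ` diagonal_steps k = diag_vec k ` sign_vecs k c"
proof -
  have basis: "(\<Sum>j = 1..k. s j * std_basis j i) = (if i \<in> {1..k} then s i else 0)" for s :: "nat \<Rightarrow> real" and i
  proof -
    have "(\<Sum>j = 1..k. s j * std_basis j i) = (\<Sum>j = 1..k. if j = i then s i else 0)"
      by (intro sum.cong refl) (auto simp: std_basis_def)
    then show ?thesis by (simp add: sum.delta)
  qed
  show ?thesis
  proof (intro equalityI subsetI)
    fix a assume "a \<in> rescale c ` diagonal_steps k"
    then obtain s where s: "\<forall>j\<in>{1..k}. s j \<in> {-1, 1}" and a: "a = rescale c (\<lambda>i. \<Sum>j = 1..k. s j * std_basis j i)"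
      unfolding diagonal_steps_def by auto
    have "a = diag_vec k (\<lambda>i\<in>{..<k}. c * s (Suc i))"
      unfolding a basis by (auto simp: rescale_def diag_vec_def fun_eq_iff)
    moreover have "(\<lambda>i\<in>{..<k}. c * s (Suc i)) \<in> sign_vecs k c"
    proof (rule PiE_I)
      fix i assume i: "i \<in> {..<k}"
      then have "s (Suc i) \<in> {-1, 1}" using s by simp
      then show "(\<lambda>i\<in>{..<k}. c * s (Suc i)) i \<in> {c, - c}" using i by auto
    qed simp
    ultimately show "a \<in> diag_vec k ` sign_vecs k c" by blast
  next
    fix a assume "a \<in> diag_vec k ` sign_vecs k c"
    then obtain x where x: "x \<in> sign_vecs k c" and a: "a = diag_vec k x" by auto
    define s where "s j = (if x (j - 1) = c then 1 else -1 :: real)" for j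
    have "a = rescale c (\<lambda>i. \<Sum>j = 1..k. s j * std_basis j i)"
    proof
      fix i
      show "a i = rescale c (\<lambda>i. \<Sum>j = 1..k. s j * std_basis j i) i"
      proof (cases "i \<in> {1..k}")
        case True
        then have "x (i - 1) \<in> {c, - c}" using PiE_mem[OF x, of "i - 1"] by auto
        then show ?thesis unfolding basis a using True by (auto simp: rescale_def diag_vec_def s_def)
      next
        case False
        then show ?thesis unfolding basis a by (auto simp: rescale_def diag_vec_def)
      qed
    qed
    moreover have "(\<lambda>i. \<Sum>j = 1..k. s j * std_basis j i) \<in> diagonal_steps k"
      unfolding diagonal_steps_def by (intro CollectI exI[of _ s]) (auto simp: s_def)
    ultimately show "a \<in> rescale c ` diagonal_steps k" by blast
  qed
qed

lemma inj_diag_vec: "inj_on (diag_vec k) (sign_vecs k c)"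
proof (rule inj_onI)
  fix x y assume x: "x \<in> sign_vecs k c" and y: "y \<in> sign_vecs k c" and eq: "diag_vec k x = diag_vec k y"
  show "x = y"
  proof (rule PiE_ext[OF x y])
    fix i assume "i \<in> {..<k}"
    then show "x i = y i" using fun_cong[OF eq, of "Suc i"] by (simp add: diag_vec_Suc)
  qed
qed

lemma sum_diagonal_steps:
  "(\<Sum>a\<in>rescale c ` diagonal_steps k. f a) = (\<Sum>x\<in>sign_vecs k c. f (diag_vec k x))"
  unfolding rescale_diagonal_steps by (simp add: sum.reindex[OF inj_diag_vec])

lemma sum_sign_vecs_prod:
  assumes "c > 0"
  shows "(\<Sum>x\<in>sign_vecs k c. \<Prod>i<k. g i (x i)) = (\<Prod>i<k. g i c + g i (- c) :: 'a :: comm_semiring_1)"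
  using prod_sum_PiE[of "{..<k}" "\<lambda>_. {c, - c}" g] assms by simp

lemma finite_diagonal_steps: "finite (rescale c ` diagonal_steps k)"
  unfolding rescale_diagonal_steps by (intro finite_imageI finite_PiE) auto

lemma card_diagonal_steps: "c > 0 \<Longrightarrow> card (rescale c ` diagonal_steps k) = 2 ^ k"
  unfolding rescale_diagonal_steps by (simp add: card_image[OF inj_diag_vec] card_PiE numeral_2_eq_2)

text \<open>In units of 2 c each step changes every coordinate by 1/2 and the angles are halved.
  Within the box the product of the cos(y_j/2) then has maximal modulus at 0 only.\<close>

lemma diag_symbol:
  assumes c: "c > 0"
  shows "walk_symbol k (rescale c ` diagonal_steps k) (2 * c) z = (\<Prod>j<k. exp (z j / 2) + exp (- (z j / 2)))"
proof -
  have "walk_symbol k (rescale c ` diagonal_steps k) (2 * c) z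
    = (\<Sum>x\<in>sign_vecs k c. \<Prod>i<k. exp (of_real (x i / (2 * c)) * z i))"
    unfolding walk_symbol_def sum_diagonal_steps by (intro sum.cong refl) (simp add: exp_sum diag_vec_Suc)
  also have "\<dots> = (\<Prod>i<k. exp (of_real (c / (2 * c)) * z i) + exp (of_real (- c / (2 * c)) * z i))"
    by (rule sum_sign_vecs_prod[OF c])
  also have "\<dots> = (\<Prod>j<k. exp (z j / 2) + exp (- (z j / 2)))"
    using c by (intro prod.cong refl) simp
  finally show ?thesis .
qed

lemma sinh_diff_half: "sinh_diff (b + 1 / 2) z + sinh_diff (b - 1 / 2) z = (exp (z / 2) + exp (- (z / 2))) * sinh_diff b z"
proof -
  have "exp (- of_real (b + 1 / 2) * z) = exp (- of_real b * z) * exp (- (z / 2))"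
    "exp (of_real (b + 1 / 2) * z) = exp (of_real b * z) * exp (z / 2)"
    "exp (- of_real (b - 1 / 2) * z) = exp (- of_real b * z) * exp (z / 2)"
    "exp (of_real (b - 1 / 2) * z) = exp (of_real b * z) * exp (- (z / 2))"
    unfolding exp_add[symmetric] by (auto intro!: arg_cong[where f = exp] simp: algebra_simps)
  then show ?thesis unfolding sinh_diff_def by (simp add: algebra_simps)
qed

text \<open>The signs of a step are independent, so for each p the sum over the steps is a product
  of one-dimensional sums, evaluated by \<open>sinh_diff_half\<close>. The inverse \<open>q\<close>
  of p arranges the factors by coordinates.\<close>

lemma diag_symbol_altern:
  assumes c: "c > 0"
  shows "walk_symbol k (rescale c ` diagonal_steps k) (2 * c) z * alternant k b z
    = (\<Sum>a\<in>rescale c ` diagonal_steps k. alternant k (\<lambda>i. b i + a (Suc i) / (2 * c)) z)"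
proof -
  define E where "E w = exp (w / 2) + exp (- (w / 2))" for w :: complex
  have key: "(\<Sum>x\<in>sign_vecs k c. \<Prod>i<k. sinh_diff (b (p i) + diag_vec k x (Suc (p i)) / (2 * c)) (z i))
     = (\<Prod>i<k. E (z i)) * (\<Prod>i<k. sinh_diff (b (p i)) (z i))"
    if p: "p permutes {..<k}" for p
  proof -
    define q where "q = inv_into UNIV p"
    have qp: "q (p i) = i" for i unfolding q_def using permutes_inj[OF p] by (rule inv_into_f_f) simp
    have "(\<Prod>i<k. sinh_diff (b (p i) + diag_vec k x (Suc (p i)) / (2 * c)) (z i))
       = (\<Prod>j<k. sinh_diff (b j + x j / (2 * c)) (z (q j)))" for x
    proof -
      have "(\<Prod>j<k. sinh_diff (b j + x j / (2 * c)) (z (q j))) = (\<Prod>i<k. sinh_diff (b (p i) + x (p i) / (2 * c)) (z i))"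
        using prod.permute[OF p, of "\<lambda>j. sinh_diff (b j + x j / (2 * c)) (z (q j))"] by (simp add: comp_def qp)
      also have "\<dots> = (\<Prod>i<k. sinh_diff (b (p i) + diag_vec k x (Suc (p i)) / (2 * c)) (z i))"
      proof (intro prod.cong refl)
        fix i assume "i \<in> {..<k}"
        then have "p i < k" using permutes_in_image[OF p, of i] by auto
        then show "sinh_diff (b (p i) + x (p i) / (2 * c)) (z i) = sinh_diff (b (p i) + diag_vec k x (Suc (p i)) / (2 * c)) (z i)"
          by (simp add: diag_vec_Suc)
      qed
      finally show ?thesis by simp
    qed
    then have "(\<Sum>x\<in>sign_vecs k c. \<Prod>i<k. sinh_diff (b (p i) + diag_vec k x (Suc (p i)) / (2 * c)) (z i))
       = (\<Sum>x\<in>sign_vecs k c. \<Prod>j<k. sinh_diff (b j + x j / (2 * c)) (z (q j)))" by simp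
    also have "\<dots> = (\<Prod>j<k. sinh_diff (b j + c / (2 * c)) (z (q j)) + sinh_diff (b j + - c / (2 * c)) (z (q j)))"
      by (rule sum_sign_vecs_prod[OF c, where g = "\<lambda>j t. sinh_diff (b j + t / (2 * c)) (z (q j))"])
    also have "\<dots> = (\<Prod>j<k. E (z (q j)) * sinh_diff (b j) (z (q j)))"
      using c by (intro prod.cong refl) (simp add: E_def sinh_diff_half[symmetric])
    also have "\<dots> = (\<Prod>i<k. E (z i) * sinh_diff (b (p i)) (z i))"
      using prod.permute[OF p, of "\<lambda>j. E (z (q j)) * sinh_diff (b j) (z (q j))"] by (simp add: comp_def qp)
    finally show ?thesis by (simp add: prod.distrib)
  qed
  have "(\<Sum>a\<in>rescale c ` diagonal_steps k. alternant k (\<lambda>i. b i + a (Suc i) / (2 * c)) z)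
     = (\<Sum>p | p permutes {..<k}. of_int (sign p) * (\<Sum>x\<in>sign_vecs k c. \<Prod>i<k. sinh_diff (b (p i) + diag_vec k x (Suc (p i)) / (2 * c)) (z i)))"
    unfolding sum_diagonal_steps alternant_def sum_distrib_left by (rule sum.swap)
  also have "\<dots> = (\<Sum>p | p permutes {..<k}. of_int (sign p) * ((\<Prod>i<k. E (z i)) * (\<Prod>i<k. sinh_diff (b (p i)) (z i))))"
    by (intro sum.cong refl) (simp add: key)
  also have "\<dots> = (\<Prod>i<k. E (z i)) * alternant k b z"
    unfolding alternant_def sum_distrib_left by (intro sum.cong refl) (simp add: mult_ac)
  finally show ?thesis by (simp add: diag_symbol[OF c] E_def)
qed

text \<open>\<open>m\<close> counts the steps still to go; each of them shifts every coordinate by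
  1/2, whence the offset (e + m)/2.\<close>

definition diag_adm :: "nat \<Rightarrow> nat \<Rightarrow> (nat \<Rightarrow> real) \<Rightarrow> nat \<Rightarrow> bool" where
  "diag_adm k m b e \<longleftrightarrow> e \<le> 1 \<and> (\<exists>\<beta>. \<forall>j<k. b j = of_int (\<beta> j) - (real e + real m) / 2)"

definition diag_phi :: "nat \<Rightarrow> (nat \<Rightarrow> real) \<Rightarrow> real" where
  "diag_phi k y = (\<Prod>j<k. cos (y j / 2))"

text \<open>The comparison passes through the product of the exp(- y_j^2/8): a difference of
  products of factors of modulus at most 1 is bounded by the sum of the differences. The constant 2
  covers 1 + 1/64.\<close>

lemma diag_phi_taylor: "\<bar>diag_phi k y - (1 - 1 / 4 * norm_sq k y / 2)\<bar> \<le> 2 * (norm_sq k y)\<^sup>2"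
proof -
  have "norm ((\<Prod>j<k. cos (y j / 2)) - (\<Prod>j<k. exp (- ((y j)\<^sup>2 / 8)))) \<le> (\<Sum>j<k. norm (cos (y j / 2) - exp (- ((y j)\<^sup>2 / 8))))"
    by (rule norm_prod_diff) auto
  also have "\<dots> \<le> (\<Sum>j<k. (y j)\<^sup>2 * norm_sq k y)"
  proof (intro sum_mono)
    fix j assume j: "j \<in> {..<k}"
    have "\<bar>cos (y j / 2) - (1 - (y j)\<^sup>2 / 8)\<bar> \<le> (y j) ^ 4 / 384"
      using cos_bounds(1)[of "y j / 2"] by (simp add: power_divide)
    moreover have "\<bar>1 - (y j)\<^sup>2 / 8 - exp (- ((y j)\<^sup>2 / 8))\<bar> \<le> (y j) ^ 4 / 64"
      using exp_minus_taylor[of "(y j)\<^sup>2 / 8"] by (simp add: power_divide flip: power_mult)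
    moreover have "0 \<le> (y j) ^ 4" by simp
    ultimately have "\<bar>cos (y j / 2) - exp (- ((y j)\<^sup>2 / 8))\<bar> \<le> (y j) ^ 4" by linarith
    also have "\<dots> = (y j)\<^sup>2 * (y j)\<^sup>2" by (simp flip: power_add)
    also have "\<dots> \<le> (y j)\<^sup>2 * norm_sq k y" unfolding norm_sq_def using j by (intro mult_left_mono member_le_sum) auto
    finally show "norm (cos (y j / 2) - exp (- ((y j)\<^sup>2 / 8))) \<le> (y j)\<^sup>2 * norm_sq k y" by simp
  qed
  also have "\<dots> = (norm_sq k y)\<^sup>2" by (simp add: sum_distrib_right[symmetric] norm_sq_def power2_eq_square)
  finally have 1: "\<bar>diag_phi k y - (\<Prod>j<k. exp (- ((y j)\<^sup>2 / 8)))\<bar> \<le> (norm_sq k y)\<^sup>2" by (simp add: diag_phi_def)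
  have "(\<Prod>j<k. exp (- ((y j)\<^sup>2 / 8))) = exp (- (norm_sq k y / 8))"
    by (simp add: exp_sum[symmetric] norm_sq_def sum_negf sum_divide_distrib)
  with 1 have "\<bar>diag_phi k y - exp (- (norm_sq k y / 8))\<bar> \<le> (norm_sq k y)\<^sup>2" by simp
  moreover have "\<bar>1 - norm_sq k y / 8 - exp (- (norm_sq k y / 8))\<bar> \<le> (norm_sq k y)\<^sup>2 / 64"
    using exp_minus_taylor[of "norm_sq k y / 8"] by (simp add: power_divide)
  moreover have "0 \<le> (norm_sq k y)\<^sup>2" by simp
  ultimately show ?thesis by linarith
qed

text \<open>The modulus of the product is at most that of every factor, hence at most their average.
  The constant 200 is 4 times 50, from 1 - cos y = 2 (1 - cos^2(y/2)), which is at most 4 (1 -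
  |cos(y/2)|).\<close>

lemma diag_decay:
  assumes k: "k \<ge> 1" and y: "in_box k y"
  shows "\<bar>diag_phi k y\<bar> \<le> 1 - 1 / (200 * real k) * norm_sq k y"
proof -
  have one: "\<bar>cos (y i / 2)\<bar> \<le> 1 - (y i)\<^sup>2 / 200" if "i < k" for i
  proof -
    have "- (pi / 2) \<le> y i" "y i \<le> 3 * pi / 2" using y that by auto
    moreover have "0 < pi" by simp
    ultimately have "\<bar>y i\<bar> \<le> 3 * pi / 2" by (intro abs_leI; linarith)
    then have "(y i)\<^sup>2 / 50 \<le> 1 - cos (y i)" by (rule one_minus_cos_ge)
    also have "\<dots> = 2 * (1 - \<bar>cos (y i / 2)\<bar>\<^sup>2)" using cos_double_cos[of "y i / 2"] by simp
    also have "\<dots> = 2 * (1 + \<bar>cos (y i / 2)\<bar>) * (1 - \<bar>cos (y i / 2)\<bar>)"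
      by (simp only: power2_eq_square) (simp add: algebra_simps)
    also have "\<dots> \<le> 4 * (1 - \<bar>cos (y i / 2)\<bar>)"
    proof -
      have "\<bar>cos (y i / 2)\<bar> \<le> 1" by simp
      then show ?thesis by (intro mult_right_mono) auto
    qed
    finally have "(y i)\<^sup>2 / 50 \<le> 4 * (1 - \<bar>cos (y i / 2)\<bar>)" .
    moreover have "a \<le> 1 - b / 200" if "b / 50 \<le> 4 * (1 - a)" for a b :: real using that by (simp add: field_simps)
    ultimately show ?thesis by blast
  qed
  have "\<bar>diag_phi k y\<bar> \<le> \<bar>cos (y i / 2)\<bar>" if "i < k" for i
  proof -
    have "\<bar>diag_phi k y\<bar> = \<bar>cos (y i / 2)\<bar> * (\<Prod>j\<in>{..<k} - {i}. \<bar>cos (y j / 2)\<bar>)"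
      unfolding diag_phi_def abs_prod using that by (intro prod.remove) auto
    also have "\<dots> \<le> \<bar>cos (y i / 2)\<bar> * 1" by (intro mult_left_mono prod_le_1) auto
    finally show ?thesis by simp
  qed
  then have "(\<Sum>i<k. \<bar>diag_phi k y\<bar>) \<le> (\<Sum>i<k. 1 - (y i)\<^sup>2 / 200)"
    using one by (intro sum_mono) (meson lessThan_iff order_trans)
  then have "real k * \<bar>diag_phi k y\<bar> \<le> real k - norm_sq k y / 200"
    by (simp add: sum_subtractf norm_sq_def sum_divide_distrib)
  then have "real k * \<bar>diag_phi k y\<bar> \<le> real k * (1 - 1 / (200 * real k) * norm_sq k y)"
    using k by (simp add: algebra_simps)
  then show ?thesis using k by (simp only: mult_le_cancel_left_pos of_nat_0_less_iff)
qed

lemma diag_weyl_walk: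
  assumes k: "k \<ge> 1" and c: "c > 0"
  shows "weyl_walk_asymp k (rescale c ` diagonal_steps k) (2 * c) (diag_adm k) (diag_phi k) (1 / 4) 2"
proof
  let ?A = "rescale c ` diagonal_steps k"
  show "1 \<le> k" "finite ?A" "0 < 2 * c" using k c finite_diagonal_steps by auto
  show "?A \<subseteq> vec_space k"
  proof -
    have "diag_vec k x \<in> vec_space k" for x by (simp add: vec_space_def diag_vec_def)
    then show ?thesis unfolding rescale_diagonal_steps by blast
  qed
  show "walk_symbol k ?A (2 * c) z * alternant k b z = (\<Sum>a\<in>?A. alternant k (\<lambda>i. b i + a (Suc i) / (2 * c)) z)" for b z
    by (rule diag_symbol_altern[OF c])
  have half: "a (Suc i) / (2 * c) = 1 / 2 \<or> a (Suc i) / (2 * c) = - 1 / 2" if a: "a \<in> ?A" and i: "i < k" for a i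
  proof -
    obtain x where x: "a = diag_vec k x" "x \<in> sign_vecs k c" using a unfolding rescale_diagonal_steps by auto
    then have "x i \<in> {c, - c}" using PiE_mem[OF x(2), of i] i by auto
    then show ?thesis using x(1) i c by (auto simp: diag_vec_Suc)
  qed
  show "diag_adm k m (\<lambda>i. b i + a (Suc i) / (2 * c)) e" if ad: "diag_adm k (Suc m) b e" and mem: "a \<in> ?A" for m b e a
  proof -
    obtain \<beta> where e: "e \<le> 1" and \<beta>: "\<forall>j<k. b j = of_int (\<beta> j) - (real e + real (Suc m)) / 2"
      using ad by (auto simp: diag_adm_def)
    define \<beta>' where "\<beta>' j = (if a (Suc j) / (2 * c) = 1 / 2 then \<beta> j else \<beta> j - 1)" for j
    have "b j + a (Suc j) / (2 * c) = of_int (\<beta>' j) - (real e + real m) / 2" if "j < k" for j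
      using \<beta> half[OF mem that] that by (auto simp: \<beta>'_def field_simps)
    then show ?thesis using e by (auto simp: diag_adm_def)
  qed
  show "e \<le> 1 \<and> (\<exists>\<beta>. \<forall>j<k. b j = of_int (\<beta> j) - of_nat e / 2)" if "diag_adm k 0 b e" for b e
    using that by (auto simp: diag_adm_def)
  show "chamber_coords k (\<lambda>i. b i + a (Suc i) / (2 * c)) \<or> (\<exists>i<k. b i + a (Suc i) / (2 * c) = 0)
      \<or> (\<exists>i j. i < k \<and> j < k \<and> i \<noteq> j \<and> b i + a (Suc i) / (2 * c) = b j + a (Suc j) / (2 * c))"
    if adm: "diag_adm k m b e" and ch: "chamber_coords k b" and a: "a \<in> ?A" for m b e a
  proof (rule chamber_or_wall[OF k])
    obtain \<beta> where \<beta>: "\<And>j. j < k \<Longrightarrow> b j = of_int (\<beta> j) - (real e + real m) / 2" using adm by (auto simp: diag_adm_def)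
    \<comment> \<open>Twice each coordinate is an integer and all coordinates agree modulo 1: the
      first one is at least 1/2 and neighbours differ by at least 1, so moves by 1/2 can at most
      reach a wall.\<close>
    have "0 < 2 * b 0" using ch by (simp add: chamber_coords_def)
    also have "2 * b 0 = of_int (2 * \<beta> 0 - int e - int m)" using \<beta>[of 0] k by (simp add: field_simps)
    finally have "1 \<le> 2 * \<beta> 0 - int e - int m" by linarith
    then have "1 \<le> real_of_int (2 * \<beta> 0 - int e - int m)" by linarith
    then have "1 / 2 \<le> b 0" using \<beta>[of 0] k by (simp add: field_simps)
    then show "0 \<le> b 0 + a (Suc 0) / (2 * c)" using half[OF a, of 0] k by auto
    fix i assume i: "Suc i < k"
    have "b i < b (Suc i)" using ch i by (auto simp: chamber_coords_def)
    then have "\<beta> i < \<beta> (Suc i)" using \<beta>[of i] \<beta>[of "Suc i"] i by simp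
    then have "real_of_int (\<beta> i + 1) \<le> real_of_int (\<beta> (Suc i))" by (simp only: of_int_le_iff)
    then have "b i + 1 \<le> b (Suc i)" using \<beta>[of i] \<beta>[of "Suc i"] i by simp
    then show "b i + a (Suc i) / (2 * c) \<le> b (Suc i) + a (Suc (Suc i)) / (2 * c)"
      using half[OF a, of i] half[OF a, of "Suc i"] i by auto
  qed
  have "card ?A \<noteq> 0" using card_diagonal_steps[OF c, of k] by simp
  then show "?A \<noteq> {}" by (metis card.empty)
  show "e \<le> 1" if "diag_adm k m b e" for m b e using that by (simp add: diag_adm_def)
  show "walk_symbol k ?A (2 * c) (imag_pt y) = of_real (real (card ?A) * diag_phi k y)" for y
  proof -
    have half: "Complex 0 t / 2 = Complex 0 (t / 2)" for t by (simp add: complex_eq_iff)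
    have "walk_symbol k ?A (2 * c) (imag_pt y) = (\<Prod>j<k. of_real (2 * cos (y j / 2)))"
      unfolding diag_symbol[OF c] half exp_imag_add ..
    also have "\<dots> = of_real (2 ^ k * diag_phi k y)"
      by (simp only: of_real_prod[symmetric] prod.distrib diag_phi_def) simp
    finally show ?thesis by (simp add: card_diagonal_steps[OF c])
  qed
  show "\<bar>diag_phi k y - (1 - 1 / 4 * norm_sq k y / 2)\<bar> \<le> 2 * (norm_sq k y)\<^sup>2" for y
    by (rule diag_phi_taylor)
qed simp_all

lemma diag_transitive:
  assumes c: "c > 0" and a: "a \<in> rescale c ` diagonal_steps k" and b: "b \<in> rescale c ` diagonal_steps k"
  shows "\<exists>\<rho>\<in>signed_perms k. \<rho> a = b"
proof -
  obtain x where x: "a = diag_vec k x" "x \<in> sign_vecs k c" using a unfolding rescale_diagonal_steps by auto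
  obtain x' where x': "b = diag_vec k x'" "x' \<in> sign_vecs k c" using b unfolding rescale_diagonal_steps by auto
  define s where "s i = (if a i = b i then 1 else -1 :: real)" for i
  define \<rho> where "\<rho> = (\<lambda>(x :: rvec) i. if i \<in> {1..k} then s i * x (id i) else 0)"
  have "\<rho> \<in> signed_perms k" unfolding signed_perms_def
    by (intro CollectI exI[of _ s] exI[of _ id] conjI permutes_id) (auto simp: \<rho>_def s_def)
  moreover have "\<rho> a = b"
  proof
    fix i
    show "\<rho> a i = b i"
    proof (cases "i \<in> {1..k}")
      case True
      then have "a i \<in> {c, - c}" "b i \<in> {c, - c}"
        using PiE_mem[OF x(2), of "i - 1"] PiE_mem[OF x'(2), of "i - 1"] by (auto simp: x x' diag_vec_def)
      then show ?thesis using True by (auto simp: \<rho>_def s_def)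
    next
      case False
      then show ?thesis by (auto simp: \<rho>_def x' diag_vec_def)
    qed
  qed
  ultimately show ?thesis by blast
qed

lemma walk_weight_asymptotics_diag:
  assumes k: "k \<ge> 1" and c: "c > 0" and A: "A = rescale c ` diagonal_steps k"
    and comp: "composite_step_set A S w" and inv: "prefix_invariant k S w"
    and pos: "step_gf_one k S w > 0" and ex: "\<exists>s\<in>S. s \<noteq> [] \<and> w s > 0"
    and u: "u \<in> chamber k \<inter> int_lattice A" and l: "l \<in> {1..k}"
  shows "\<exists>\<epsilon> :: nat \<Rightarrow> real. \<epsilon> \<in> O(\<lambda>n. 1 / real n) \<and>
    (\<forall>\<^sub>F n in sequentially.
      walk_weight k S w n u =
        step_gf_one k S w ^ n
        * (2 / pi) powr (real k / 2)
        * (step_gf_one k S w / (real n * step_gf_snd_deriv_one k S w l)) powr (real (k ^ 2) / 2)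
        * (\<Prod>j = 1..k. u j * fact (j - 1) / fact (2 * j - 1))
        * (\<Prod>m = 1..k. \<Prod>j = 1..<m. (u m)\<^sup>2 - (u j)\<^sup>2)
        * (1 + \<epsilon> n))"
proof -
  interpret weyl_walk_asymp k A "2 * c" "diag_adm k" "diag_phi k" "1 / 4" 2
    unfolding A by (rule diag_weyl_walk[OF k c])
  have uc: "u \<in> chamber k" using u by simp
  obtain N where N: "u = (\<lambda>i. \<Sum>a\<in>A. of_int (N a) * a i)" using u by (auto simp: int_lattice_def)
  \<comment> \<open>All coordinates of an atomic step are odd in units of c, so every coordinate of
    a lattice vector has the parity of the sum of its integer coefficients.\<close>
  define T where "T = (\<Sum>a\<in>A. N a)"
  define e where "e = nat (T mod 2)"
  have e: "e \<le> 1" "int e = T mod 2" unfolding e_def by auto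
  have "\<exists>\<beta>. coords u j = of_int \<beta> - real e / 2" if j: "j < k" for j
  proof -
    have "\<exists>\<delta>. a (Suc j) / c = 1 + 2 * of_int \<delta>" if a: "a \<in> A" for a
    proof -
      obtain x where x: "a = diag_vec k x" "x \<in> sign_vecs k c" using a unfolding A rescale_diagonal_steps by auto
      then have "x j \<in> {c, - c}" using PiE_mem[OF x(2), of j] j by auto
      then show ?thesis using c j
        by (intro exI[of _ "if x j = c then 0 else -1"]) (auto simp: x(1) diag_vec_Suc)
    qed
    then obtain \<delta> where \<delta>: "\<And>a. a \<in> A \<Longrightarrow> a (Suc j) / c = 1 + 2 * of_int (\<delta> a)" by metis
    have "2 * coords u j = u (Suc j) / c" using c by (simp add: coords_def)
    also have "\<dots> = (\<Sum>a\<in>A. of_int (N a) * (a (Suc j) / c))"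
      by (subst N) (simp add: sum_divide_distrib)
    also have "\<dots> = (\<Sum>a\<in>A. of_int (N a) * (1 + 2 * of_int (\<delta> a)))" by (simp add: \<delta>)
    also have "\<dots> = of_int T + 2 * of_int (\<Sum>a\<in>A. N a * \<delta> a)"
      by (simp add: T_def distrib_left sum.distrib sum_distrib_left mult_ac)
    also have "of_int T = (2 * of_int (T div 2) + real e :: real)"
    proof -
      have "T = 2 * (T div 2) + int e" unfolding e(2) by simp
      then have "real_of_int T = of_int (2 * (T div 2) + int e)" by (rule arg_cong)
      then show ?thesis by simp
    qed
    finally have "coords u j = of_int (T div 2 + int e + (\<Sum>a\<in>A. N a * \<delta> a)) - real e / 2"
      by (simp add: field_simps)
    then show ?thesis by blast
  qed
  then obtain \<beta> where \<beta>: "\<And>j. j < k \<Longrightarrow> coords u j = of_int (\<beta> j) - real e / 2" by metis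
  have ch: "chamber_coords k (coords u)" using uc chamber_iff by simp
  have cpos: "coords u j > 0" if "j < k" for j
    using ch chamber_coords_mono[OF ch, of 0 j] that by (cases "j = 0") (auto simp: chamber_coords_def)
  have \<beta>pos: "\<beta> j > 0" if "j < k" for j
  proof -
    have "0 < of_int (\<beta> j) - real e / 2" using cpos[OF that] \<beta>[OF that] by simp
    moreover have "0 \<le> real e / 2" by simp
    ultimately have "0 < real_of_int (\<beta> j)" by linarith
    then show ?thesis by simp
  qed
  show ?thesis
  \<comment> \<open>Every step exchanges Z^k and (Z + 1/2)^k, so the end parity is (e + m) mod 2.
    The \<beta> are positive, which allows \<open>nat\<close>.\<close>
  proof (rule walk_weight_asymptotics[where e = e and eps = "\<lambda>m. (e + m) mod 2" and n = "\<lambda>j. nat (\<beta> j)" and ?c0.0 = "1 / (200 * real k)", OF comp inv pos ex l _ _ _ uc e(1)])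
    show "\<exists>\<rho>\<in>signed_perms k. \<rho> a = b" if "a \<in> A" "b \<in> A" for a b
      using diag_transitive[OF c] that unfolding A by blast
    obtain l' where l': "l = Suc l'" "l' < k" using l by (cases l) auto
    have "(\<Sum>a\<in>A. a l) = (\<Sum>x\<in>sign_vecs k c. \<Prod>i<k. if i = l' then x i else 1)"
      unfolding A sum_diagonal_steps by (intro sum.cong refl) (simp add: l' diag_vec_Suc prod.delta)
    also have "\<dots> = (\<Prod>i<k. (if i = l' then c else 1) + (if i = l' then - c else 1))"
      by (rule sum_sign_vecs_prod[OF c, where g = "\<lambda>i t. if i = l' then t else 1"])
    also have "\<dots> = 0" using l' by (intro prod_zero bexI[of _ l']) auto
    finally show "(\<Sum>a\<in>A. a l) = 0" .
    have "(\<Sum>a\<in>A. (a l)\<^sup>2) = (\<Sum>a\<in>A. c\<^sup>2)"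
    proof (intro sum.cong refl)
      fix a assume "a \<in> A"
      then obtain x where x: "a = diag_vec k x" "x \<in> sign_vecs k c" unfolding A rescale_diagonal_steps by auto
      then have "x l' \<in> {c, - c}" using PiE_mem[OF x(2), of l'] l' by auto
      then show "(a l)\<^sup>2 = c\<^sup>2" using l' by (auto simp: x(1) diag_vec_Suc)
    qed
    then show "(\<Sum>a\<in>A. (a l)\<^sup>2) = real (card A) * (1 / 4) * (2 * c)\<^sup>2"
      by (simp add: power_mult_distrib)
    show "coords u j = real (nat (\<beta> j)) - real e / 2" if "j < k" for j
      using \<beta>[OF that] \<beta>pos[OF that] by simp
    show "diag_adm k m (coords u) ((e + m) mod 2)" for m
    proof -
      define q where "q = (e + m) div 2"
      have "real (2 * q + (e + m) mod 2) = real (e + m)" unfolding q_def by simp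
      then have eq: "real ((e + m) mod 2) = real e + real m - 2 * real q" by simp
      have "coords u j = of_int (\<beta> j + int m - int q) - (real ((e + m) mod 2) + real m) / 2" if "j < k" for j
        unfolding \<beta>[OF that] eq by (simp add: field_simps)
      then have "\<forall>j<k. coords u j = of_int (\<beta> j + int m - int q) - (real ((e + m) mod 2) + real m) / 2" by blast
      moreover have "(e + m) mod 2 \<le> 1" by simp
      ultimately show ?thesis
        unfolding diag_adm_def by (intro conjI exI[of _ "\<lambda>j. \<beta> j + int m - int q"])
    qed
    show "0 < 1 / (200 * real k)" using k by simp
    show "\<bar>diag_phi k y\<bar> \<le> 1 - 1 / (200 * real k) * norm_sq k y
      \<or> (e = 0 \<and> (\<forall>m. (e + m) mod 2 = 0) \<and> 1 \<le> norm_sq k y \<and> \<bar>diag_phi k y\<bar> \<le> 1 - 1 / (200 * real k) * norm_sq k (\<lambda>i. y i - pi))"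
      if "in_box k y" for y using diag_decay[OF k that] by blast
  qed
qed

theorem theorem3:
  fixes k :: nat and A :: "rvec set" and S :: "rvec list set" and w :: "rvec list \<Rightarrow> real"
    and c :: real and u :: rvec and l :: nat
  assumes "k \<ge> 1"
    and "c > 0"
    and "A = rescale c ` axis_steps k \<or> A = rescale c ` diagonal_steps k"
    and "composite_step_set A S w"
    and "prefix_invariant k S w"
    and "step_gf_one k S w > 0"
    and "\<exists>s\<in>S. s \<noteq> [] \<and> w s > 0"
    and "u \<in> chamber k \<inter> int_lattice A"
    and "l \<in> {1..k}"
  shows "\<exists>\<epsilon> :: nat \<Rightarrow> real. \<epsilon> \<in> O(\<lambda>n. 1 / real n) \<and>
    (\<forall>\<^sub>F n in sequentially.
      walk_weight k S w n u =
        step_gf_one k S w ^ n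
        * (2 / pi) powr (real k / 2)
        * (step_gf_one k S w / (real n * step_gf_snd_deriv_one k S w l)) powr (real (k ^ 2) / 2)
        * (\<Prod>j = 1..k. u j * fact (j - 1) / fact (2 * j - 1))
        * (\<Prod>m = 1..k. \<Prod>j = 1..<m. (u m)\<^sup>2 - (u j)\<^sup>2)
        * (1 + \<epsilon> n))"
  using assms(3)
proof
  assume "A = rescale c ` axis_steps k"
  then show ?thesis by (rule walk_weight_asymptotics_axis[OF assms(1,2) _ assms(4-9)])
next
  assume "A = rescale c ` diagonal_steps k"
  then show ?thesis by (rule walk_weight_asymptotics_diag[OF assms(1,2) _ assms(4-9)])
qed

end
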